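(* Let $X$ be an object of $\mathcal C$ and let $S\in\operatorname{Irr}(\mathcal C)$. Then $$d(S)\operatorname{id}_{X\otimes S}=\sum_{T,b}d(T)\,(\operatorname{id}_X\otimes b^* )\circ(\mathrm{coev}_X\otimes\operatorname{id}_T)\circ(\widetilde{\mathrm{ev}}_X\otimes\operatorname{id}_T)\circ(\operatorname{id}_X\otimes b),$$ where $T$ ranges over $\operatorname{Irr}(\mathcal C)$ and $b$ ranges over a basis of $\operatorname{Hom}_{\mathcal C}(S,X^\vee T)$. Also $$d(S)\operatorname{id}_{S\otimes X}=\sum_{T,b}d(T)\,(b^*\otimes\operatorname{id}_X)\circ(\operatorname{id}_T\otimes\widetilde{\mathrm{coev}}_X)\circ(\operatorname{id}_T\otimes\mathrm{ev}_X)\circ(b\otimes\operatorname{id}_X),$$ where $T$ ranges over $\operatorname{Irr}(\mathcal C)$ and $b$ ranges over a basis of $\operatorname{Hom}_{\mathcal C}(S,TX^\vee)$.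
   Context: $\mathbb K$ is an algebraically closed field and $\mathcal C$ is a modular tensor category over $\mathbb K$ (semisimple $\mathbb K$-linear ribbon category with finite-dimensional Hom spaces, finitely many isomorphism classes of simple objects, simple tensor unit $\mathbf 1$, and invertible $S$-matrix). Tensor product is written by juxtaposition or $\otimes$; associativity and unit isomorphisms are suppressed. $\operatorname{Irr}(\mathcal C)$ is a complete set of representatives of simple objects. Left and right duals are identified by the pivotal structure and written $X^\vee$, with maps $\mathrm{ev}_X:X^\vee X\to\mathbf 1$, $\mathrm{coev}_X:\mathbf 1\to XX^\vee$, $\widetilde{\mathrm{ev}}_X:XX^\vee\to\mathbf 1$, $\widetilde{\mathrm{coev}}_X:\mathbf 1\to X^\vee X$. For $f\in\operatorname{End}_{\mathcal C}(X)$, $\operatorname{tr}(f)=\widetilde{\mathrm{ev}}_X\circ(f\otimes\operatorname{id}_{X^\vee})\circ\mathrm{coev}_X\in\operatorname{End}_{\mathcal C}(\mathbf 1)=\mathbb K$, and $d(X)=\operatorname{tr}(\operatorname{id}_X)$. For $S$ simple, $W$ any object and a basis $\{b\}$ of $\operatorname{Hom}_{\mathcal C}(S,W)$, $\{b^*\}$ is the dual basis of $\operatorname{Hom}_{\mathcal C}(W,S)$ with respect to the perfect pairing $f\otimes g\mapsto g\circ f\in\operatorname{End}_{\mathcal C}(S)=\mathbb K$. *)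

theory Defs
  imports "HOL-Computational_Algebra.Polynomial"
begin

text \<open>
  Every element of the type \<open>'o\<close> is an object. The Hom spaces are subspaces of one ambient
  \<open>'k\<close>-vector space \<open>'m\<close>; nothing is required of their intersections, and nothing is required of
  the operations outside the Hom spaces. This loses no generality: for a \<open>'k\<close>-linear category take
  for \<open>'m\<close> the direct sum of all Hom spaces, and extend composition and tensor product of morphisms
  bilinearly (composition by zero on non-composable summands). Associativity and unit isomorphisms
  are part of the structure; monoidal categories are not assumed to be strict.
\<close>

record ('o, 'm, 'k) ribbon_data =
  Hom :: "'o \<Rightarrow> 'o \<Rightarrow> 'm set"
  scale :: "'k \<Rightarrow> 'm \<Rightarrow> 'm"  (infixr \<open>\<odot>\<index>\<close> 75)
  ide :: "'o \<Rightarrow> 'm"  (\<open>ide\<index>\<close>)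
  comp :: "'m \<Rightarrow> 'm \<Rightarrow> 'm"  (infixr \<open>\<cdot>\<index>\<close> 60)
  unit :: 'o  (\<open>\<one>\<index>\<close>)
  tensor :: "'o \<Rightarrow> 'o \<Rightarrow> 'o"  (infixr \<open>\<otimes>\<index>\<close> 80)
  tensor_mor :: "'m \<Rightarrow> 'm \<Rightarrow> 'm"  (infixr \<open>\<otimes>\<^sub>m\<index>\<close> 70)
  associator :: "'o \<Rightarrow> 'o \<Rightarrow> 'o \<Rightarrow> 'm"  (\<open>\<alpha>\<index>\<close>)
  left_unitor :: "'o \<Rightarrow> 'm"  (\<open>\<l>\<index>\<close>)
  right_unitor :: "'o \<Rightarrow> 'm"  (\<open>\<r>\<index>\<close>)
  braiding :: "'o \<Rightarrow> 'o \<Rightarrow> 'm"  (\<open>\<c>\<index>\<close>)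
  dual :: "'o \<Rightarrow> 'o"  (\<open>(\<open>notation=\<open>postfix dual\<close>\<close>_\<^sup>\<or>\<index>)\<close> [1000] 999)
  ev :: "'o \<Rightarrow> 'm"  (\<open>ev\<index>\<close>)
  coev :: "'o \<Rightarrow> 'm"  (\<open>coev\<index>\<close>)
  twist :: "'o \<Rightarrow> 'm"  (\<open>\<theta>\<index>\<close>)

locale linear_category = vector_space "scale C"
  for C :: "('o, 'm::ab_group_add, 'k::field) ribbon_data" (structure) +
  assumes subspace_Hom: "subspace (Hom C X Y)"
    and ide_in_Hom: "ide X \<in> Hom C X X"
    and comp_in_Hom: "\<lbrakk>g \<in> Hom C Y Z; f \<in> Hom C X Y\<rbrakk> \<Longrightarrow> g \<cdot> f \<in> Hom C X Z"
    and comp_ide_left: "f \<in> Hom C X Y \<Longrightarrow> ide Y \<cdot> f = f"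
    and comp_ide_right: "f \<in> Hom C X Y \<Longrightarrow> f \<cdot> ide X = f"
    and comp_assoc: "\<lbrakk>h \<in> Hom C Y Z; g \<in> Hom C X Y; f \<in> Hom C W X\<rbrakk> \<Longrightarrow> (h \<cdot> g) \<cdot> f = h \<cdot> (g \<cdot> f)"
    and comp_add_left: "\<lbrakk>g \<in> Hom C Y Z; g' \<in> Hom C Y Z; f \<in> Hom C X Y\<rbrakk>
          \<Longrightarrow> (g + g') \<cdot> f = (g \<cdot> f) + (g' \<cdot> f)"
    and comp_add_right: "\<lbrakk>g \<in> Hom C Y Z; f \<in> Hom C X Y; f' \<in> Hom C X Y\<rbrakk>
          \<Longrightarrow> g \<cdot> (f + f') = (g \<cdot> f) + (g \<cdot> f')"
    and comp_scale_left: "\<lbrakk>g \<in> Hom C Y Z; f \<in> Hom C X Y\<rbrakk> \<Longrightarrow> (a \<odot> g) \<cdot> f = a \<odot> (g \<cdot> f)"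
    and comp_scale_right: "\<lbrakk>g \<in> Hom C Y Z; f \<in> Hom C X Y\<rbrakk> \<Longrightarrow> g \<cdot> (a \<odot> f) = a \<odot> (g \<cdot> f)"

text \<open>Since Hom spaces may overlap, properties of morphisms carry source and target explicitly.\<close>

definition inverse_mor :: "('o, 'm, 'k) ribbon_data \<Rightarrow> 'o \<Rightarrow> 'o \<Rightarrow> 'm \<Rightarrow> 'm \<Rightarrow> bool"
  where "inverse_mor C X Y f g \<longleftrightarrow>
    f \<in> Hom C X Y \<and> g \<in> Hom C Y X \<and> g \<cdot>\<^bsub>C\<^esub> f = ide\<^bsub>C\<^esub> X \<and> f \<cdot>\<^bsub>C\<^esub> g = ide\<^bsub>C\<^esub> Y"

definition iso :: "('o, 'm, 'k) ribbon_data \<Rightarrow> 'o \<Rightarrow> 'o \<Rightarrow> 'm \<Rightarrow> bool"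
  where "iso C X Y f \<longleftrightarrow> (\<exists>g. inverse_mor C X Y f g)"

definition inv_mor :: "('o, 'm, 'k) ribbon_data \<Rightarrow> 'o \<Rightarrow> 'o \<Rightarrow> 'm \<Rightarrow> 'm"
  where "inv_mor C X Y f = (THE g. inverse_mor C X Y f g)"

definition isomorphic :: "('o, 'm, 'k) ribbon_data \<Rightarrow> 'o \<Rightarrow> 'o \<Rightarrow> bool"
  where "isomorphic C X Y \<longleftrightarrow> (\<exists>f. iso C X Y f)"

definition monic :: "('o, 'm, 'k) ribbon_data \<Rightarrow> 'o \<Rightarrow> 'o \<Rightarrow> 'm \<Rightarrow> bool"
  where "monic C X Y f \<longleftrightarrow> f \<in> Hom C X Y \<and>
    (\<forall>Z. \<forall>g\<in>Hom C Z X. \<forall>h\<in>Hom C Z X. f \<cdot>\<^bsub>C\<^esub> g = f \<cdot>\<^bsub>C\<^esub> h \<longrightarrow> g = h)"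

definition epic :: "('o, 'm, 'k) ribbon_data \<Rightarrow> 'o \<Rightarrow> 'o \<Rightarrow> 'm \<Rightarrow> bool"
  where "epic C X Y f \<longleftrightarrow> f \<in> Hom C X Y \<and>
    (\<forall>Z. \<forall>g\<in>Hom C Y Z. \<forall>h\<in>Hom C Y Z. g \<cdot>\<^bsub>C\<^esub> f = h \<cdot>\<^bsub>C\<^esub> f \<longrightarrow> g = h)"

definition is_kernel :: "('o, 'm::zero, 'k) ribbon_data \<Rightarrow> 'o \<Rightarrow> 'o \<Rightarrow> 'o \<Rightarrow> 'm \<Rightarrow> 'm \<Rightarrow> bool"
  where "is_kernel C K X Y k f \<longleftrightarrow>
    k \<in> Hom C K X \<and> f \<in> Hom C X Y \<and> f \<cdot>\<^bsub>C\<^esub> k = 0 \<and>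
    (\<forall>Z. \<forall>g\<in>Hom C Z X. f \<cdot>\<^bsub>C\<^esub> g = 0 \<longrightarrow> (\<exists>!h. h \<in> Hom C Z K \<and> k \<cdot>\<^bsub>C\<^esub> h = g))"

definition is_cokernel :: "('o, 'm::zero, 'k) ribbon_data \<Rightarrow> 'o \<Rightarrow> 'o \<Rightarrow> 'o \<Rightarrow> 'm \<Rightarrow> 'm \<Rightarrow> bool"
  where "is_cokernel C X Y Q q f \<longleftrightarrow>
    q \<in> Hom C Y Q \<and> f \<in> Hom C X Y \<and> q \<cdot>\<^bsub>C\<^esub> f = 0 \<and>
    (\<forall>Z. \<forall>g\<in>Hom C Y Z. g \<cdot>\<^bsub>C\<^esub> f = 0 \<longrightarrow> (\<exists>!h. h \<in> Hom C Q Z \<and> h \<cdot>\<^bsub>C\<^esub> q = g))"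

text \<open>\<open>P\<close> is a direct sum of \<open>F 0, \<dots>, F (n - 1)\<close>; for \<open>n = 0\<close> this says that \<open>P\<close> is a zero object.\<close>

definition is_direct_sum ::
    "('o, 'm::ab_group_add, 'k) ribbon_data \<Rightarrow> 'o \<Rightarrow> nat \<Rightarrow> (nat \<Rightarrow> 'o) \<Rightarrow> bool"
  where "is_direct_sum C P n F \<longleftrightarrow>
    (\<exists>i p. (\<forall>j<n. i j \<in> Hom C (F j) P \<and> p j \<in> Hom C P (F j)) \<and>
           (\<forall>j<n. \<forall>l<n. p j \<cdot>\<^bsub>C\<^esub> i l = (if j = l then ide\<^bsub>C\<^esub> (F j) else 0)) \<and>
           (\<Sum>j<n. i j \<cdot>\<^bsub>C\<^esub> p j) = ide\<^bsub>C\<^esub> P)"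

definition zero_object :: "('o, 'm::zero, 'k) ribbon_data \<Rightarrow> 'o \<Rightarrow> bool"
  where "zero_object C X \<longleftrightarrow> (\<forall>Y. Hom C X Y = {0} \<and> Hom C Y X = {0})"

definition simple :: "('o, 'm::zero, 'k) ribbon_data \<Rightarrow> 'o \<Rightarrow> bool"
  where "simple C S \<longleftrightarrow> \<not> zero_object C S \<and>
    (\<forall>Y f. monic C Y S f \<longrightarrow> zero_object C Y \<or> iso C Y S f)"

locale abelian_linear_category = linear_category +
  assumes ex_direct_sum: "\<exists>P. is_direct_sum C P n F"
    and ex_kernel: "f \<in> Hom C X Y \<Longrightarrow> \<exists>K k. is_kernel C K X Y k f"
    and ex_cokernel: "f \<in> Hom C X Y \<Longrightarrow> \<exists>Q q. is_cokernel C X Y Q q f"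
    and monic_is_kernel: "monic C K X k \<Longrightarrow> \<exists>Y f. is_kernel C K X Y k f"
    and epic_is_cokernel: "epic C Y Q q \<Longrightarrow> \<exists>X f. is_cokernel C X Y Q q f"

locale semisimple_linear_category = abelian_linear_category +
  assumes semisimple: "\<exists>n F. (\<forall>j<n. simple C (F j)) \<and> is_direct_sum C X n F"

definition associator_inv :: "('o, 'm, 'k) ribbon_data \<Rightarrow> 'o \<Rightarrow> 'o \<Rightarrow> 'o \<Rightarrow> 'm"  (\<open>\<alpha>inv\<index>\<close>)
  where "\<alpha>inv\<^bsub>C\<^esub> X Y Z =
    inv_mor C ((X \<otimes>\<^bsub>C\<^esub> Y) \<otimes>\<^bsub>C\<^esub> Z) (X \<otimes>\<^bsub>C\<^esub> (Y \<otimes>\<^bsub>C\<^esub> Z)) (\<alpha>\<^bsub>C\<^esub> X Y Z)"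

locale monoidal_linear_category = linear_category +
  assumes tensor_in_Hom: "\<lbrakk>f \<in> Hom C X Y; g \<in> Hom C V W\<rbrakk> \<Longrightarrow> f \<otimes>\<^sub>m g \<in> Hom C (X \<otimes> V) (Y \<otimes> W)"
    and tensor_ide: "ide X \<otimes>\<^sub>m ide Y = ide (X \<otimes> Y)"
    and interchange: "\<lbrakk>f \<in> Hom C X Y; g \<in> Hom C Y Z; f' \<in> Hom C X' Y'; g' \<in> Hom C Y' Z'\<rbrakk>
          \<Longrightarrow> (g \<cdot> f) \<otimes>\<^sub>m (g' \<cdot> f') = (g \<otimes>\<^sub>m g') \<cdot> (f \<otimes>\<^sub>m f')"
    and tensor_add_left: "\<lbrakk>f \<in> Hom C X Y; f' \<in> Hom C X Y; g \<in> Hom C V W\<rbrakk>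
          \<Longrightarrow> (f + f') \<otimes>\<^sub>m g = (f \<otimes>\<^sub>m g) + (f' \<otimes>\<^sub>m g)"
    and tensor_add_right: "\<lbrakk>f \<in> Hom C X Y; g \<in> Hom C V W; g' \<in> Hom C V W\<rbrakk>
          \<Longrightarrow> f \<otimes>\<^sub>m (g + g') = (f \<otimes>\<^sub>m g) + (f \<otimes>\<^sub>m g')"
    and tensor_scale_left: "\<lbrakk>f \<in> Hom C X Y; g \<in> Hom C V W\<rbrakk> \<Longrightarrow> (a \<odot> f) \<otimes>\<^sub>m g = a \<odot> (f \<otimes>\<^sub>m g)"
    and tensor_scale_right: "\<lbrakk>f \<in> Hom C X Y; g \<in> Hom C V W\<rbrakk> \<Longrightarrow> f \<otimes>\<^sub>m (a \<odot> g) = a \<odot> (f \<otimes>\<^sub>m g)"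
    and associator_iso: "iso C ((X \<otimes> Y) \<otimes> Z) (X \<otimes> (Y \<otimes> Z)) (\<alpha> X Y Z)"
    and associator_natural:
      "\<lbrakk>f \<in> Hom C X X'; g \<in> Hom C Y Y'; h \<in> Hom C Z Z'\<rbrakk>
          \<Longrightarrow> \<alpha> X' Y' Z' \<cdot> ((f \<otimes>\<^sub>m g) \<otimes>\<^sub>m h) = (f \<otimes>\<^sub>m (g \<otimes>\<^sub>m h)) \<cdot> \<alpha> X Y Z"
    and left_unitor_iso: "iso C (\<one> \<otimes> X) X (\<l> X)"
    and left_unitor_natural: "f \<in> Hom C X Y \<Longrightarrow> \<l> Y \<cdot> (ide \<one> \<otimes>\<^sub>m f) = f \<cdot> \<l> X"
    and right_unitor_iso: "iso C (X \<otimes> \<one>) X (\<r> X)"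
    and right_unitor_natural: "f \<in> Hom C X Y \<Longrightarrow> \<r> Y \<cdot> (f \<otimes>\<^sub>m ide \<one>) = f \<cdot> \<r> X"
    and pentagon:
      "\<alpha> W X (Y \<otimes> Z) \<cdot> \<alpha> (W \<otimes> X) Y Z
        = (ide W \<otimes>\<^sub>m \<alpha> X Y Z) \<cdot> \<alpha> W (X \<otimes> Y) Z \<cdot> (\<alpha> W X Y \<otimes>\<^sub>m ide Z)"
    and triangle: "(ide X \<otimes>\<^sub>m \<l> Y) \<cdot> \<alpha> X \<one> Y = \<r> X \<otimes>\<^sub>m ide Y"

locale braided_linear_category = monoidal_linear_category +
  assumes braiding_iso: "iso C (X \<otimes> Y) (Y \<otimes> X) (\<c> X Y)"
    and braiding_natural:
      "\<lbrakk>f \<in> Hom C X X'; g \<in> Hom C Y Y'\<rbrakk> \<Longrightarrow> \<c> X' Y' \<cdot> (f \<otimes>\<^sub>m g) = (g \<otimes>\<^sub>m f) \<cdot> \<c> X Y"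
    and hexagon:
      "\<alpha> Y Z X \<cdot> \<c> X (Y \<otimes> Z) \<cdot> \<alpha> X Y Z
        = (ide Y \<otimes>\<^sub>m \<c> X Z) \<cdot> \<alpha> Y X Z \<cdot> (\<c> X Y \<otimes>\<^sub>m ide Z)"
    and hexagon_inv:
      "\<alpha>inv Z X Y \<cdot> \<c> (X \<otimes> Y) Z \<cdot> \<alpha>inv X Y Z
        = (\<c> X Z \<otimes>\<^sub>m ide Y) \<cdot> \<alpha>inv X Z Y \<cdot> (ide X \<otimes>\<^sub>m \<c> Y Z)"

definition dual_mor :: "('o, 'm, 'k) ribbon_data \<Rightarrow> 'o \<Rightarrow> 'o \<Rightarrow> 'm \<Rightarrow> 'm"
  where "dual_mor C X Y f =
    \<l>\<^bsub>C\<^esub> (X\<^sup>\<or>\<^bsub>C\<^esub>)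
    \<cdot>\<^bsub>C\<^esub> (ev\<^bsub>C\<^esub> Y \<otimes>\<^sub>m\<^bsub>C\<^esub> ide\<^bsub>C\<^esub> (X\<^sup>\<or>\<^bsub>C\<^esub>))
    \<cdot>\<^bsub>C\<^esub> \<alpha>inv\<^bsub>C\<^esub> (Y\<^sup>\<or>\<^bsub>C\<^esub>) Y (X\<^sup>\<or>\<^bsub>C\<^esub>)
    \<cdot>\<^bsub>C\<^esub> (ide\<^bsub>C\<^esub> (Y\<^sup>\<or>\<^bsub>C\<^esub>) \<otimes>\<^sub>m\<^bsub>C\<^esub> (f \<otimes>\<^sub>m\<^bsub>C\<^esub> ide\<^bsub>C\<^esub> (X\<^sup>\<or>\<^bsub>C\<^esub>)))
    \<cdot>\<^bsub>C\<^esub> (ide\<^bsub>C\<^esub> (Y\<^sup>\<or>\<^bsub>C\<^esub>) \<otimes>\<^sub>m\<^bsub>C\<^esub> coev\<^bsub>C\<^esub> X)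
    \<cdot>\<^bsub>C\<^esub> inv_mor C (Y\<^sup>\<or>\<^bsub>C\<^esub> \<otimes>\<^bsub>C\<^esub> \<one>\<^bsub>C\<^esub>) (Y\<^sup>\<or>\<^bsub>C\<^esub>) (\<r>\<^bsub>C\<^esub> (Y\<^sup>\<or>\<^bsub>C\<^esub>))"

locale ribbon_linear_category = braided_linear_category +
  assumes ev_in_Hom: "ev X \<in> Hom C (X\<^sup>\<or> \<otimes> X) \<one>"
    and coev_in_Hom: "coev X \<in> Hom C \<one> (X \<otimes> X\<^sup>\<or>)"
    and zigzag:
      "\<r> X \<cdot> (ide X \<otimes>\<^sub>m ev X) \<cdot> \<alpha> X (X\<^sup>\<or>) X \<cdot> (coev X \<otimes>\<^sub>m ide X) \<cdot> inv_mor C (\<one> \<otimes> X) X (\<l> X)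
        = ide X"
    and zigzag_dual:
      "\<l> (X\<^sup>\<or>) \<cdot> (ev X \<otimes>\<^sub>m ide (X\<^sup>\<or>)) \<cdot> \<alpha>inv (X\<^sup>\<or>) X (X\<^sup>\<or>) \<cdot> (ide (X\<^sup>\<or>) \<otimes>\<^sub>m coev X)
          \<cdot> inv_mor C (X\<^sup>\<or> \<otimes> \<one>) (X\<^sup>\<or>) (\<r> (X\<^sup>\<or>))
        = ide (X\<^sup>\<or>)"
    and twist_iso: "iso C X X (\<theta> X)"
    and twist_natural: "f \<in> Hom C X Y \<Longrightarrow> \<theta> Y \<cdot> f = f \<cdot> \<theta> X"
    and twist_tensor: "\<theta> (X \<otimes> Y) = \<c> Y X \<cdot> \<c> X Y \<cdot> (\<theta> X \<otimes>\<^sub>m \<theta> Y)"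
    and twist_dual: "\<theta> (X\<^sup>\<or>) = dual_mor C X X (\<theta> X)"

text \<open>
  In a ribbon category the left dual \<open>X\<^sup>\<or>\<close> is also a right dual. These are the right duality
  morphisms for the pivotal structure determined by braiding and twist,
  \<open>tev X : X \<otimes> X\<^sup>\<or> \<rightarrow> \<one>\<close> and \<open>tcoev X : \<one> \<rightarrow> X\<^sup>\<or> \<otimes> X\<close>.
\<close>

definition tev :: "('o, 'm, 'k) ribbon_data \<Rightarrow> 'o \<Rightarrow> 'm"  (\<open>tev\<index>\<close>)
  where "tev\<^bsub>C\<^esub> X =
    ev\<^bsub>C\<^esub> X \<cdot>\<^bsub>C\<^esub> \<c>\<^bsub>C\<^esub> X (X\<^sup>\<or>\<^bsub>C\<^esub>) \<cdot>\<^bsub>C\<^esub> (\<theta>\<^bsub>C\<^esub> X \<otimes>\<^sub>m\<^bsub>C\<^esub> ide\<^bsub>C\<^esub> (X\<^sup>\<or>\<^bsub>C\<^esub>))"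

definition tcoev :: "('o, 'm, 'k) ribbon_data \<Rightarrow> 'o \<Rightarrow> 'm"  (\<open>tcoev\<index>\<close>)
  where "tcoev\<^bsub>C\<^esub> X =
    (ide\<^bsub>C\<^esub> (X\<^sup>\<or>\<^bsub>C\<^esub>) \<otimes>\<^sub>m\<^bsub>C\<^esub> inv_mor C X X (\<theta>\<^bsub>C\<^esub> X))
    \<cdot>\<^bsub>C\<^esub> inv_mor C (X\<^sup>\<or>\<^bsub>C\<^esub> \<otimes>\<^bsub>C\<^esub> X) (X \<otimes>\<^bsub>C\<^esub> X\<^sup>\<or>\<^bsub>C\<^esub>) (\<c>\<^bsub>C\<^esub> (X\<^sup>\<or>\<^bsub>C\<^esub>) X)
    \<cdot>\<^bsub>C\<^esub> coev\<^bsub>C\<^esub> X"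

text \<open>
  \<open>trace C X f\<close> is the scalar corresponding to an endomorphism of the tensor unit under
  \<open>End(\<one>) = 'k\<close>, which holds when the tensor unit is simple, Hom spaces are finite-dimensional and
  \<open>'k\<close> is algebraically closed.
\<close>

definition trace :: "('o, 'm, 'k) ribbon_data \<Rightarrow> 'o \<Rightarrow> 'm \<Rightarrow> 'k"
  where "trace C X f =
    (THE a. a \<odot>\<^bsub>C\<^esub> ide\<^bsub>C\<^esub> \<one>\<^bsub>C\<^esub> =
       tev\<^bsub>C\<^esub> X \<cdot>\<^bsub>C\<^esub> (f \<otimes>\<^sub>m\<^bsub>C\<^esub> ide\<^bsub>C\<^esub> (X\<^sup>\<or>\<^bsub>C\<^esub>)) \<cdot>\<^bsub>C\<^esub> coev\<^bsub>C\<^esub> X)"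

definition qdim :: "('o, 'm, 'k) ribbon_data \<Rightarrow> 'o \<Rightarrow> 'k"
  where "qdim C X = trace C X (ide\<^bsub>C\<^esub> X)"

definition simple_representatives :: "('o, 'm::zero, 'k) ribbon_data \<Rightarrow> 'o set \<Rightarrow> bool"
  where "simple_representatives C I \<longleftrightarrow>
    (\<forall>S\<in>I. simple C S) \<and> (\<forall>S. simple C S \<longrightarrow> (\<exists>!T. T \<in> I \<and> isomorphic C S T))"

definition S_matrix :: "('o, 'm, 'k) ribbon_data \<Rightarrow> 'o \<Rightarrow> 'o \<Rightarrow> 'k"
  where "S_matrix C X Y = trace C (X \<otimes>\<^bsub>C\<^esub> Y) (\<c>\<^bsub>C\<^esub> Y X \<cdot>\<^bsub>C\<^esub> \<c>\<^bsub>C\<^esub> X Y)"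

definition invertible_on :: "'i set \<Rightarrow> ('i \<Rightarrow> 'i \<Rightarrow> 'k::field) \<Rightarrow> bool"
  where "invertible_on I A \<longleftrightarrow>
    (\<exists>B. \<forall>i\<in>I. \<forall>j\<in>I. (\<Sum>l\<in>I. A i l * B l j) = (if i = j then 1 else 0) \<and>
                       (\<Sum>l\<in>I. B i l * A l j) = (if i = j then 1 else 0))"

text \<open>
  Finiteness of the set of isomorphism classes makes every set \<open>I\<close> of representatives finite; the
  invertibility of the S-matrix does not depend on the choice of \<open>I\<close>.
\<close>

locale modular_tensor_category =
  semisimple_linear_category C + ribbon_linear_category C
  for C :: "('o, 'm::ab_group_add, 'k::alg_closed_field) ribbon_data" (structure) +
  assumes finite_dim_Hom: "\<exists>B. finite B \<and> B \<subseteq> Hom C X Y \<and> span B = Hom C X Y"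
    and finitely_many_simples: "\<exists>I. finite I \<and> simple_representatives C I"
    and simple_unit: "simple C \<one>"
    and S_matrix_invertible: "simple_representatives C I \<Longrightarrow> invertible_on I (S_matrix C)"

definition Hom_basis ::
    "('o, 'm::ab_group_add, 'k::field) ribbon_data \<Rightarrow> 'o \<Rightarrow> 'o \<Rightarrow> 'm set \<Rightarrow> bool"
  where "Hom_basis C X Y B \<longleftrightarrow>
    B \<subseteq> Hom C X Y \<and> \<not> module.dependent (scale C) B \<and> module.span (scale C) B = Hom C X Y"

text \<open>
  For \<open>S\<close> simple, \<open>B\<close> a basis of \<open>Hom C S W\<close> and \<open>b \<in> B\<close>, this is the element \<open>b\<^sup>*\<close> of the basis of
  \<open>Hom C W S\<close> dual to \<open>B\<close> with respect to the perfect pairing given by composition, with values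
  in \<open>End(S) = 'k\<close>.
\<close>

definition dual_vector ::
    "('o, 'm::zero, 'k) ribbon_data \<Rightarrow> 'o \<Rightarrow> 'o \<Rightarrow> 'm set \<Rightarrow> 'm \<Rightarrow> 'm"
  where "dual_vector C S W B b =
    (THE g. g \<in> Hom C W S \<and> (\<forall>b'\<in>B. g \<cdot>\<^bsub>C\<^esub> b' = (if b' = b then ide\<^bsub>C\<^esub> S else 0)))"

end

theory Submission
  imports Defs
begin

text \<open>
  Write \<open>X'\<close> for the dual of \<open>X\<close>. Bending the strand \<open>X\<close> turns \<open>b : S \<rightarrow> X' \<otimes> T\<close> into
  \<open>cap b : X \<otimes> S \<rightarrow> T\<close> and \<open>g : X' \<otimes> T \<rightarrow> S\<close> into \<open>cup g : T \<rightarrow> X \<otimes> S\<close>, and the summand belonging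
  to \<open>b\<close> in the first formula is \<open>d(T) (cup b\<^sup>* \<circ> cap b)\<close>. The whole content is the identity
    \<open>tr\<^sub>T (cap b \<circ> cup g) = tr\<^sub>S (g \<circ> b)\<close>.
  It says that whenever \<open>g \<circ> b = a id\<^sub>S\<close> and \<open>cap b \<circ> cup g = c id\<^sub>T\<close>, the scalars satisfy
  \<open>d(T) c = d(S) a\<close>. By semisimplicity it suffices to compare both sides of the formula after
  precomposing with an arbitrary \<open>q : T \<rightarrow> X \<otimes> S\<close> from a simple object. The zigzag relations give \<open>q = cup g\<close> for some \<open>g\<close>;
  by Schur's lemma only the summands with this \<open>T\<close> survive, and they add up to
  \<open>d(S) \<Sum>\<^sub>b a\<^sub>b (cup b\<^sup>*)\<close> with \<open>g \<circ> b = a\<^sub>b id\<^sub>S\<close>. This is \<open>d(S) q\<close> since \<open>g = \<Sum>\<^sub>b a\<^sub>b b\<^sup>*\<close>.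
  The argument is \<open>resolution_of_identity\<close>; both halves of the
  theorem are instances of it.
  
  The trace identity is a deformation of diagrams. By cyclicity its left-hand side is the trace of
  \<open>cup g \<circ> cap b\<close> on \<open>X \<otimes> S\<close>. The trace of a tensor product is an iterated partial trace, and the
  partial trace over \<open>X\<close> straightens to \<open>g \<circ> b\<close> by two zigzags on the strand \<open>X'\<close>.
  Two facts make this work: the right duality morphisms, which are built from braiding and twist, are
  compatible with tensor products, because of the hexagons and of the formula for the twist of a
  tensor product; and they satisfy the zigzag relations, because the twist is compatible with duals.
  
  These deformations are carried out in a strict category, where diagrams need no associators. For
  that purpose the given category is embedded in its strictification, whose objects are lists of
  objects; the coherence isomorphisms enter only there.
\<close>


section \<open>Traces in strict balanced monoidal categories\<close>

text \<open>
  Objects are lists, so that associativity and unit laws hold on the nose already for objects.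
  Composition and tensor product are total operations on one type of arrows: an equation between
  composites can then be reassociated unconditionally, and side conditions concern only the validity
  of the arrows involved and the equality of sources and targets, both of which rewriting decides.
\<close>


locale strict_balanced_category =
  fixes arr :: "'x \<Rightarrow> bool" and src tgt :: "'x \<Rightarrow> 'a list" and id :: "'a list \<Rightarrow> 'x"
    and comp :: "'x \<Rightarrow> 'x \<Rightarrow> 'x" (infixr \<open>\<bullet>\<close> 60)
    and tens :: "'x \<Rightarrow> 'x \<Rightarrow> 'x" (infixr \<open>\<star>\<close> 70)
    and br bri :: "'a list \<Rightarrow> 'a list \<Rightarrow> 'x" and tw twi :: "'a list \<Rightarrow> 'x"
  assumes comp_assoc [simp]: "(f \<bullet> g) \<bullet> h = f \<bullet> (g \<bullet> h)"
    and src_comp [simp]: "src (f \<bullet> g) = src g"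
    and tgt_comp [simp]: "tgt (f \<bullet> g) = tgt f"
    and arr_comp [simp]: "\<lbrakk>arr f; arr g\<rbrakk> \<Longrightarrow> arr (f \<bullet> g)"
    and id_typing [simp]: "arr (id A)" "src (id A) = A" "tgt (id A) = A"
    and comp_id [simp]: "\<lbrakk>arr f; src f = A\<rbrakk> \<Longrightarrow> f \<bullet> id A = f"
    and id_comp [simp]: "\<lbrakk>arr f; tgt f = A\<rbrakk> \<Longrightarrow> id A \<bullet> f = f"
    and src_tens [simp]: "src (f \<star> g) = src f @ src g"
    and tgt_tens [simp]: "tgt (f \<star> g) = tgt f @ tgt g"
    and arr_tens [simp]: "\<lbrakk>arr f; arr g\<rbrakk> \<Longrightarrow> arr (f \<star> g)"
    and tens_assoc [simp]: "\<lbrakk>arr f; arr g; arr h\<rbrakk> \<Longrightarrow> (f \<star> g) \<star> h = f \<star> (g \<star> h)"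
    and tens_unit [simp]: "arr f \<Longrightarrow> id [] \<star> f = f" "arr f \<Longrightarrow> f \<star> id [] = f"
    and tens_id [simp]: "id A \<star> id B = id (A @ B)"
    and interchange: "\<lbrakk>arr f; arr g; arr h; arr k; src f = tgt h; src g = tgt k\<rbrakk>
          \<Longrightarrow> (f \<star> g) \<bullet> (h \<star> k) = (f \<bullet> h) \<star> (g \<bullet> k)"
    and br_typing [simp]: "arr (br A B)" "src (br A B) = A @ B" "tgt (br A B) = B @ A"
    and bri_typing [simp]: "arr (bri A B)" "src (bri A B) = B @ A" "tgt (bri A B) = A @ B"
    and bri_br: "bri A B \<bullet> br A B = id (A @ B)"
    and br_bri: "br A B \<bullet> bri A B = id (B @ A)"
    and br_natural: "\<lbrakk>arr f; arr g\<rbrakk>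
          \<Longrightarrow> br (tgt f) (tgt g) \<bullet> (f \<star> g) = (g \<star> f) \<bullet> br (src f) (src g)"
    and br_tens_right: "br A (B @ D) = (id B \<star> br A D) \<bullet> (br A B \<star> id D)"
    and br_tens_left: "br (A @ B) D = (br A D \<star> id B) \<bullet> (id A \<star> br B D)"
    and tw_typing [simp]: "arr (tw A)" "src (tw A) = A" "tgt (tw A) = A"
    and twi_typing [simp]: "arr (twi A)" "src (twi A) = A" "tgt (twi A) = A"
    and twi_tw: "twi A \<bullet> tw A = id A"
    and tw_twi: "tw A \<bullet> twi A = id A"
    and tw_natural: "arr f \<Longrightarrow> tw (tgt f) \<bullet> f = f \<bullet> tw (src f)"
    and tw_tens: "tw (A @ B) = br B A \<bullet> br A B \<bullet> (tw A \<star> tw B)"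
begin

lemma whisker_left_comp: "\<lbrakk>arr f; arr g; src f = tgt g\<rbrakk> \<Longrightarrow> id A \<star> (f \<bullet> g) = (id A \<star> f) \<bullet> (id A \<star> g)"
  by (simp add: interchange)

lemma whisker_right_comp: "\<lbrakk>arr f; arr g; src f = tgt g\<rbrakk> \<Longrightarrow> (f \<bullet> g) \<star> id A = (f \<star> id A) \<bullet> (g \<star> id A)"
  by (simp add: interchange)

lemma id_id_tens [simp]: "arr f \<Longrightarrow> id A \<star> (id B \<star> f) = id (A @ B) \<star> f"
  by (metis id_typing(1) tens_assoc tens_id)

lemma tens_split: "\<lbrakk>arr f; arr g; tgt g = B; src f = A\<rbrakk> \<Longrightarrow> f \<star> g = (f \<star> id B) \<bullet> (id A \<star> g)"
  by (simp add: interchange)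

lemma tens_split': "\<lbrakk>arr f; arr g; src g = B; tgt f = A\<rbrakk> \<Longrightarrow> f \<star> g = (id A \<star> g) \<bullet> (f \<star> id B)"
  by (simp add: interchange)

lemma exchange: "\<lbrakk>arr f; arr g; tgt g = B; src f = A; src g = B'; tgt f = A'\<rbrakk> \<Longrightarrow>
   (f \<star> id B) \<bullet> (id A \<star> g) = (id A' \<star> g) \<bullet> (f \<star> id B')"
  by (simp add: interchange)

lemma exchange_comp: "\<lbrakk>arr f; arr g; tgt g = B; src f = A; src g = B'; tgt f = A'\<rbrakk> \<Longrightarrow>
   (f \<star> id B) \<bullet> (id A \<star> g) \<bullet> h = (id A' \<star> g) \<bullet> (f \<star> id B') \<bullet> h"
  by (metis comp_assoc exchange)

lemmas whisker = whisker_left_comp whisker_right_comp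

text \<open>
  An invertible idempotent is an identity; this normalises braidings and twists at the unit.
\<close>

lemma idem_iso:
  assumes "arr f" "tgt f = A" "f \<bullet> f = f" "g \<bullet> f = id A"
  shows "f = id A"
  by (metis assms comp_assoc id_comp)

lemma br_unit_right: "br A [] = id A"
proof (rule idem_iso)
  show "br A [] \<bullet> br A [] = br A []" using br_tens_right[of A "[]" "[]"] by simp
  show "bri A [] \<bullet> br A [] = id A" using bri_br[of A "[]"] by simp
qed simp_all

lemma br_unit_left: "br [] A = id A"
proof (rule idem_iso)
  show "br [] A \<bullet> br [] A = br [] A" using br_tens_left[of "[]" "[]" A] by simp
  show "bri [] A \<bullet> br [] A = id A" using bri_br[of "[]" A] by simp
qed simp_all

lemma tw_unit: "tw [] = id []"
proof (rule idem_iso)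
  show "tw [] \<bullet> tw [] = tw []"
    using tw_tens[of "[]" "[]"] by (simp add: br_unit_left tens_split[of "tw []" "tw []" "[]" "[]"])
  show "twi [] \<bullet> tw [] = id []" by (rule twi_tw)
qed simp_all

lemma br_natural_left: "\<lbrakk>arr f; src f = A; tgt f = A'\<rbrakk> \<Longrightarrow> br A' B \<bullet> (f \<star> id B) = (id B \<star> f) \<bullet> br A B"
  using br_natural[of f "id B"] by simp
lemma br_natural_right: "\<lbrakk>arr f; src f = A; tgt f = A'\<rbrakk> \<Longrightarrow> br B A' \<bullet> (id B \<star> f) = (f \<star> id B) \<bullet> br B A"
  using br_natural[of "id B" f] by simp

subsection \<open>Dual pairs and cyclicity of the trace\<close>

text \<open>
  The dual may be any list \<open>A'\<close>, so that the reversed list of duals can serve as the dual of a tensor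
  product.
\<close>

definition dual_pair :: "'a list \<Rightarrow> 'a list \<Rightarrow> 'x \<Rightarrow> 'x \<Rightarrow> bool" where
  "dual_pair A A' e k \<longleftrightarrow> arr e \<and> src e = A' @ A \<and> tgt e = [] \<and> arr k \<and> src k = [] \<and> tgt k = A @ A' \<and>
     (id A \<star> e) \<bullet> (k \<star> id A) = id A \<and> (e \<star> id A') \<bullet> (id A' \<star> k) = id A'"

lemma dual_pairD:
  assumes "dual_pair A A' e k"
  shows "arr e" "src e = A' @ A" "tgt e = []" "arr k" "src k = []" "tgt k = A @ A'"
    and "(id A \<star> e) \<bullet> (k \<star> id A) = id A" "(e \<star> id A') \<bullet> (id A' \<star> k) = id A'"
  using assms by (auto simp: dual_pair_def)

text \<open>
  The dual morphism of \<open>v : A \<rightarrow> B\<close>.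
\<close>

definition transpose :: "'x \<Rightarrow> 'a list \<Rightarrow> 'x \<Rightarrow> 'a list \<Rightarrow> 'x \<Rightarrow> 'x" where
  "transpose eB B' kA A' v = (eB \<star> id A') \<bullet> (id B' \<star> ((v \<star> id A') \<bullet> kA))"

text \<open>
  A morphism slides around a cup or a cap and becomes its transpose on the other strand. Each
  equation cancels one zigzag, that of \<open>B\<close> for the cup and that of \<open>A\<close> for the cap.
\<close>

lemma transpose:
  assumes A: "dual_pair A A' eA kA" and B: "dual_pair B B' eB kB"
    and v: "arr v" "src v = A" "tgt v = B"
  defines "v' \<equiv> transpose eB B' kA A' v"
  shows "arr v'" "src v' = B'" "tgt v' = A'"
    and coev_transpose: "(id B \<star> v') \<bullet> kB = (v \<star> id A') \<bullet> kA"
    and ev_transpose: "eA \<bullet> (v' \<star> id A) = eB \<bullet> (id B' \<star> v)"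
proof -
  note [simp] = dual_pairD(1-6)[OF A] dual_pairD(1-6)[OF B] v
  show [simp]: "arr v'" "src v' = B'" "tgt v' = A'" by (simp_all add: v'_def transpose_def)
  have "(id B \<star> v') \<bullet> kB = (id B \<star> eB \<star> id A') \<bullet> (id (B @ B') \<star> ((v \<star> id A') \<bullet> kA)) \<bullet> (kB \<star> id [])"
    by (simp add: v'_def transpose_def whisker_left_comp)
  also have "\<dots> = (id B \<star> eB \<star> id A') \<bullet> (kB \<star> ((v \<star> id A') \<bullet> kA))"
    by (simp add: interchange del: tens_unit)
  also have "\<dots> = (((id B \<star> eB) \<bullet> (kB \<star> id B)) \<star> id A') \<bullet> ((v \<star> id A') \<bullet> kA)"
    by (subst tens_split[of kB _ "B @ A'" "[]"]) (simp_all add: whisker)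
  also have "\<dots> = (v \<star> id A') \<bullet> kA" by (simp add: dual_pairD(7)[OF B])
  finally show "(id B \<star> v') \<bullet> kB = (v \<star> id A') \<bullet> kA" .
  have "eA \<bullet> (v' \<star> id A) = eA \<bullet> (eB \<star> id (A' @ A)) \<bullet> (id B' \<star> v \<star> id (A' @ A)) \<bullet> (id B' \<star> kA \<star> id A)"
    by (simp add: v'_def transpose_def whisker)
  also have "\<dots> = (eB \<star> id []) \<bullet> (id (B' @ B) \<star> eA) \<bullet> (id B' \<star> v \<star> id (A' @ A)) \<bullet> (id B' \<star> kA \<star> id A)"
    using exchange_comp[of eB eA "[]" "B' @ B" "A' @ A" "[]"] by simp
  also have "\<dots> = eB \<bullet> (id B' \<star> ((id B \<star> eA) \<bullet> (v \<star> id (A' @ A)) \<bullet> (kA \<star> id A)))"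
    by (simp add: whisker)
  also have "(id B \<star> eA) \<bullet> (v \<star> id (A' @ A)) \<bullet> (kA \<star> id A) = (v \<star> id []) \<bullet> (id A \<star> eA) \<bullet> (kA \<star> id A)"
    using exchange_comp[of v eA "[]" A "A' @ A" B] by simp
  also have "\<dots> = v" by (simp add: dual_pairD(7)[OF A])
  finally show "eA \<bullet> (v' \<star> id A) = eB \<bullet> (id B' \<star> v)" .
qed

text \<open>
  The trace formed with an arbitrary dual pair: the cap is turned into one for \<open>A \<otimes> A'\<close> by the braiding,
  and the twist corrects the framing. By cyclicity with an identity morphism it does not depend on the
  dual pair.
\<close>

definition tr :: "'a list \<Rightarrow> 'a list \<Rightarrow> 'x \<Rightarrow> 'x \<Rightarrow> 'x \<Rightarrow> 'x" where
  "tr A A' e k f = e \<bullet> br A A' \<bullet> ((tw A \<bullet> f) \<star> id A') \<bullet> k"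

text \<open>
  The factor \<open>v\<close> travels once around the loop: through the cup it becomes its transpose, the braiding
  carries it to the other side, and through the cap it becomes \<open>v\<close> again, now to the left of \<open>u\<close>.
\<close>

lemma tr_cyclic:
  assumes A: "dual_pair A A' eA kA" and B: "dual_pair B B' eB kB"
    and v: "arr v" "src v = A" "tgt v = B" and u: "arr u" "src u = B" "tgt u = A"
  shows "tr A A' eA kA (u \<bullet> v) = tr B B' eB kB (v \<bullet> u)"
proof -
  define v' where "v' = transpose eB B' kA A' v"
  note v' = transpose[OF A B v, folded v'_def]
  note [simp] = dual_pairD(1-6)[OF A] dual_pairD(1-6)[OF B] v u v'(1-3)
  have "tr A A' eA kA (u \<bullet> v) = eA \<bullet> br A A' \<bullet> ((tw A \<bullet> u) \<star> id A') \<bullet> ((v \<star> id A') \<bullet> kA)"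
    by (simp add: tr_def whisker)
  also have "\<dots> = eA \<bullet> br A A' \<bullet> (((tw A \<bullet> u) \<star> id A') \<bullet> (id B \<star> v')) \<bullet> kB"
    by (simp flip: v'(4))
  also have "((tw A \<bullet> u) \<star> id A') \<bullet> (id B \<star> v') = (id A \<star> v') \<bullet> ((tw A \<bullet> u) \<star> id B')"
    by (rule exchange) simp_all
  also have "eA \<bullet> br A A' \<bullet> \<dots> \<bullet> kB = eA \<bullet> (br A A' \<bullet> (id A \<star> v')) \<bullet> ((tw A \<bullet> u) \<star> id B') \<bullet> kB"
    by simp
  also have "br A A' \<bullet> (id A \<star> v') = (v' \<star> id A) \<bullet> br A B'" by (rule br_natural_right) simp_all
  also have "eA \<bullet> \<dots> \<bullet> ((tw A \<bullet> u) \<star> id B') \<bullet> kB = (eA \<bullet> (v' \<star> id A)) \<bullet> br A B' \<bullet> ((tw A \<bullet> u) \<star> id B') \<bullet> kB"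
    by simp
  also have "\<dots> = eB \<bullet> ((id B' \<star> v) \<bullet> br A B') \<bullet> ((tw A \<bullet> u) \<star> id B') \<bullet> kB"
    by (simp only: v'(5) comp_assoc)
  also have "(id B' \<star> v) \<bullet> br A B' = br B B' \<bullet> (v \<star> id B')" by (rule br_natural_left[symmetric]) simp_all
  also have "eB \<bullet> \<dots> \<bullet> ((tw A \<bullet> u) \<star> id B') \<bullet> kB = eB \<bullet> br B B' \<bullet> ((v \<bullet> tw A \<bullet> u) \<star> id B') \<bullet> kB"
    by (simp add: whisker)
  also have "v \<bullet> tw A \<bullet> u = tw B \<bullet> v \<bullet> u"
    using tw_natural[of v] by (metis comp_assoc v)
  finally show ?thesis by (simp add: tr_def)
qed


text \<open>
  Nested caps and cups: the inner zigzag is cancelled inside the outer one.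
\<close>

lemma dual_pair_tens:
  assumes A: "dual_pair A A' eA kA" and B: "dual_pair B B' eB kB"
  shows "dual_pair (A @ B) (B' @ A') (eB \<bullet> (id B' \<star> eA \<star> id B)) ((id A \<star> kB \<star> id A') \<bullet> kA)"
    (is "dual_pair _ _ ?e ?k")
proof -
  note [simp] = dual_pairD(1-6)[OF A] dual_pairD(1-6)[OF B]
  have *: "(id (B @ B') \<star> eA) \<bullet> (kB \<star> id (A' @ A)) = kB \<bullet> eA"
    using exchange[of kB eA "[]" "[]" "A' @ A" "B @ B'"] by simp
  have **: "(eA \<star> id (B @ B')) \<bullet> (id (A' @ A) \<star> kB) = kB \<bullet> eA"
    using exchange[of eA kB "B @ B'" "A' @ A" "[]" "[]"] by simp
  have "(id (A @ B) \<star> ?e) \<bullet> (?k \<star> id (A @ B))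
      = (id (A @ B) \<star> eB) \<bullet> (id A \<star> ((id (B @ B') \<star> eA) \<bullet> (kB \<star> id (A' @ A))) \<star> id B) \<bullet> (kA \<star> id (A @ B))"
    by (simp add: whisker)
  also have "\<dots> = (id A \<star> ((id B \<star> eB) \<bullet> (kB \<star> id B))) \<bullet> (((id A \<star> eA) \<bullet> (kA \<star> id A)) \<star> id B)"
    unfolding * by (simp add: whisker)
  also have "\<dots> = id (A @ B)" unfolding dual_pairD(7)[OF A] dual_pairD(7)[OF B] by simp
  finally have 1: "(id (A @ B) \<star> ?e) \<bullet> (?k \<star> id (A @ B)) = id (A @ B)" .
  have "(?e \<star> id (B' @ A')) \<bullet> (id (B' @ A') \<star> ?k)
      = (eB \<star> id (B' @ A')) \<bullet> (id B' \<star> ((eA \<star> id (B @ B')) \<bullet> (id (A' @ A) \<star> kB)) \<star> id A') \<bullet> (id (B' @ A') \<star> kA)"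
    by (simp add: whisker)
  also have "\<dots> = (((eB \<star> id B') \<bullet> (id B' \<star> kB)) \<star> id A') \<bullet> (id B' \<star> ((eA \<star> id A') \<bullet> (id A' \<star> kA)))"
    unfolding ** by (simp add: whisker)
  also have "\<dots> = id (B' @ A')" unfolding dual_pairD(8)[OF A] dual_pairD(8)[OF B] by simp
  finally show ?thesis using 1 by (simp add: dual_pair_def)
qed

subsection \<open>Right duality and partial traces\<close>

text \<open>
  The cup \<open>1 \<rightarrow> A' \<otimes> A\<close> and the cap \<open>A \<otimes> A' \<rightarrow> 1\<close> of the other chirality. They make \<open>A'\<close> a dual of
  \<open>A\<close> on the other side as well.
\<close>

definition right_coev :: "'a list \<Rightarrow> 'a list \<Rightarrow> 'x \<Rightarrow> 'x" where
  "right_coev A A' k = br A A' \<bullet> (tw A \<star> id A') \<bullet> k"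
definition right_ev :: "'a list \<Rightarrow> 'a list \<Rightarrow> 'x \<Rightarrow> 'x" where
  "right_ev A A' e = e \<bullet> br A A' \<bullet> (tw A \<star> id A')"

lemma right_coev_typing [simp]:
  assumes "arr k" "tgt k = A @ A'"
  shows "arr (right_coev A A' k)" "src (right_coev A A' k) = src k" "tgt (right_coev A A' k) = A' @ A"
  using assms by (simp_all add: right_coev_def)
lemma right_ev_typing [simp]:
  assumes "arr e" "src e = A' @ A"
  shows "arr (right_ev A A' e)" "src (right_ev A A' e) = A @ A'" "tgt (right_ev A A' e) = tgt e"
  using assms by (simp_all add: right_ev_def)

text \<open>
  Right cups nest like the left ones: this is where the hexagons and the formula for the twist of a
  tensor product are used. Of the double braiding of \<open>A\<close> and \<open>B\<close> in that twist, one half slides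
  through the outer braidings, and the other half pulls the cup of \<open>B\<close> off the strand \<open>A\<close>;
  what remains are the two right cups, linked by a braiding of \<open>B\<close> with \<open>A' \<otimes> A\<close>, and the
  cup of \<open>A\<close> slides out of it.
\<close>

lemma right_coev_tens:
  assumes A: "dual_pair A A' eA kA" and B: "dual_pair B B' eB kB"
  shows "right_coev (A @ B) (B' @ A') ((id A \<star> kB \<star> id A') \<bullet> kA) = (id B' \<star> right_coev A A' kA \<star> id B) \<bullet> right_coev B B' kB"
proof -
  note [simp] = dual_pairD(1-6)[OF A] dual_pairD(1-6)[OF B]
  have *: "(id B \<star> br A B') \<bullet> (br A B \<star> id B') \<bullet> (id A \<star> kB) = kB \<star> id A"
    using br_natural_right[of kB "[]" "B @ B'" A] br_tens_right[of A B B'] by (simp add: br_unit_right)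
  have "br (A @ B) B' \<bullet> (tw (A @ B) \<star> id B') \<bullet> (id A \<star> kB)
    = (br (A @ B) B' \<bullet> (br B A \<star> id B')) \<bullet> (br A B \<star> id B') \<bullet> (tw A \<star> tw B \<star> id B') \<bullet> (id A \<star> kB)"
    by (simp add: tw_tens whisker)
  also have "br (A @ B) B' \<bullet> (br B A \<star> id B') = (id B' \<star> br B A) \<bullet> (br B B' \<star> id A) \<bullet> (id B \<star> br A B')"
    using br_natural_left[of "br B A" "B @ A" "A @ B" B'] br_tens_left[of B A B'] by simp
  finally have L1: "br (A @ B) B' \<bullet> (tw (A @ B) \<star> id B') \<bullet> (id A \<star> kB)
     = (id B' \<star> br B A) \<bullet> (br B B' \<star> id A) \<bullet> (id B \<star> br A B') \<bullet> (br A B \<star> id B') \<bullet> (tw A \<star> tw B \<star> id B') \<bullet> (id A \<star> kB)"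
    by simp
  have "(br A B \<star> id B') \<bullet> (tw A \<star> tw B \<star> id B') = ((br A B \<bullet> (tw A \<star> tw B)) \<star> id B')"
    by (simp add: whisker)
  also have "\<dots> = (tw B \<star> tw A \<star> id B') \<bullet> (br A B \<star> id B')"
    using br_natural[of "tw A" "tw B"] by (simp add: whisker)
  finally have L2: "(br A B \<star> id B') \<bullet> (tw A \<star> tw B \<star> id B') \<bullet> h = (tw B \<star> tw A \<star> id B') \<bullet> (br A B \<star> id B') \<bullet> h" for h
    by (metis comp_assoc)
  have "(id B \<star> br A B') \<bullet> (tw B \<star> tw A \<star> id B') = tw B \<star> (br A B' \<bullet> (tw A \<star> id B'))"
    by (simp add: interchange)
  also have "\<dots> = tw B \<star> ((id B' \<star> tw A) \<bullet> br A B')"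
    by (simp add: br_natural_left[of "tw A" A A])
  also have "\<dots> = (tw B \<star> id B' \<star> tw A) \<bullet> (id B \<star> br A B')"
    by (simp add: interchange)
  finally have L3: "(id B \<star> br A B') \<bullet> (tw B \<star> tw A \<star> id B') \<bullet> h = (tw B \<star> id B' \<star> tw A) \<bullet> (id B \<star> br A B') \<bullet> h" for h
    by (metis comp_assoc)
  have L4: "br (A @ B) B' \<bullet> (tw (A @ B) \<star> id B') \<bullet> (id A \<star> kB)
     = (id B' \<star> br B A) \<bullet> (right_coev B B' kB \<star> tw A)"
    unfolding L1 L2 L3 *
    using interchange[of "tw B \<star> id B'" "tw A" kB "id A"]
      interchange[of "br B B'" "id A" "(tw B \<star> id B') \<bullet> kB" "tw A"]
    by (simp add: right_coev_def)
  have "br (A @ B) A' \<bullet> (br B A \<star> id A') = (id A' \<star> br B A) \<bullet> (br B A' \<star> id A) \<bullet> (id B \<star> br A A')"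
    using br_natural_left[of "br B A" "B @ A" "A @ B" A'] br_tens_left[of B A A'] by simp
  also have "\<dots> = br B (A' @ A) \<bullet> (id B \<star> br A A')" by (simp add: br_tens_right)
  finally have L5: "br (A @ B) A' \<bullet> (br B A \<star> id A') = br B (A' @ A) \<bullet> (id B \<star> br A A')" .
  have "right_coev (A @ B) (B' @ A') ((id A \<star> kB \<star> id A') \<bullet> kA)
     = (id B' \<star> br (A @ B) A') \<bullet> ((br (A @ B) B' \<bullet> (tw (A @ B) \<star> id B') \<bullet> (id A \<star> kB)) \<star> id A') \<bullet> kA"
    by (simp add: right_coev_def br_tens_right whisker)
  also have "\<dots> = (id B' \<star> (br (A @ B) A' \<bullet> (br B A \<star> id A'))) \<bullet> (right_coev B B' kB \<star> tw A \<star> id A') \<bullet> kA"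
    unfolding L4 by (simp add: whisker)
  also have "\<dots> = (id B' \<star> br B (A' @ A)) \<bullet> ((id (B' @ B) \<star> br A A') \<bullet> (right_coev B B' kB \<star> tw A \<star> id A')) \<bullet> kA"
    unfolding L5 by (simp add: whisker)
  also have "\<dots> = (id B' \<star> br B (A' @ A)) \<bullet> (right_coev B B' kB \<star> (br A A' \<bullet> (tw A \<star> id A'))) \<bullet> (id [] \<star> kA)"
    using interchange[of "id (B' @ B)" "br A A'" "right_coev B B' kB" "tw A \<star> id A'"] by (simp del: tens_unit) simp
  also have "\<dots> = (id B' \<star> br B (A' @ A)) \<bullet> (right_coev B B' kB \<star> right_coev A A' kA)"
    by (simp add: interchange right_coev_def del: tens_unit)
  also have "right_coev B B' kB \<star> right_coev A A' kA = (id (B' @ B) \<star> right_coev A A' kA) \<bullet> (right_coev B B' kB \<star> id [])"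
    by (rule tens_split') simp_all
  also have "(id B' \<star> br B (A' @ A)) \<bullet> \<dots> = (id B' \<star> (br B (A' @ A) \<bullet> (id B \<star> right_coev A A' kA))) \<bullet> right_coev B B' kB"
    by (simp add: whisker)
  also have "br B (A' @ A) \<bullet> (id B \<star> right_coev A A' kA) = right_coev A A' kA \<star> id B"
    using br_natural_right[of "right_coev A A' kA" "[]" "A' @ A" B] by (simp add: br_unit_right)
  finally show ?thesis .
qed


text \<open>
  The mirror image of the preceding lemma, with caps in place of cups.
\<close>

lemma right_ev_tens:
  assumes A: "dual_pair A A' eA kA" and B: "dual_pair B B' eB kB"
  shows "right_ev (A @ B) (B' @ A') (eB \<bullet> (id B' \<star> eA \<star> id B)) = right_ev A A' eA \<bullet> (id A \<star> right_ev B B' eB \<star> id A')"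
proof -
  note [simp] = dual_pairD(1-6)[OF A] dual_pairD(1-6)[OF B]
  have 1: "br (A @ B) A' \<bullet> (br B A \<star> id A') \<bullet> h = br B (A' @ A) \<bullet> (id B \<star> br A A') \<bullet> h" for h
  proof -
    have "br (A @ B) A' \<bullet> (br B A \<star> id A') = (id A' \<star> br B A) \<bullet> (br B A' \<star> id A) \<bullet> (id B \<star> br A A')"
      using br_natural_left[of "br B A" "B @ A" "A @ B" A'] br_tens_left[of B A A'] by simp
    also have "\<dots> = br B (A' @ A) \<bullet> (id B \<star> br A A')" by (simp add: br_tens_right)
    finally show ?thesis by (metis comp_assoc)
  qed
  have 2: "(eA \<star> id B) \<bullet> br B (A' @ A) \<bullet> h = (id B \<star> eA) \<bullet> h" for h
    using br_natural_right[of eA "A' @ A" "[]" B] by (simp add: br_unit_right flip: comp_assoc)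
  have "(br A B \<star> id A') \<bullet> (tw A \<star> tw B \<star> id A') = ((br A B \<bullet> (tw A \<star> tw B)) \<star> id A')"
    by (simp add: whisker)
  also have "\<dots> = (tw B \<star> tw A \<star> id A') \<bullet> (br A B \<star> id A')"
    using br_natural[of "tw A" "tw B"] by (simp add: whisker)
  finally have 3: "(br A B \<star> id A') \<bullet> (tw A \<star> tw B \<star> id A') = \<dots>" .
  have "(id B \<star> eA) \<bullet> (id B \<star> br A A') \<bullet> (tw B \<star> tw A \<star> id A') = tw B \<star> right_ev A A' eA"
    using interchange[of "id B" "br A A'" "tw B" "tw A \<star> id A'"] by (simp add: interchange right_ev_def)
  also have "\<dots> = tw B \<bullet> (id B \<star> right_ev A A' eA)"
    using tens_split[of "tw B" "right_ev A A' eA" "[]" B] by simp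
  finally have 4: "(id B \<star> eA) \<bullet> (id B \<star> br A A') \<bullet> (tw B \<star> tw A \<star> id A') \<bullet> h
     = tw B \<bullet> (id B \<star> right_ev A A' eA) \<bullet> h" for h
    by (metis comp_assoc)
  have 5: "(eA \<star> id B) \<bullet> br (A @ B) A' \<bullet> (tw (A @ B) \<star> id A') = tw B \<bullet> (id B \<star> right_ev A A' eA) \<bullet> (br A B \<star> id A')"
    by (simp add: tw_tens whisker 1 2 3 4)
  have 6: "(id B' \<star> br A B) \<bullet> br (A @ B) B' = (br B B' \<star> id A) \<bullet> br A (B @ B')"
    using br_natural_left[of "br A B" "A @ B" "B @ A" B'] br_tens_left[of B A B'] by (simp add: br_tens_right)
  have 7: "(right_ev B B' eB \<star> id A) \<bullet> br A (B @ B') = id A \<star> right_ev B B' eB"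
    using br_natural_right[of "right_ev B B' eB" "B @ B'" "[]" A] by (simp add: br_unit_right)
  have 8: "br (A @ B) B' \<bullet> (tw (A @ B) \<star> id B') = (id B' \<star> tw (A @ B)) \<bullet> br (A @ B) B'"
    by (rule br_natural_left) simp_all
  have "right_ev (A @ B) (B' @ A') (eB \<bullet> (id B' \<star> eA \<star> id B))
    = eB \<bullet> (id B' \<star> eA \<star> id B) \<bullet> (id B' \<star> br (A @ B) A') \<bullet> ((br (A @ B) B' \<bullet> (tw (A @ B) \<star> id B')) \<star> id A')"
    by (simp add: right_ev_def br_tens_right whisker)
  also have "\<dots> = eB \<bullet> (id B' \<star> ((eA \<star> id B) \<bullet> br (A @ B) A' \<bullet> (tw (A @ B) \<star> id A'))) \<bullet> (br (A @ B) B' \<star> id A')"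
    unfolding 8 by (simp add: whisker)
  also have "\<dots> = eB \<bullet> (id B' \<star> tw B) \<bullet> (id (B' @ B) \<star> right_ev A A' eA) \<bullet> (((id B' \<star> br A B) \<bullet> br (A @ B) B') \<star> id A')"
    unfolding 5 by (simp add: whisker)
  also have "\<dots> = eB \<bullet> (id B' \<star> tw B) \<bullet> ((id (B' @ B) \<star> right_ev A A' eA) \<bullet> (br B B' \<star> id (A @ A'))) \<bullet> (br A (B @ B') \<star> id A')"
    unfolding 6 by (simp add: whisker)
  also have "(id (B' @ B) \<star> right_ev A A' eA) \<bullet> (br B B' \<star> id (A @ A')) = br B B' \<bullet> (id (B @ B') \<star> right_ev A A' eA)"
    using exchange[of "br B B'" "right_ev A A' eA" "[]"] by simp
  also have "eB \<bullet> (id B' \<star> tw B) \<bullet> \<dots> \<bullet> (br A (B @ B') \<star> id A')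
     = eB \<bullet> ((id B' \<star> tw B) \<bullet> br B B') \<bullet> (id (B @ B') \<star> right_ev A A' eA) \<bullet> (br A (B @ B') \<star> id A')"
    by simp
  also have "(id B' \<star> tw B) \<bullet> br B B' = br B B' \<bullet> (tw B \<star> id B')"
    by (rule br_natural_left[symmetric]) simp_all
  also have "eB \<bullet> \<dots> \<bullet> (id (B @ B') \<star> right_ev A A' eA) \<bullet> (br A (B @ B') \<star> id A')
     = (right_ev B B' eB \<bullet> (id (B @ B') \<star> right_ev A A' eA)) \<bullet> (br A (B @ B') \<star> id A')"
    by (simp add: right_ev_def)
  also have "right_ev B B' eB \<bullet> (id (B @ B') \<star> right_ev A A' eA) = right_ev A A' eA \<bullet> (right_ev B B' eB \<star> id (A @ A'))"
    using exchange[of "right_ev B B' eB" "right_ev A A' eA" "[]"] by simp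
  also have "\<dots> \<bullet> (br A (B @ B') \<star> id A') = right_ev A A' eA \<bullet> (((right_ev B B' eB \<star> id A) \<bullet> br A (B @ B')) \<star> id A')"
    by (simp add: whisker)
  finally show ?thesis unfolding 7 by simp
qed

text \<open>
  The braiding and the twist in a trace can be attributed to the cup or to the cap, which exhibits the
  trace as a closure on the left or on the right of \<open>f\<close>. The equality of the two is sphericality.
\<close>

lemma tr_via_right_coev:
  assumes A: "dual_pair A A' e k" and f: "arr f" "src f = A" "tgt f = A"
  shows "tr A A' e k f = e \<bullet> (id A' \<star> f) \<bullet> right_coev A A' k"
proof -
  note [simp] = dual_pairD(1-6)[OF A] f
  have "tr A A' e k f = e \<bullet> (br A A' \<bullet> (f \<star> id A')) \<bullet> (tw A \<star> id A') \<bullet> k"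
    using tw_natural[of f] by (simp add: tr_def whisker)
  then show ?thesis by (simp add: br_natural_left right_coev_def)
qed

lemma tr_via_right_ev:
  assumes A: "dual_pair A A' e k" and f: "arr f" "src f = A" "tgt f = A"
  shows "tr A A' e k f = right_ev A A' e \<bullet> (f \<star> id A') \<bullet> k"
  using dual_pairD(1-6)[OF A] f by (simp add: tr_def right_ev_def whisker)

text \<open>
  The strand \<open>A\<close> is closed on the left of \<open>B\<close>, where it does not meet the closure of \<open>B\<close>; hence the
  left form of the trace is taken. The next lemma closes \<open>B\<close> on the right of \<open>A\<close>.
\<close>

lemma tr_tens_left:
  assumes A: "dual_pair A A' eA kA" and B: "dual_pair B B' eB kB"
    and f: "arr f" "src f = A @ B" "tgt f = A @ B"
  shows "tr (A @ B) (B' @ A') (eB \<bullet> (id B' \<star> eA \<star> id B)) ((id A \<star> kB \<star> id A') \<bullet> kA) f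
    = tr B B' eB kB ((eA \<star> id B) \<bullet> (id A' \<star> f) \<bullet> (right_coev A A' kA \<star> id B))"
proof -
  note [simp] = dual_pairD(1-6)[OF A] dual_pairD(1-6)[OF B] f
  show ?thesis
    by (simp add: tr_via_right_coev[OF dual_pair_tens[OF A B]] tr_via_right_coev[OF B] right_coev_tens[OF A B] whisker)
qed

lemma tr_tens_right:
  assumes A: "dual_pair A A' eA kA" and B: "dual_pair B B' eB kB"
    and f: "arr f" "src f = A @ B" "tgt f = A @ B"
  shows "tr (A @ B) (B' @ A') (eB \<bullet> (id B' \<star> eA \<star> id B)) ((id A \<star> kB \<star> id A') \<bullet> kA) f
    = tr A A' eA kA ((id A \<star> right_ev B B' eB) \<bullet> (f \<star> id B') \<bullet> (id A \<star> kB))"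
proof -
  note [simp] = dual_pairD(1-6)[OF A] dual_pairD(1-6)[OF B] f
  show ?thesis
    by (simp add: tr_via_right_ev[OF dual_pair_tens[OF A B]] tr_via_right_ev[OF A] right_ev_tens[OF A B] whisker)
qed

subsection \<open>Right zigzag relations\<close>

text \<open>
  Compatibility of the twist with duals: a twist can be moved from one leg of the cup to the other.
\<close>

definition balanced :: "'a list \<Rightarrow> 'a list \<Rightarrow> 'x \<Rightarrow> bool" where
  "balanced A A' k \<longleftrightarrow> (id A \<star> tw A') \<bullet> k = (tw A \<star> id A') \<bullet> k"

text \<open>
  By balancedness the two twists produced by moving \<open>tw A\<close> through the braiding can be distributed over
  both legs of the cup. Together with a double braiding they form the twist of \<open>A \<otimes> A'\<close>, which
  naturality moves down to the unit, where it is trivial.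
\<close>

lemma twist_right_coev:
  assumes A: "dual_pair A A' e k" and b: "balanced A A' k"
  shows "(id A' \<star> tw A) \<bullet> right_coev A A' k = bri A' A \<bullet> k"
proof -
  note [simp] = dual_pairD(1-6)[OF A]
  have n: "(id A' \<star> tw A) \<bullet> br A A' = br A A' \<bullet> (tw A \<star> id A')"
    by (rule br_natural_left[symmetric]) simp_all
  have "br A' A \<bullet> (id A' \<star> tw A) \<bullet> right_coev A A' k
      = br A' A \<bullet> ((id A' \<star> tw A) \<bullet> br A A') \<bullet> (tw A \<star> id A') \<bullet> k"
    by (simp add: right_coev_def)
  also have "\<dots> = br A' A \<bullet> br A A' \<bullet> (tw A \<star> id A') \<bullet> ((id A \<star> tw A') \<bullet> k)"
    unfolding n using b by (simp add: balanced_def)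
  also have "\<dots> = br A' A \<bullet> br A A' \<bullet> ((tw A \<star> id A') \<bullet> (id A \<star> tw A')) \<bullet> k" by simp
  also have "(tw A \<star> id A') \<bullet> (id A \<star> tw A') = tw A \<star> tw A'" by (simp add: interchange)
  also have "br A' A \<bullet> br A A' \<bullet> (tw A \<star> tw A') \<bullet> k = tw (A @ A') \<bullet> k" by (simp add: tw_tens)
  also have "\<dots> = k" using tw_natural[of k] by (simp add: tw_unit)
  finally have "bri A' A \<bullet> br A' A \<bullet> (id A' \<star> tw A) \<bullet> right_coev A A' k = bri A' A \<bullet> k" by simp
  then show ?thesis
    by (subst (asm) comp_assoc[symmetric]) (simp add: bri_br)
qed

text \<open>
  In a ribbon category the right cup is usually defined with the inverse braiding and the inverse twist; this links that form to the one that occurs in traces.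
\<close>

lemma right_coev_eq:
  assumes A: "dual_pair A A' e k" and b: "balanced A A' k"
  shows "right_coev A A' k = (id A' \<star> twi A) \<bullet> bri A' A \<bullet> k"
proof -
  note [simp] = dual_pairD(1-6)[OF A]
  have "(id A' \<star> twi A) \<bullet> bri A' A \<bullet> k = ((id A' \<star> twi A) \<bullet> (id A' \<star> tw A)) \<bullet> right_coev A A' k"
    by (simp add: twist_right_coev[OF A b])
  also have "(id A' \<star> twi A) \<bullet> (id A' \<star> tw A) = id (A' @ A)"
    by (simp add: interchange twi_tw)
  finally show ?thesis by simp
qed

text \<open>
  After the twists have cancelled, the braiding of the cap and the inverse braiding of the cup
  combine to an inverse braiding of the strand \<open>A'\<close> with the pair \<open>A' \<otimes> A\<close>; the cap slides through
  it, and the zigzag for \<open>A'\<close> is left.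
\<close>

lemma right_zigzag_dual:
  assumes A: "dual_pair A A' e k" and b: "balanced A A' k"
  shows "(id A' \<star> right_ev A A' e) \<bullet> (right_coev A A' k \<star> id A') = id A'"
proof -
  note [simp] = dual_pairD(1-6)[OF A]
  have "(id A' \<star> right_ev A A' e) \<bullet> (right_coev A A' k \<star> id A')
     = (id A' \<star> e) \<bullet> (id A' \<star> br A A') \<bullet> (((id A' \<star> tw A) \<bullet> right_coev A A' k) \<star> id A')"
    by (simp add: right_ev_def whisker)
  also have "\<dots> = (id A' \<star> e) \<bullet> (id A' \<star> br A A') \<bullet> (bri A' A \<star> id A') \<bullet> (k \<star> id A')"
    by (simp add: twist_right_coev[OF A b] whisker)
  finally have 1: "(id A' \<star> right_ev A A' e) \<bullet> (right_coev A A' k \<star> id A') = \<dots>" .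
  have "br A' (A' @ A) \<bullet> (id A' \<star> br A A') = (br A A' \<star> id A') \<bullet> br A' (A @ A')"
    by (rule br_natural_right) simp_all
  also have "\<dots> = (br A A' \<star> id A') \<bullet> (id A \<star> br A' A') \<bullet> (br A' A \<star> id A')"
    by (simp add: br_tens_right)
  finally have 2: "br A' (A' @ A) \<bullet> (id A' \<star> br A A') \<bullet> h
     = (br A A' \<star> id A') \<bullet> (id A \<star> br A' A') \<bullet> (br A' A \<star> id A') \<bullet> h" for h
    by (metis comp_assoc)
  have "br A' (A' @ A) \<bullet> (id A' \<star> br A A') \<bullet> (bri A' A \<star> id A') \<bullet> (k \<star> id A')
     = (br A A' \<star> id A') \<bullet> (id A \<star> br A' A') \<bullet> ((br A' A \<bullet> bri A' A) \<star> id A') \<bullet> (k \<star> id A')"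
    unfolding 2 by (simp add: whisker)
  also have "\<dots> = br (A @ A') A' \<bullet> (k \<star> id A')" by (simp add: br_bri br_tens_left)
  also have "\<dots> = id A' \<star> k"
    by (simp add: br_natural_left[of k "[]" "A @ A'"] br_unit_left)
  finally have 3: "br A' (A' @ A) \<bullet> (id A' \<star> br A A') \<bullet> (bri A' A \<star> id A') \<bullet> (k \<star> id A') = id A' \<star> k" .
  have "(e \<star> id A') \<bullet> br A' (A' @ A) = id A' \<star> e"
    using br_natural_right[of e "A' @ A" "[]" A'] by (simp add: br_unit_right)
  then have "(id A' \<star> right_ev A A' e) \<bullet> (right_coev A A' k \<star> id A') = (e \<star> id A') \<bullet> (br A' (A' @ A) \<bullet> (id A' \<star> br A A') \<bullet> (bri A' A \<star> id A') \<bullet> (k \<star> id A'))"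
    unfolding 1 by (metis comp_assoc)
  then show ?thesis unfolding 3 dual_pairD(8)[OF A] .
qed

text \<open>
  The zigzag \<open>p\<close> on \<open>A\<close> is absorbed by the right cup, by the zigzag on \<open>A'\<close>. Since the right cup
  arises from the left cup by invertible morphisms, \<open>p\<close> is absorbed by the left cup too, which forces
  \<open>p = id A\<close>.
\<close>

lemma right_zigzag:
  assumes A: "dual_pair A A' e k" and b: "balanced A A' k"
  shows "(right_ev A A' e \<star> id A) \<bullet> (id A \<star> right_coev A A' k) = id A"
proof -
  note [simp] = dual_pairD(1-6)[OF A]
  define p where "p = (right_ev A A' e \<star> id A) \<bullet> (id A \<star> right_coev A A' k)"
  have [simp]: "arr p" "src p = A" "tgt p = A" by (simp_all add: p_def)
  have "(id A' \<star> p) \<bullet> right_coev A A' k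
     = (id A' \<star> right_ev A A' e \<star> id A) \<bullet> ((id (A' @ A) \<star> right_coev A A' k) \<bullet> right_coev A A' k)"
    by (simp add: p_def whisker)
  also have "(id (A' @ A) \<star> right_coev A A' k) \<bullet> right_coev A A' k = (right_coev A A' k \<star> id (A' @ A)) \<bullet> right_coev A A' k"
    using exchange[of "right_coev A A' k" "right_coev A A' k" "A' @ A" "[]" "[]" "A' @ A"] by simp
  also have "(id A' \<star> right_ev A A' e \<star> id A) \<bullet> \<dots>
     = (((id A' \<star> right_ev A A' e) \<bullet> (right_coev A A' k \<star> id A')) \<star> id A) \<bullet> right_coev A A' k"
    by (simp add: whisker)
  also have "\<dots> = right_coev A A' k" by (simp add: right_zigzag_dual[OF A b])
  finally have 1: "(id A' \<star> p) \<bullet> right_coev A A' k = right_coev A A' k" .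
  have n: "(id A' \<star> p) \<bullet> br A A' = br A A' \<bullet> (p \<star> id A')"
    by (rule br_natural_left[symmetric]) simp_all
  have t: "p \<bullet> tw A = tw A \<bullet> p" using tw_natural[of p] by simp
  have "br A A' \<bullet> (tw A \<star> id A') \<bullet> (p \<star> id A') \<bullet> k = br A A' \<bullet> ((p \<bullet> tw A) \<star> id A') \<bullet> k"
    unfolding t by (simp add: whisker)
  also have "\<dots> = ((id A' \<star> p) \<bullet> br A A') \<bullet> (tw A \<star> id A') \<bullet> k"
    unfolding n by (simp add: whisker)
  also have "\<dots> = br A A' \<bullet> (tw A \<star> id A') \<bullet> k"
    using 1 by (simp add: right_coev_def)
  finally have "(twi A \<star> id A') \<bullet> (bri A A' \<bullet> br A A') \<bullet> (tw A \<star> id A') \<bullet> (p \<star> id A') \<bullet> k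
     = (twi A \<star> id A') \<bullet> (bri A A' \<bullet> br A A') \<bullet> (tw A \<star> id A') \<bullet> k" by simp
  then have "((twi A \<star> id A') \<bullet> (tw A \<star> id A')) \<bullet> (p \<star> id A') \<bullet> k = ((twi A \<star> id A') \<bullet> (tw A \<star> id A')) \<bullet> k"
    by (simp add: bri_br)
  then have 2: "(p \<star> id A') \<bullet> k = k" by (simp add: interchange twi_tw)
  have "p = p \<bullet> (id A \<star> e) \<bullet> (k \<star> id A)" unfolding dual_pairD(7)[OF A] by simp
  also have "\<dots> = (p \<bullet> (id A \<star> e)) \<bullet> (k \<star> id A)" by simp
  also have "p \<bullet> (id A \<star> e) = (id A \<star> e) \<bullet> (p \<star> id (A' @ A))"
    using exchange[of p e "[]" A "A' @ A" A] by simp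
  also have "\<dots> \<bullet> (k \<star> id A) = (id A \<star> e) \<bullet> (((p \<star> id A') \<bullet> k) \<star> id A)"
    by (simp add: whisker)
  also have "\<dots> = id A" unfolding 2 by (rule dual_pairD(7)[OF A])
  finally show ?thesis by (simp add: p_def)
qed

subsection \<open>Rotating a strand through a trace\<close>

text \<open>
  Cyclicity transports the trace from \<open>T\<close> to \<open>X \<otimes> S\<close>, where the partial trace over \<open>X\<close> meets a left
  zigzag next to \<open>g\<close> and a right zigzag next to \<open>b\<close>.
\<close>

theorem trace_rotate_left:
  assumes S: "dual_pair S S' eS kS" and T: "dual_pair T T' eT kT" and X: "dual_pair X X' eX kX"
    and bal: "balanced X X' kX"
    and b: "arr b" "src b = S" "tgt b = X' @ T" and g: "arr g" "src g = X' @ T" "tgt g = S"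
  shows "tr T T' eT kT ((right_ev X X' eX \<star> id T) \<bullet> (id X \<star> b) \<bullet> (id X \<star> g) \<bullet> (kX \<star> id T)) = tr S S' eS kS (g \<bullet> b)"
proof -
  note [simp] = dual_pairD(1-6)[OF S] dual_pairD(1-6)[OF T] dual_pairD(1-6)[OF X] b g
  let ?u = "(right_ev X X' eX \<star> id T) \<bullet> (id X \<star> b)" and ?v = "(id X \<star> g) \<bullet> (kX \<star> id T)"
  have gg: "(eX \<star> id S) \<bullet> (id (X' @ X) \<star> g) = g \<bullet> (eX \<star> id (X' @ T))"
    using exchange[of eX g] by simp
  have bb: "(id (X' @ X) \<star> b) \<bullet> (right_coev X X' kX \<star> id S) = (right_coev X X' kX \<star> id (X' @ T)) \<bullet> b"
    using exchange[of "right_coev X X' kX" b] by simp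
  have "(eX \<star> id S) \<bullet> (id X' \<star> (?v \<bullet> ?u)) \<bullet> (right_coev X X' kX \<star> id S)
     = ((eX \<star> id S) \<bullet> (id (X' @ X) \<star> g)) \<bullet> (id X' \<star> kX \<star> id T) \<bullet> (id X' \<star> right_ev X X' eX \<star> id T)
       \<bullet> ((id (X' @ X) \<star> b) \<bullet> (right_coev X X' kX \<star> id S))"
    by (simp add: whisker)
  also have "\<dots> = g \<bullet> (((eX \<star> id X') \<bullet> (id X' \<star> kX)) \<star> id T)
       \<bullet> (((id X' \<star> right_ev X X' eX) \<bullet> (right_coev X X' kX \<star> id X')) \<star> id T) \<bullet> b"
    unfolding gg bb by (simp add: whisker)
  also have "\<dots> = g \<bullet> b" by (simp add: dual_pairD(8)[OF X] right_zigzag_dual[OF X bal])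
  finally have 1: "(eX \<star> id S) \<bullet> (id X' \<star> (?v \<bullet> ?u)) \<bullet> (right_coev X X' kX \<star> id S) = g \<bullet> b" .
  note tr_cyclic[OF T dual_pair_tens[OF X S], of ?v ?u]
  also note tr_tens_left[OF X S, of "?v \<bullet> ?u"]
  also note 1
  finally show ?thesis by simp
qed

text \<open>
  The same deformation with \<open>X\<close> on the other side, closed on the right.
\<close>

theorem trace_rotate_right:
  assumes S: "dual_pair S S' eS kS" and T: "dual_pair T T' eT kT" and X: "dual_pair X X' eX kX"
    and bal: "balanced X X' kX"
    and b: "arr b" "src b = S" "tgt b = T @ X'" and g: "arr g" "src g = T @ X'" "tgt g = S"
  shows "tr T T' eT kT ((id T \<star> eX) \<bullet> (b \<star> id X) \<bullet> (g \<star> id X) \<bullet> (id T \<star> right_coev X X' kX)) = tr S S' eS kS (g \<bullet> b)"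
proof -
  note [simp] = dual_pairD(1-6)[OF S] dual_pairD(1-6)[OF T] dual_pairD(1-6)[OF X] b g
  let ?u = "(id T \<star> eX) \<bullet> (b \<star> id X)" and ?v = "(g \<star> id X) \<bullet> (id T \<star> right_coev X X' kX)"
  have gg: "(id S \<star> right_ev X X' eX) \<bullet> (g \<star> id (X @ X')) = g \<bullet> (id (T @ X') \<star> right_ev X X' eX)"
    using exchange[of g "right_ev X X' eX"] by simp
  have bb: "(b \<star> id (X @ X')) \<bullet> (id S \<star> kX) = (id (T @ X') \<star> kX) \<bullet> b"
    using exchange[of b kX] by simp
  have "(id S \<star> right_ev X X' eX) \<bullet> ((?v \<bullet> ?u) \<star> id X') \<bullet> (id S \<star> kX)
     = ((id S \<star> right_ev X X' eX) \<bullet> (g \<star> id (X @ X'))) \<bullet> (id T \<star> right_coev X X' kX \<star> id X') \<bullet> (id T \<star> eX \<star> id X')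
       \<bullet> ((b \<star> id (X @ X')) \<bullet> (id S \<star> kX))"
    by (simp add: whisker)
  also have "\<dots> = g \<bullet> (id T \<star> ((id X' \<star> right_ev X X' eX) \<bullet> (right_coev X X' kX \<star> id X')))
       \<bullet> (id T \<star> ((eX \<star> id X') \<bullet> (id X' \<star> kX))) \<bullet> b"
    unfolding gg bb by (simp add: whisker)
  also have "\<dots> = g \<bullet> b" by (simp add: dual_pairD(8)[OF X] right_zigzag_dual[OF X bal])
  finally have 1: "(id S \<star> right_ev X X' eX) \<bullet> ((?v \<bullet> ?u) \<star> id X') \<bullet> (id S \<star> kX) = g \<bullet> b" .
  note tr_cyclic[OF T dual_pair_tens[OF S X], of ?v ?u]
  also note tr_tens_right[OF S X, of "?v \<bullet> ?u"]
  also note 1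
  finally show ?thesis by simp
qed

end

section \<open>Strictification\<close>

text \<open>
  The same single-sorted presentation for a category with associators and unitors, which are part of
  the data together with their inverses.
\<close>


locale balanced_category =
  fixes arr :: "'x \<Rightarrow> bool" and src tgt :: "'x \<Rightarrow> 'o" and id :: "'o \<Rightarrow> 'x"
    and comp :: "'x \<Rightarrow> 'x \<Rightarrow> 'x" (infixr \<open>\<bullet>\<close> 60)
    and ten :: "'o \<Rightarrow> 'o \<Rightarrow> 'o" (infixr \<open>\<diamondop>\<close> 80) and U :: 'o
    and tens :: "'x \<Rightarrow> 'x \<Rightarrow> 'x" (infixr \<open>\<star>\<close> 70)
    and asc asci :: "'o \<Rightarrow> 'o \<Rightarrow> 'o \<Rightarrow> 'x" and lu lui ru rui :: "'o \<Rightarrow> 'x"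
    and br bri :: "'o \<Rightarrow> 'o \<Rightarrow> 'x" and tw twi :: "'o \<Rightarrow> 'x"
  assumes comp_assoc [simp]: "(f \<bullet> g) \<bullet> h = f \<bullet> (g \<bullet> h)"
    and src_comp [simp]: "src (f \<bullet> g) = src g"
    and tgt_comp [simp]: "tgt (f \<bullet> g) = tgt f"
    and arr_comp [simp]: "\<lbrakk>arr f; arr g\<rbrakk> \<Longrightarrow> arr (f \<bullet> g)"
    and id_typing [simp]: "arr (id A)" "src (id A) = A" "tgt (id A) = A"
    and comp_id [simp]: "\<lbrakk>arr f; src f = A\<rbrakk> \<Longrightarrow> f \<bullet> id A = f"
    and id_comp [simp]: "\<lbrakk>arr f; tgt f = A\<rbrakk> \<Longrightarrow> id A \<bullet> f = f"
    and src_tens [simp]: "src (f \<star> g) = src f \<diamondop> src g"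
    and tgt_tens [simp]: "tgt (f \<star> g) = tgt f \<diamondop> tgt g"
    and arr_tens [simp]: "\<lbrakk>arr f; arr g\<rbrakk> \<Longrightarrow> arr (f \<star> g)"
    and tens_id [simp]: "id A \<star> id B = id (A \<diamondop> B)"
    and interchange: "\<lbrakk>arr f; arr g; arr h; arr k; src f = tgt h; src g = tgt k\<rbrakk>
          \<Longrightarrow> (f \<star> g) \<bullet> (h \<star> k) = (f \<bullet> h) \<star> (g \<bullet> k)"
    and asc_typing [simp]: "arr (asc A B D)" "src (asc A B D) = (A \<diamondop> B) \<diamondop> D" "tgt (asc A B D) = A \<diamondop> (B \<diamondop> D)"
    and asci_typing [simp]: "arr (asci A B D)" "src (asci A B D) = A \<diamondop> (B \<diamondop> D)" "tgt (asci A B D) = (A \<diamondop> B) \<diamondop> D"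
    and asci_asc: "asci A B D \<bullet> asc A B D = id ((A \<diamondop> B) \<diamondop> D)"
    and asc_asci: "asc A B D \<bullet> asci A B D = id (A \<diamondop> (B \<diamondop> D))"
    and asc_natural: "\<lbrakk>arr f; arr g; arr h\<rbrakk> \<Longrightarrow>
          asc (tgt f) (tgt g) (tgt h) \<bullet> ((f \<star> g) \<star> h) = (f \<star> (g \<star> h)) \<bullet> asc (src f) (src g) (src h)"
    and lu_typing [simp]: "arr (lu A)" "src (lu A) = U \<diamondop> A" "tgt (lu A) = A"
    and lui_typing [simp]: "arr (lui A)" "src (lui A) = A" "tgt (lui A) = U \<diamondop> A"
    and lui_lu: "lui A \<bullet> lu A = id (U \<diamondop> A)"
    and lu_lui: "lu A \<bullet> lui A = id A"
    and lu_natural: "arr f \<Longrightarrow> lu (tgt f) \<bullet> (id U \<star> f) = f \<bullet> lu (src f)"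
    and ru_typing [simp]: "arr (ru A)" "src (ru A) = A \<diamondop> U" "tgt (ru A) = A"
    and rui_typing [simp]: "arr (rui A)" "src (rui A) = A" "tgt (rui A) = A \<diamondop> U"
    and rui_ru: "rui A \<bullet> ru A = id (A \<diamondop> U)"
    and ru_rui: "ru A \<bullet> rui A = id A"
    and ru_natural: "arr f \<Longrightarrow> ru (tgt f) \<bullet> (f \<star> id U) = f \<bullet> ru (src f)"
    and pentagon: "asc W X (Y \<diamondop> Z) \<bullet> asc (W \<diamondop> X) Y Z
        = (id W \<star> asc X Y Z) \<bullet> asc W (X \<diamondop> Y) Z \<bullet> (asc W X Y \<star> id Z)"
    and triangle: "(id X \<star> lu Y) \<bullet> asc X U Y = ru X \<star> id Y"
    and br_typing [simp]: "arr (br A B)" "src (br A B) = A \<diamondop> B" "tgt (br A B) = B \<diamondop> A"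
    and bri_typing [simp]: "arr (bri A B)" "src (bri A B) = B \<diamondop> A" "tgt (bri A B) = A \<diamondop> B"
    and bri_br: "bri A B \<bullet> br A B = id (A \<diamondop> B)"
    and br_bri: "br A B \<bullet> bri A B = id (B \<diamondop> A)"
    and br_natural: "\<lbrakk>arr f; arr g\<rbrakk>
          \<Longrightarrow> br (tgt f) (tgt g) \<bullet> (f \<star> g) = (g \<star> f) \<bullet> br (src f) (src g)"
    and hexagon: "asc Y Z X \<bullet> br X (Y \<diamondop> Z) \<bullet> asc X Y Z
        = (id Y \<star> br X Z) \<bullet> asc Y X Z \<bullet> (br X Y \<star> id Z)"
    and hexagon_inv: "asci Z X Y \<bullet> br (X \<diamondop> Y) Z \<bullet> asci X Y Z
        = (br X Z \<star> id Y) \<bullet> asci X Z Y \<bullet> (id X \<star> br Y Z)"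
    and tw_typing [simp]: "arr (tw A)" "src (tw A) = A" "tgt (tw A) = A"
    and twi_typing [simp]: "arr (twi A)" "src (twi A) = A" "tgt (twi A) = A"
    and twi_tw: "twi A \<bullet> tw A = id A"
    and tw_twi: "tw A \<bullet> twi A = id A"
    and tw_natural: "arr f \<Longrightarrow> tw (tgt f) \<bullet> f = f \<bullet> tw (src f)"
    and tw_tens: "tw (A \<diamondop> B) = br B A \<bullet> br A B \<bullet> (tw A \<star> tw B)"
begin

lemma whisker_left_comp: "\<lbrakk>arr f; arr g; src f = tgt g\<rbrakk> \<Longrightarrow> id A \<star> (f \<bullet> g) = (id A \<star> f) \<bullet> (id A \<star> g)"
  by (simp add: interchange)

lemma whisker_right_comp: "\<lbrakk>arr f; arr g; src f = tgt g\<rbrakk> \<Longrightarrow> (f \<bullet> g) \<star> id A = (f \<star> id A) \<bullet> (g \<star> id A)"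
  by (simp add: interchange)

lemmas whisker = whisker_left_comp whisker_right_comp

lemma cancel_head:
  assumes "g \<bullet> f = id A" "arr h" "tgt h = A"
  shows "g \<bullet> f \<bullet> h = h"
  by (metis assms comp_assoc id_comp)

lemma cancel_right:
  assumes "f \<bullet> h = g \<bullet> h" "h \<bullet> k = id A" "arr f" "arr g" "src f = A" "src g = A"
  shows "f = g"
  by (metis assms comp_assoc comp_id)

lemma cancel_left:
  assumes "h \<bullet> f = h \<bullet> g" "k \<bullet> h = id A" "arr f" "arr g" "tgt f = A" "tgt g = A"
  shows "f = g"
  by (metis assms comp_assoc id_comp)

subsection \<open>Coherence of the unitors\<close>

lemma unit_tens_faithful:
  assumes "id U \<star> f = id U \<star> g" "arr f" "arr g" "src f = A" "src g = A" "tgt f = tgt g"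
  shows "f = g"
proof (rule cancel_right[of _ "lu A" _ "lui A"])
  show "f \<bullet> lu A = g \<bullet> lu A" using lu_natural[of f] lu_natural[of g] assms by simp
qed (use assms lu_lui in auto)

lemma tens_unit_faithful:
  assumes "f \<star> id U = g \<star> id U" "arr f" "arr g" "src f = A" "src g = A" "tgt f = tgt g"
  shows "f = g"
proof (rule cancel_right[of _ "ru A" _ "rui A"])
  show "f \<bullet> ru A = g \<bullet> ru A" using ru_natural[of f] ru_natural[of g] assms by simp
qed (use assms ru_rui in auto)

text \<open>
  Kelly's argument: after tensoring with the unit, the claim follows from the pentagon for
  \<open>U, U, A, B\<close> and the triangle.
\<close>

lemma lu_tens: "lu (A \<diamondop> B) \<bullet> asc U A B = lu A \<star> id B"
proof (rule unit_tens_faithful)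
  let ?h = "asc U (U \<diamondop> A) B \<bullet> (asc U U A \<star> id B)"
  show "id U \<star> (lu (A \<diamondop> B) \<bullet> asc U A B) = id U \<star> (lu A \<star> id B)"
  proof (rule cancel_right)
    have "(id U \<star> (lu (A \<diamondop> B) \<bullet> asc U A B)) \<bullet> ?h
        = ((id U \<star> lu (A \<diamondop> B)) \<bullet> asc U U (A \<diamondop> B)) \<bullet> asc (U \<diamondop> U) A B"
      by (simp add: whisker pentagon)
    also have "\<dots> = (ru U \<star> id (A \<diamondop> B)) \<bullet> asc (U \<diamondop> U) A B" by (simp only: triangle)
    also have "\<dots> = asc U A B \<bullet> ((ru U \<star> id A) \<star> id B)"
      using asc_natural[of "ru U" "id A" "id B"] by simp
    also have "\<dots> = (asc U A B \<bullet> ((id U \<star> lu A) \<star> id B)) \<bullet> (asc U U A \<star> id B)"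
      by (simp add: whisker flip: triangle)
    also have "asc U A B \<bullet> ((id U \<star> lu A) \<star> id B) = (id U \<star> (lu A \<star> id B)) \<bullet> asc U (U \<diamondop> A) B"
      using asc_natural[of "id U" "lu A" "id B"] by simp
    finally show "(id U \<star> (lu (A \<diamondop> B) \<bullet> asc U A B)) \<bullet> ?h = (id U \<star> (lu A \<star> id B)) \<bullet> ?h" by simp
    have "?h \<bullet> (asci U U A \<star> id B) \<bullet> asci U (U \<diamondop> A) B
       = asc U (U \<diamondop> A) B \<bullet> ((asc U U A \<bullet> asci U U A) \<star> id B) \<bullet> asci U (U \<diamondop> A) B"
      by (simp add: whisker)
    then show "?h \<bullet> (asci U U A \<star> id B) \<bullet> asci U (U \<diamondop> A) B = id (U \<diamondop> ((U \<diamondop> A) \<diamondop> B))"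
      by (simp add: asc_asci)
  qed simp_all
qed simp_all

text \<open>
  The same argument with the pentagon for \<open>A, B, U, U\<close>.
\<close>

lemma ru_tens: "(id A \<star> ru B) \<bullet> asc A B U = ru (A \<diamondop> B)"
proof (rule tens_unit_faithful)
  show "((id A \<star> ru B) \<bullet> asc A B U) \<star> id U = ru (A \<diamondop> B) \<star> id U"
  proof (rule cancel_left)
    have "asc A B U \<bullet> (ru (A \<diamondop> B) \<star> id U) = (asc A B U \<bullet> (id (A \<diamondop> B) \<star> lu U)) \<bullet> asc (A \<diamondop> B) U U"
      by (simp flip: triangle)
    also have "asc A B U \<bullet> (id (A \<diamondop> B) \<star> lu U) = (id A \<star> (id B \<star> lu U)) \<bullet> asc A B (U \<diamondop> U)"
      using asc_natural[of "id A" "id B" "lu U"] by simp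
    also have "\<dots> \<bullet> asc (A \<diamondop> B) U U
        = (id A \<star> ((id B \<star> lu U) \<bullet> asc B U U)) \<bullet> asc A (B \<diamondop> U) U \<bullet> (asc A B U \<star> id U)"
      by (simp add: whisker pentagon)
    also have "\<dots> = ((id A \<star> (ru B \<star> id U)) \<bullet> asc A (B \<diamondop> U) U) \<bullet> (asc A B U \<star> id U)"
      by (simp add: triangle)
    also have "(id A \<star> (ru B \<star> id U)) \<bullet> asc A (B \<diamondop> U) U = asc A B U \<bullet> ((id A \<star> ru B) \<star> id U)"
      using asc_natural[of "id A" "ru B" "id U"] by simp
    finally show "asc A B U \<bullet> (((id A \<star> ru B) \<bullet> asc A B U) \<star> id U) = asc A B U \<bullet> (ru (A \<diamondop> B) \<star> id U)"
      by (simp add: whisker)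
  qed (rule asci_asc, simp_all)
qed simp_all

lemma lu_unit: "lu U = ru U"
proof (rule tens_unit_faithful)
  have "lu (U \<diamondop> U) = id U \<star> lu U"
    by (rule cancel_left[of "lu U" _ _ "lui U"]) (use lu_natural[of "lu U"] in \<open>simp_all add: lui_lu\<close>)
  then show "lu U \<star> id U = ru U \<star> id U"
    using lu_tens[of U U] triangle[of U U] by simp
qed simp_all

lemma ru_tens_unit: "ru (A \<diamondop> U) = ru A \<star> id U"
  by (rule cancel_left[of "ru A" _ _ "rui A"]) (use ru_natural[of "ru A"] in \<open>simp_all add: rui_ru\<close>)

subsection \<open>Rebracketing of lists\<close>

text \<open>
  Lists are bracketed to the right and end in the unit, so that concatenation nests.
\<close>

definition obj :: "'o list \<Rightarrow> 'o" where
  "obj As = foldr (\<diamondop>) As U"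

lemma obj_simps [simp]: "obj [] = U" "obj (A # As) = A \<diamondop> obj As"
  by (simp_all add: obj_def)

text \<open>
  The rebracketing isomorphism \<open>obj As \<otimes> Z \<rightarrow> act As Z\<close>. Having an arbitrary object \<open>Z\<close> in place of
  \<open>obj Bs\<close> makes it natural in \<open>Z\<close>, as the comparison for appended lists requires.
\<close>

fun mu mui :: "'o list \<Rightarrow> 'o \<Rightarrow> 'x" where
  "mu [] Z = lu Z"
| "mu (A # As) Z = (id A \<star> mu As Z) \<bullet> asc A (obj As) Z"
| "mui [] Z = lui Z"
| "mui (A # As) Z = asci A (obj As) Z \<bullet> (id A \<star> mui As Z)"

abbreviation act :: "'o list \<Rightarrow> 'o \<Rightarrow> 'o" where "act As Z \<equiv> foldr (\<diamondop>) As Z"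
abbreviation whisk :: "'o list \<Rightarrow> 'x \<Rightarrow> 'x" where "whisk As f \<equiv> foldr (\<lambda>A g. id A \<star> g) As f"

lemma mu_typing [simp]: "arr (mu As Z)" "src (mu As Z) = obj As \<diamondop> Z" "tgt (mu As Z) = act As Z"
  by (induction As) simp_all
lemma mui_typing [simp]: "arr (mui As Z)" "tgt (mui As Z) = obj As \<diamondop> Z" "src (mui As Z) = act As Z"
  by (induction As) simp_all
lemma whisk_typing [simp]: "arr f \<Longrightarrow> arr (whisk As f)" "src (whisk As f) = act As (src f)"
  "tgt (whisk As f) = act As (tgt f)"
  by (induction As) simp_all

lemma mui_mu: "mui As Z \<bullet> mu As Z = id (obj As \<diamondop> Z)"
proof (induction As)
  case Nil then show ?case by (simp add: lui_lu)
next
  case (Cons A As)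
  have "mui (A # As) Z \<bullet> mu (A # As) Z = asci A (obj As) Z \<bullet> (id A \<star> (mui As Z \<bullet> mu As Z)) \<bullet> asc A (obj As) Z"
    by (simp add: whisker)
  then show ?case by (simp add: Cons asci_asc)
qed

lemma mu_mui: "mu As Z \<bullet> mui As Z = id (act As Z)"
proof (induction As)
  case Nil then show ?case by (simp add: lu_lui)
next
  case (Cons A As)
  have "mu (A # As) Z \<bullet> mui (A # As) Z = (id A \<star> mu As Z) \<bullet> (asc A (obj As) Z \<bullet> asci A (obj As) Z) \<bullet> (id A \<star> mui As Z)"
    by simp
  then show ?case by (simp add: Cons asc_asci flip: whisker)
qed

lemma mu_natural: "arr f \<Longrightarrow> mu As (tgt f) \<bullet> (id (obj As) \<star> f) = whisk As f \<bullet> mu As (src f)"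
proof (induction As)
  case Nil then show ?case by (simp add: lu_natural)
next
  case (Cons A As)
  have "mu (A # As) (tgt f) \<bullet> (id (obj (A # As)) \<star> f)
     = (id A \<star> mu As (tgt f)) \<bullet> (asc A (obj As) (tgt f) \<bullet> ((id A \<star> id (obj As)) \<star> f))" by simp
  also have "asc A (obj As) (tgt f) \<bullet> ((id A \<star> id (obj As)) \<star> f) = (id A \<star> (id (obj As) \<star> f)) \<bullet> asc A (obj As) (src f)"
    using asc_natural[of "id A" "id (obj As)" f] Cons.prems by simp
  also have "(id A \<star> mu As (tgt f)) \<bullet> \<dots> = (id A \<star> (mu As (tgt f) \<bullet> (id (obj As) \<star> f))) \<bullet> asc A (obj As) (src f)"
    using Cons.prems by (simp add: whisker)
  also have "\<dots> = whisk (A # As) f \<bullet> mu (A # As) (src f)"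
    using Cons by (simp add: whisker)
  finally show ?case .
qed

text \<open>
  Induction with one pentagon for each step; the base case is the left unit coherence.
\<close>

lemma mu_append: "whisk As (mu Bs Z) \<bullet> mu As (obj Bs \<diamondop> Z) \<bullet> asc (obj As) (obj Bs) Z
   = mu (As @ Bs) Z \<bullet> (mu As (obj Bs) \<star> id Z)"
proof (induction As)
  case Nil
  have "mu Bs Z \<bullet> lu (obj Bs \<diamondop> Z) \<bullet> asc U (obj Bs) Z = mu Bs Z \<bullet> (lu (obj Bs) \<star> id Z)"
    by (simp add: lu_tens)
  then show ?case by simp
next
  case (Cons A As)
  have o: "obj (As @ Bs) = act As (obj Bs)" by (simp add: obj_def)
  have "whisk (A # As) (mu Bs Z) \<bullet> mu (A # As) (obj Bs \<diamondop> Z) \<bullet> asc (obj (A # As)) (obj Bs) Z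
     = (id A \<star> whisk As (mu Bs Z)) \<bullet> (id A \<star> mu As (obj Bs \<diamondop> Z)) \<bullet> (asc A (obj As) (obj Bs \<diamondop> Z) \<bullet> asc (A \<diamondop> obj As) (obj Bs) Z)"
    by simp
  also have "\<dots> = (id A \<star> (whisk As (mu Bs Z) \<bullet> mu As (obj Bs \<diamondop> Z) \<bullet> asc (obj As) (obj Bs) Z))
      \<bullet> asc A (obj As \<diamondop> obj Bs) Z \<bullet> (asc A (obj As) (obj Bs) \<star> id Z)"
    by (simp add: pentagon whisker)
  also have "\<dots> = (id A \<star> mu (As @ Bs) Z) \<bullet> ((id A \<star> (mu As (obj Bs) \<star> id Z))
      \<bullet> asc A (obj As \<diamondop> obj Bs) Z) \<bullet> (asc A (obj As) (obj Bs) \<star> id Z)"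
    by (subst Cons) (simp add: whisker o)
  also have "(id A \<star> (mu As (obj Bs) \<star> id Z)) \<bullet> asc A (obj As \<diamondop> obj Bs) Z
     = asc A (act As (obj Bs)) Z \<bullet> ((id A \<star> mu As (obj Bs)) \<star> id Z)"
    using asc_natural[of "id A" "mu As (obj Bs)" "id Z"] by simp
  finally show ?case by (simp add: whisker o)
qed

definition join where "join As Bs = mu As (obj Bs)"
definition unjoin where "unjoin As Bs = mui As (obj Bs)"

lemma obj_append: "obj (As @ Bs) = act As (obj Bs)" by (simp add: obj_def)

lemma join_typing [simp]: "arr (join As Bs)" "src (join As Bs) = obj As \<diamondop> obj Bs" "tgt (join As Bs) = obj (As @ Bs)"
  by (simp_all add: join_def obj_append)
lemma unjoin_typing [simp]: "arr (unjoin As Bs)" "tgt (unjoin As Bs) = obj As \<diamondop> obj Bs" "src (unjoin As Bs) = obj (As @ Bs)"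
  by (simp_all add: unjoin_def obj_append)

lemma unjoin_join: "unjoin As Bs \<bullet> join As Bs = id (obj As \<diamondop> obj Bs)"
  by (simp add: join_def unjoin_def mui_mu)
lemma join_unjoin: "join As Bs \<bullet> unjoin As Bs = id (obj (As @ Bs))"
  by (simp add: join_def unjoin_def mu_mui obj_append)

lemma join_Nil_left: "join [] Bs = lu (obj Bs)" by (simp add: join_def)
lemma unjoin_Nil_left: "unjoin [] Bs = lui (obj Bs)" by (simp add: unjoin_def)

lemma join_Nil_right: "join As [] = ru (obj As)"
  by (induction As) (simp_all add: join_def lu_unit ru_tens)

lemma unjoin_Nil_right: "unjoin As [] = rui (obj As)"
proof (rule cancel_left[of "join As []"])
  show "join As [] \<bullet> unjoin As [] = join As [] \<bullet> rui (obj As)"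
    unfolding join_unjoin unfolding join_Nil_right by (simp add: ru_rui)
qed (use unjoin_join[of As "[]"] in simp_all)

text \<open>
  The coherence law from which associativity of the strict tensor product and the strict hexagons follow.
\<close>

lemma join_assoc: "join As (Bs @ Ds) \<bullet> (id (obj As) \<star> join Bs Ds) \<bullet> asc (obj As) (obj Bs) (obj Ds)
   = join (As @ Bs) Ds \<bullet> (join As Bs \<star> id (obj Ds))"
  using mu_natural[of "mu Bs (obj Ds)" As] mu_append[of As Bs "obj Ds"]
  by (simp add: join_def obj_append flip: comp_assoc)

lemma unjoin_assoc: "asc (obj As) (obj Bs) (obj Ds) \<bullet> (unjoin As Bs \<star> id (obj Ds)) \<bullet> unjoin (As @ Bs) Ds
   = (id (obj As) \<star> unjoin Bs Ds) \<bullet> unjoin As (Bs @ Ds)" (is "?l = ?r")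
proof (rule cancel_left)
  show "(join As (Bs @ Ds) \<bullet> (id (obj As) \<star> join Bs Ds)) \<bullet> ?l = (join As (Bs @ Ds) \<bullet> (id (obj As) \<star> join Bs Ds)) \<bullet> ?r"
  proof -
    have "(join As (Bs @ Ds) \<bullet> (id (obj As) \<star> join Bs Ds)) \<bullet> ?l
      = (join As (Bs @ Ds) \<bullet> (id (obj As) \<star> join Bs Ds) \<bullet> asc (obj As) (obj Bs) (obj Ds)) \<bullet> (unjoin As Bs \<star> id (obj Ds)) \<bullet> unjoin (As @ Bs) Ds"
      by simp
    also have "\<dots> = join (As @ Bs) Ds \<bullet> ((join As Bs \<bullet> unjoin As Bs) \<star> id (obj Ds)) \<bullet> unjoin (As @ Bs) Ds"
      by (simp only: join_assoc) (simp add: whisker)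
    also have "\<dots> = id (obj (As @ Bs @ Ds))" by (simp add: join_unjoin)
    also have "\<dots> = join As (Bs @ Ds) \<bullet> (id (obj As) \<star> (join Bs Ds \<bullet> unjoin Bs Ds)) \<bullet> unjoin As (Bs @ Ds)"
      by (simp add: join_unjoin)
    finally show ?thesis by (simp add: whisker)
  qed
  have "((id (obj As) \<star> unjoin Bs Ds) \<bullet> unjoin As (Bs @ Ds)) \<bullet> join As (Bs @ Ds) \<bullet> (id (obj As) \<star> join Bs Ds)
     = (id (obj As) \<star> unjoin Bs Ds) \<bullet> (unjoin As (Bs @ Ds) \<bullet> join As (Bs @ Ds)) \<bullet> (id (obj As) \<star> join Bs Ds)"
    by simp
  then show "((id (obj As) \<star> unjoin Bs Ds) \<bullet> unjoin As (Bs @ Ds)) \<bullet> join As (Bs @ Ds) \<bullet> (id (obj As) \<star> join Bs Ds)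
     = id (obj As \<diamondop> (obj Bs \<diamondop> obj Ds))"
    by (simp add: unjoin_join flip: whisker)
qed simp_all


subsection \<open>The strict category of lists\<close>

text \<open>
  An arrow of the strictification is an arrow between the bracketed lists, together with these lists; tensor products are conjugated by the rebracketing isomorphisms.
\<close>

fun sarr where "sarr (As, Bs, f) \<longleftrightarrow> arr f \<and> src f = obj As \<and> tgt f = obj Bs"
fun ssrc :: "'o list \<times> 'o list \<times> 'x \<Rightarrow> 'o list" where "ssrc (As, Bs, f) = As"
fun stgt :: "'o list \<times> 'o list \<times> 'x \<Rightarrow> 'o list" where "stgt (As, Bs, f) = Bs"
definition sid where "sid As = (As, As, id (obj As))"
fun scomp :: "'o list \<times> 'o list \<times> 'x \<Rightarrow> 'o list \<times> 'o list \<times> 'x \<Rightarrow> 'o list \<times> 'o list \<times> 'x" (infixr \<open>\<bullet>\<^sub>s\<close> 60)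
  where "(As, Bs, f) \<bullet>\<^sub>s (As', Bs', f') = (As', Bs, f \<bullet> f')"
fun stens :: "'o list \<times> 'o list \<times> 'x \<Rightarrow> 'o list \<times> 'o list \<times> 'x \<Rightarrow> 'o list \<times> 'o list \<times> 'x" (infixr \<open>\<star>\<^sub>s\<close> 70)
  where "(As, Bs, f) \<star>\<^sub>s (As', Bs', f') = (As @ As', Bs @ Bs', join Bs Bs' \<bullet> (f \<star> f') \<bullet> unjoin As As')"
definition sbr where "sbr As Bs = (As @ Bs, Bs @ As, join Bs As \<bullet> br (obj As) (obj Bs) \<bullet> unjoin As Bs)"
definition sbri where "sbri As Bs = (Bs @ As, As @ Bs, join As Bs \<bullet> bri (obj As) (obj Bs) \<bullet> unjoin Bs As)"
definition stw where "stw As = (As, As, tw (obj As))"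
definition stwi where "stwi As = (As, As, twi (obj As))"

lemma unjoin_join_cancel: "arr h \<Longrightarrow> tgt h = obj As \<diamondop> obj Bs \<Longrightarrow> unjoin As Bs \<bullet> join As Bs \<bullet> h = h"
  by (rule cancel_head[OF unjoin_join])

lemma stens_assoc:
  assumes "arr f" "src f = obj A" "tgt f = obj B" "arr g" "src g = obj A'" "tgt g = obj B'"
    "arr h" "src h = obj A''" "tgt h = obj B''"
  shows "join (B @ B') B'' \<bullet> ((join B B' \<bullet> (f \<star> g) \<bullet> unjoin A A') \<star> h) \<bullet> unjoin (A @ A') A''
    = join B (B' @ B'') \<bullet> (f \<star> (join B' B'' \<bullet> (g \<star> h) \<bullet> unjoin A' A'')) \<bullet> unjoin A (A' @ A'')"
proof -
  have "(join B B' \<bullet> (f \<star> g) \<bullet> unjoin A A') \<star> h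
     = (join B B' \<star> id (obj B'')) \<bullet> ((f \<star> g) \<star> h) \<bullet> (unjoin A A' \<star> id (obj A''))"
    using assms by (simp add: interchange)
  then have "join (B @ B') B'' \<bullet> ((join B B' \<bullet> (f \<star> g) \<bullet> unjoin A A') \<star> h) \<bullet> unjoin (A @ A') A''
     = (join (B @ B') B'' \<bullet> (join B B' \<star> id (obj B''))) \<bullet> ((f \<star> g) \<star> h) \<bullet> (unjoin A A' \<star> id (obj A'')) \<bullet> unjoin (A @ A') A''"
    by simp
  also have "\<dots> = join B (B' @ B'') \<bullet> (id (obj B) \<star> join B' B'') \<bullet> (asc (obj B) (obj B') (obj B'') \<bullet> ((f \<star> g) \<star> h)) \<bullet> (unjoin A A' \<star> id (obj A'')) \<bullet> unjoin (A @ A') A''"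
    by (simp flip: join_assoc)
  also have "asc (obj B) (obj B') (obj B'') \<bullet> ((f \<star> g) \<star> h) = (f \<star> (g \<star> h)) \<bullet> asc (obj A) (obj A') (obj A'')"
    using asc_natural[of f g h] assms by simp
  also have "join B (B' @ B'') \<bullet> (id (obj B) \<star> join B' B'') \<bullet> \<dots> \<bullet> (unjoin A A' \<star> id (obj A'')) \<bullet> unjoin (A @ A') A''
     = join B (B' @ B'') \<bullet> ((id (obj B) \<star> join B' B'') \<bullet> (f \<star> (g \<star> h)) \<bullet> (id (obj A) \<star> unjoin A' A'')) \<bullet> unjoin A (A' @ A'')"
    by (simp add: unjoin_assoc)
  also have "(id (obj B) \<star> join B' B'') \<bullet> (f \<star> (g \<star> h)) \<bullet> (id (obj A) \<star> unjoin A' A'')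
     = f \<star> (join B' B'' \<bullet> (g \<star> h) \<bullet> unjoin A' A'')"
    using assms by (simp add: interchange)
  finally show ?thesis .
qed

text \<open>
  The rebracketings between the two strict braidings cancel up to one associator by \<open>join_assoc\<close>, and
  the hexagon applies.
\<close>

lemma sbr_tens_right:
  "join (B @ D) A \<bullet> br (obj A) (obj (B @ D)) \<bullet> unjoin A (B @ D)
   = (join B (D @ A) \<bullet> (id (obj B) \<star> (join D A \<bullet> br (obj A) (obj D) \<bullet> unjoin A D)) \<bullet> unjoin B (A @ D))
     \<bullet> (join (B @ A) D \<bullet> ((join B A \<bullet> br (obj A) (obj B) \<bullet> unjoin A B) \<star> id (obj D)) \<bullet> unjoin (A @ B) D)"
   (is "?l = ?r")
proof -
  let ?a = "obj A" and ?b = "obj B" and ?d = "obj D"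
  have 1: "unjoin B (A @ D) \<bullet> join (B @ A) D \<bullet> (join B A \<star> id ?d) \<bullet> h = (id ?b \<star> join A D) \<bullet> asc ?b ?a ?d \<bullet> h"
    if "arr h" "tgt h = (?b \<diamondop> ?a) \<diamondop> ?d" for h
  proof -
    have "unjoin B (A @ D) \<bullet> join (B @ A) D \<bullet> (join B A \<star> id ?d) \<bullet> h
       = unjoin B (A @ D) \<bullet> (join (B @ A) D \<bullet> (join B A \<star> id ?d)) \<bullet> h" by simp
    also have "\<dots> = unjoin B (A @ D) \<bullet> join B (A @ D) \<bullet> (id ?b \<star> join A D) \<bullet> asc ?b ?a ?d \<bullet> h"
      by (simp flip: join_assoc)
    finally show ?thesis using that by (simp add: unjoin_join_cancel)
  qed
  have "?r = join B (D @ A) \<bullet> (id ?b \<star> join D A) \<bullet> (id ?b \<star> br ?a ?d) \<bullet> (id ?b \<star> (unjoin A D \<bullet> join A D))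
      \<bullet> asc ?b ?a ?d \<bullet> (br ?a ?b \<star> id ?d) \<bullet> (unjoin A B \<star> id ?d) \<bullet> unjoin (A @ B) D"
    by (simp add: whisker 1)
  also have "\<dots> = join B (D @ A) \<bullet> (id ?b \<star> join D A) \<bullet> ((id ?b \<star> br ?a ?d)
      \<bullet> asc ?b ?a ?d \<bullet> (br ?a ?b \<star> id ?d)) \<bullet> (unjoin A B \<star> id ?d) \<bullet> unjoin (A @ B) D"
    by (simp add: unjoin_join)
  also have "\<dots> = (join B (D @ A) \<bullet> (id ?b \<star> join D A) \<bullet> asc ?b ?d ?a) \<bullet> br ?a (?b \<diamondop> ?d)
      \<bullet> (asc ?a ?b ?d \<bullet> (unjoin A B \<star> id ?d) \<bullet> unjoin (A @ B) D)"
    by (simp flip: hexagon)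
  also have "\<dots> = join (B @ D) A \<bullet> ((join B D \<star> id ?a) \<bullet> br ?a (?b \<diamondop> ?d))
      \<bullet> (id ?a \<star> unjoin B D) \<bullet> unjoin A (B @ D)"
    unfolding join_assoc unjoin_assoc by simp
  also have "(join B D \<star> id ?a) \<bullet> br ?a (?b \<diamondop> ?d) = br ?a (obj (B @ D)) \<bullet> (id ?a \<star> join B D)"
    using br_natural[of "id ?a" "join B D"] by simp
  also have "join (B @ D) A \<bullet> \<dots> \<bullet> (id ?a \<star> unjoin B D) \<bullet> unjoin A (B @ D)
     = join (B @ D) A \<bullet> br ?a (obj (B @ D)) \<bullet> (id ?a \<star> (join B D \<bullet> unjoin B D)) \<bullet> unjoin A (B @ D)"
    by (simp add: whisker)
  also have "\<dots> = ?l" by (simp add: join_unjoin)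
  finally show ?thesis ..
qed

lemma join_assoc': "(join As (Bs @ Ds) \<bullet> (id (obj As) \<star> join Bs Ds))
   = join (As @ Bs) Ds \<bullet> (join As Bs \<star> id (obj Ds)) \<bullet> asci (obj As) (obj Bs) (obj Ds)"
proof -
  have "join (As @ Bs) Ds \<bullet> (join As Bs \<star> id (obj Ds)) \<bullet> asci (obj As) (obj Bs) (obj Ds)
    = (join (As @ Bs) Ds \<bullet> (join As Bs \<star> id (obj Ds))) \<bullet> asci (obj As) (obj Bs) (obj Ds)" by simp
  also have "\<dots> = join As (Bs @ Ds) \<bullet> (id (obj As) \<star> join Bs Ds) \<bullet> asc (obj As) (obj Bs) (obj Ds) \<bullet> asci (obj As) (obj Bs) (obj Ds)"
    by (simp flip: join_assoc)
  finally show ?thesis by (simp add: asc_asci)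
qed

lemma unjoin_assoc': "(unjoin As Bs \<star> id (obj Ds)) \<bullet> unjoin (As @ Bs) Ds
   = asci (obj As) (obj Bs) (obj Ds) \<bullet> (id (obj As) \<star> unjoin Bs Ds) \<bullet> unjoin As (Bs @ Ds)"
  by (simp flip: unjoin_assoc add: cancel_head[OF asci_asc])

lemma sbr_tens_left:
  "join D (A @ B) \<bullet> br (obj (A @ B)) (obj D) \<bullet> unjoin (A @ B) D
   = (join (D @ A) B \<bullet> ((join D A \<bullet> br (obj A) (obj D) \<bullet> unjoin A D) \<star> id (obj B)) \<bullet> unjoin (A @ D) B)
     \<bullet> (join A (D @ B) \<bullet> (id (obj A) \<star> (join D B \<bullet> br (obj B) (obj D) \<bullet> unjoin B D)) \<bullet> unjoin A (B @ D))"
   (is "?l = ?r")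
proof -
  let ?a = "obj A" and ?b = "obj B" and ?d = "obj D"
  have 1: "unjoin (A @ D) B \<bullet> join A (D @ B) \<bullet> (id ?a \<star> join D B) \<bullet> h = (join A D \<star> id ?b) \<bullet> asci ?a ?d ?b \<bullet> h"
    if "arr h" "tgt h = ?a \<diamondop> (?d \<diamondop> ?b)" for h
  proof -
    have "unjoin (A @ D) B \<bullet> join A (D @ B) \<bullet> (id ?a \<star> join D B) \<bullet> h
       = unjoin (A @ D) B \<bullet> (join A (D @ B) \<bullet> (id ?a \<star> join D B)) \<bullet> h" by simp
    also have "\<dots> = unjoin (A @ D) B \<bullet> join (A @ D) B \<bullet> (join A D \<star> id ?b) \<bullet> asci ?a ?d ?b \<bullet> h"
      by (simp add: join_assoc')
    finally show ?thesis using that by (simp add: unjoin_join_cancel)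
  qed
  have "?r = join (D @ A) B \<bullet> (join D A \<star> id ?b) \<bullet> (br ?a ?d \<star> id ?b) \<bullet> ((unjoin A D \<bullet> join A D) \<star> id ?b)
      \<bullet> asci ?a ?d ?b \<bullet> (id ?a \<star> br ?b ?d) \<bullet> (id ?a \<star> unjoin B D) \<bullet> unjoin A (B @ D)"
    by (simp add: whisker 1)
  also have "\<dots> = join (D @ A) B \<bullet> (join D A \<star> id ?b) \<bullet> ((br ?a ?d \<star> id ?b)
      \<bullet> asci ?a ?d ?b \<bullet> (id ?a \<star> br ?b ?d)) \<bullet> (id ?a \<star> unjoin B D) \<bullet> unjoin A (B @ D)"
    by (simp add: unjoin_join)
  also have "\<dots> = (join (D @ A) B \<bullet> (join D A \<star> id ?b) \<bullet> asci ?d ?a ?b) \<bullet> br (?a \<diamondop> ?b) ?d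
      \<bullet> (asci ?a ?b ?d \<bullet> (id ?a \<star> unjoin B D) \<bullet> unjoin A (B @ D))"
    by (simp flip: hexagon_inv)
  also have "\<dots> = join D (A @ B) \<bullet> ((id ?d \<star> join A B) \<bullet> br (?a \<diamondop> ?b) ?d)
      \<bullet> (unjoin A B \<star> id ?d) \<bullet> unjoin (A @ B) D"
    unfolding unjoin_assoc' join_assoc'[symmetric] by simp
  also have "(id ?d \<star> join A B) \<bullet> br (?a \<diamondop> ?b) ?d = br (obj (A @ B)) ?d \<bullet> (join A B \<star> id ?d)"
    using br_natural[of "join A B" "id ?d"] by simp
  also have "join D (A @ B) \<bullet> \<dots> \<bullet> (unjoin A B \<star> id ?d) \<bullet> unjoin (A @ B) D
     = join D (A @ B) \<bullet> br (obj (A @ B)) ?d \<bullet> ((join A B \<bullet> unjoin A B) \<star> id ?d) \<bullet> unjoin (A @ B) D"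
    by (simp add: whisker)
  also have "\<dots> = ?l" by (simp add: join_unjoin)
  finally show ?thesis ..
qed

lemma tens_via_join:
  assumes "arr f" "arr g" "arr h" "arr k" "src f = obj A" "src g = obj B" "tgt h = obj A" "tgt k = obj B"
  shows "(f \<star> g) \<bullet> unjoin A B \<bullet> join A B \<bullet> (h \<star> k) \<bullet> l = ((f \<bullet> h) \<star> (g \<bullet> k)) \<bullet> l"
proof -
  have "(f \<star> g) \<bullet> unjoin A B \<bullet> join A B \<bullet> (h \<star> k) = (f \<bullet> h) \<star> (g \<bullet> k)"
    using assms by (simp add: unjoin_join_cancel interchange)
  then show ?thesis by (metis comp_assoc)
qed

lemma join_conj_inverse:
  assumes "g \<bullet> f = id (obj A \<diamondop> obj B)" "arr f" "arr g" "src f = obj A \<diamondop> obj B" "tgt f = obj D \<diamondop> obj E"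
  shows "join A B \<bullet> g \<bullet> unjoin D E \<bullet> join D E \<bullet> f \<bullet> unjoin A B = id (obj (A @ B))"
  using assms by (simp add: unjoin_join_cancel cancel_head[OF assms(1)] join_unjoin)

lemma sbr_natural:
  assumes "arr f" "src f = obj A" "tgt f = obj A'" "arr g" "src g = obj B" "tgt g = obj B'"
  shows "join B' A' \<bullet> br (obj A') (obj B') \<bullet> unjoin A' B' \<bullet> join A' B' \<bullet> (f \<star> g) \<bullet> unjoin A B
    = join B' A' \<bullet> (g \<star> f) \<bullet> unjoin B A \<bullet> join B A \<bullet> br (obj A) (obj B) \<bullet> unjoin A B"
proof -
  have "br (obj A') (obj B') \<bullet> (f \<star> g) \<bullet> unjoin A B = (g \<star> f) \<bullet> br (obj A) (obj B) \<bullet> unjoin A B"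
    using br_natural[of f g] assms by (simp flip: comp_assoc)
  then show ?thesis using assms by (simp add: unjoin_join_cancel)
qed

lemma stw_tens:
  "tw (obj (A @ B)) = join A B \<bullet> br (obj B) (obj A) \<bullet> unjoin B A \<bullet> join B A \<bullet> br (obj A) (obj B)
     \<bullet> unjoin A B \<bullet> join A B \<bullet> (tw (obj A) \<star> tw (obj B)) \<bullet> unjoin A B"
proof -
  have "join A B \<bullet> br (obj B) (obj A) \<bullet> unjoin B A \<bullet> join B A \<bullet> br (obj A) (obj B)
     \<bullet> unjoin A B \<bullet> join A B \<bullet> (tw (obj A) \<star> tw (obj B)) \<bullet> unjoin A B
     = (join A B \<bullet> tw (obj A \<diamondop> obj B)) \<bullet> unjoin A B"
    by (simp add: unjoin_join_cancel tw_tens)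
  also have "join A B \<bullet> tw (obj A \<diamondop> obj B) = tw (obj (A @ B)) \<bullet> join A B"
    using tw_natural[of "join A B"] by simp
  finally show ?thesis by (simp add: join_unjoin)
qed

lemma stw_natural: "\<lbrakk>arr f; src f = A; tgt f = B\<rbrakk> \<Longrightarrow> tw B \<bullet> f = f \<bullet> tw A"
  using tw_natural by auto

sublocale strict: strict_balanced_category sarr ssrc stgt sid scomp stens sbr sbri stw stwi
proof (unfold_locales)
  fix F :: "'o list \<times> 'o list \<times> 'x" assume "sarr F"
  then show "sid [] \<star>\<^sub>s F = F" "F \<star>\<^sub>s sid [] = F"
    by (cases F, use lu_natural[of "snd (snd F)"] ru_natural[of "snd (snd F)"] in
      \<open>simp add: sid_def join_Nil_left unjoin_Nil_left lu_lui join_Nil_right unjoin_Nil_right ru_rui flip: comp_assoc,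
       simp add: lu_lui ru_rui\<close>)+
qed (auto simp: split_paired_all sid_def sbr_def sbri_def stw_def stwi_def twi_tw tw_twi
    stens_assoc join_unjoin tens_via_join join_conj_inverse bri_br br_bri
    intro: stw_natural sbr_natural stw_tens sbr_tens_right[simplified] sbr_tens_left[simplified])

end

section \<open>The embedding into the strictification\<close>

context balanced_category begin

text \<open>
  An object \<open>A\<close> is sent to the list \<open>[A]\<close>, which is bracketed as \<open>A \<otimes> U\<close>. This is a strong monoidal
  functor: \<open>unpack\<close> and \<open>drop_unit\<close> compare \<open>[A \<otimes> B]\<close> with \<open>[A, B]\<close> and \<open>[U]\<close> with \<open>[]\<close>.
\<close>

definition embed where "embed f = ([src f], [tgt f], f \<star> id U)"
definition unpack where "unpack A B = ([A \<diamondop> B], [A, B], asc A B U)"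
definition pack where "pack A B = ([A, B], [A \<diamondop> B], asci A B U)"
definition drop_unit where "drop_unit = ([U], [] :: 'o list, ru U)"
definition insert_unit where "insert_unit = ([] :: 'o list, [U], rui U)"

lemma embed_typing [simp]: "arr f \<Longrightarrow> sarr (embed f)" "ssrc (embed f) = [src f]" "stgt (embed f) = [tgt f]"
  by (simp_all add: embed_def)
lemma unpack_typing [simp]: "sarr (unpack A B)" "ssrc (unpack A B) = [A \<diamondop> B]" "stgt (unpack A B) = [A, B]"
  by (simp_all add: unpack_def)
lemma pack_typing [simp]: "sarr (pack A B)" "stgt (pack A B) = [A \<diamondop> B]" "ssrc (pack A B) = [A, B]"
  by (simp_all add: pack_def)
lemma unit_arrow_typing [simp]: "sarr drop_unit" "ssrc drop_unit = [U]" "stgt drop_unit = []" "sarr insert_unit" "ssrc insert_unit = []" "stgt insert_unit = [U]"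
  by (simp_all add: drop_unit_def insert_unit_def)

lemma unpack_pack [simp]: "unpack A B \<bullet>\<^sub>s pack A B = sid [A, B]" "pack A B \<bullet>\<^sub>s unpack A B = sid [A \<diamondop> B]"
  by (simp_all add: unpack_def pack_def sid_def asc_asci asci_asc)
lemma drop_insert_unit [simp]: "drop_unit \<bullet>\<^sub>s insert_unit = sid []" "insert_unit \<bullet>\<^sub>s drop_unit = sid [U]"
  by (simp_all add: drop_unit_def insert_unit_def sid_def ru_rui rui_ru)
lemma unpack_pack_cancel [simp]: "sarr h \<Longrightarrow> stgt h = [A, B] \<Longrightarrow> unpack A B \<bullet>\<^sub>s pack A B \<bullet>\<^sub>s h = h"
  "sarr h \<Longrightarrow> stgt h = [A \<diamondop> B] \<Longrightarrow> pack A B \<bullet>\<^sub>s unpack A B \<bullet>\<^sub>s h = h"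
  "sarr h \<Longrightarrow> stgt h = [] \<Longrightarrow> drop_unit \<bullet>\<^sub>s insert_unit \<bullet>\<^sub>s h = h"
  "sarr h \<Longrightarrow> stgt h = [U] \<Longrightarrow> insert_unit \<bullet>\<^sub>s drop_unit \<bullet>\<^sub>s h = h"
  by (simp_all flip: strict.comp_assoc)

lemma embed_inject: "embed f = embed g \<Longrightarrow> arr f \<Longrightarrow> arr g \<Longrightarrow> f = g"
  by (auto simp: embed_def intro: tens_unit_faithful)

lemma embed_id: "embed (id A) = sid [A]" by (simp add: embed_def sid_def)
lemma embed_comp: "arr f \<Longrightarrow> arr g \<Longrightarrow> src f = tgt g \<Longrightarrow> embed (f \<bullet> g) = embed f \<bullet>\<^sub>s embed g"
  by (simp add: embed_def whisker)

lemma join_singleton: "join [A] Bs = ru A \<star> id (obj Bs)"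
  by (simp add: join_def triangle)
lemma unjoin_singleton: "unjoin [A] Bs = rui A \<star> id (obj Bs)"
proof (rule cancel_left[of "join [A] Bs"])
  show "join [A] Bs \<bullet> unjoin [A] Bs = join [A] Bs \<bullet> (rui A \<star> id (obj Bs))"
    unfolding join_unjoin by (simp add: join_singleton interchange ru_rui)
qed (use unjoin_join[of "[A]" Bs] in simp_all)

text \<open>
  Rebracketing after a one-element list is a right unitor, by the triangle; it cancels against that of \<open>embed f\<close>.
\<close>

lemma embed_stens:
  assumes "arr f" "arr h" "src h = obj Bs" "tgt h = obj Ds"
  shows "embed f \<star>\<^sub>s (Bs, Ds, h) = (src f # Bs, tgt f # Ds, f \<star> h)"
proof -
  have "ru (tgt f) \<bullet> (f \<star> id U) \<bullet> rui (src f) = f"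
    using ru_natural[OF assms(1)] assms by (simp add: ru_rui flip: comp_assoc) (simp add: ru_rui)
  then show ?thesis
    using assms by (simp add: embed_def join_singleton unjoin_singleton interchange)
qed

lemma embed_tens:
  assumes "arr f" "arr g"
  shows "embed (f \<star> g) = pack (tgt f) (tgt g) \<bullet>\<^sub>s (embed f \<star>\<^sub>s embed g) \<bullet>\<^sub>s unpack (src f) (src g)"
proof -
  have "embed f \<star>\<^sub>s embed g = ([src f, src g], [tgt f, tgt g], f \<star> (g \<star> id U))"
    using embed_stens[of f "g \<star> id U" "[src g]" "[tgt g]"] assms by (simp add: embed_def)
  then have "pack (tgt f) (tgt g) \<bullet>\<^sub>s (embed f \<star>\<^sub>s embed g) \<bullet>\<^sub>s unpack (src f) (src g)
    = ([src f \<diamondop> src g], [tgt f \<diamondop> tgt g], asci (tgt f) (tgt g) U \<bullet> (f \<star> (g \<star> id U)) \<bullet> asc (src f) (src g) U)"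
    by (simp add: pack_def unpack_def)
  also have "asci (tgt f) (tgt g) U \<bullet> (f \<star> (g \<star> id U)) \<bullet> asc (src f) (src g) U
    = asci (tgt f) (tgt g) U \<bullet> asc (tgt f) (tgt g) U \<bullet> ((f \<star> g) \<star> id U)"
    using asc_natural[of f g "id U"] assms by simp
  also have "\<dots> = (f \<star> g) \<star> id U" using assms by (simp add: cancel_head[OF asci_asc])
  finally show ?thesis by (simp add: embed_def)
qed

lemma unpack_stens: "unpack A B \<star>\<^sub>s sid [D] = ([A \<diamondop> B, D], [A, B, D], asc A B (D \<diamondop> U))"
proof -
  have j: "join [A, B] [D] = (id A \<star> (ru B \<star> id (D \<diamondop> U))) \<bullet> asc A (B \<diamondop> U) (D \<diamondop> U)"
    using join_singleton[of B "[D]"] by (simp add: join_def)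
  have "join [A, B] [D] \<bullet> (asc A B U \<star> id (D \<diamondop> U)) \<bullet> unjoin [A \<diamondop> B] [D]
     = ((id A \<star> (ru B \<star> id (D \<diamondop> U))) \<bullet> asc A (B \<diamondop> U) (D \<diamondop> U)) \<bullet> ((asc A B U \<bullet> rui (A \<diamondop> B)) \<star> id (D \<diamondop> U))"
    by (simp add: j unjoin_singleton whisker)
  also have "(id A \<star> (ru B \<star> id (D \<diamondop> U))) \<bullet> asc A (B \<diamondop> U) (D \<diamondop> U) = asc A B (D \<diamondop> U) \<bullet> ((id A \<star> ru B) \<star> id (D \<diamondop> U))"
    using asc_natural[of "id A" "ru B" "id (D \<diamondop> U)"] by simp
  also have "\<dots> \<bullet> ((asc A B U \<bullet> rui (A \<diamondop> B)) \<star> id (D \<diamondop> U))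
     = asc A B (D \<diamondop> U) \<bullet> ((((id A \<star> ru B) \<bullet> asc A B U) \<bullet> rui (A \<diamondop> B)) \<star> id (D \<diamondop> U))"
    by (simp add: whisker)
  also have "\<dots> = asc A B (D \<diamondop> U)" unfolding ru_tens by (simp add: ru_rui)
  finally show ?thesis by (simp add: unpack_def sid_def)
qed

lemma embed_asc: "embed (asc A B D) = pack A (B \<diamondop> D) \<bullet>\<^sub>s (sid [A] \<star>\<^sub>s pack B D) \<bullet>\<^sub>s (unpack A B \<star>\<^sub>s sid [D]) \<bullet>\<^sub>s unpack (A \<diamondop> B) D"
proof -
  have 1: "sid [A] \<star>\<^sub>s unpack B D = ([A, B \<diamondop> D], [A, B, D], id A \<star> asc B D U)"
    using embed_stens[of "id A" "asc B D U" "[B \<diamondop> D]" "[B, D]"] by (simp add: embed_id unpack_def)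
  have "(sid [A] \<star>\<^sub>s unpack B D) \<bullet>\<^sub>s unpack A (B \<diamondop> D) \<bullet>\<^sub>s embed (asc A B D) = (unpack A B \<star>\<^sub>s sid [D]) \<bullet>\<^sub>s unpack (A \<diamondop> B) D"
    unfolding 1 unpack_stens by (simp add: unpack_def embed_def pentagon)
  then have "pack A (B \<diamondop> D) \<bullet>\<^sub>s ((sid [A] \<star>\<^sub>s pack B D) \<bullet>\<^sub>s (sid [A] \<star>\<^sub>s unpack B D)) \<bullet>\<^sub>s unpack A (B \<diamondop> D) \<bullet>\<^sub>s embed (asc A B D)
     = pack A (B \<diamondop> D) \<bullet>\<^sub>s (sid [A] \<star>\<^sub>s pack B D) \<bullet>\<^sub>s (unpack A B \<star>\<^sub>s sid [D]) \<bullet>\<^sub>s unpack (A \<diamondop> B) D"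
    by simp
  also have "(sid [A] \<star>\<^sub>s pack B D) \<bullet>\<^sub>s (sid [A] \<star>\<^sub>s unpack B D) = sid [A, B \<diamondop> D]"
    by (simp add: strict.interchange)
  finally show ?thesis by simp
qed

lemma embed_asci: "embed (asci A B D) = pack (A \<diamondop> B) D \<bullet>\<^sub>s (pack A B \<star>\<^sub>s sid [D]) \<bullet>\<^sub>s (sid [A] \<star>\<^sub>s unpack B D) \<bullet>\<^sub>s unpack A (B \<diamondop> D)"
   (is "_ = ?r")
proof -
  have "?r \<bullet>\<^sub>s embed (asc A B D) = pack (A \<diamondop> B) D \<bullet>\<^sub>s (pack A B \<star>\<^sub>s sid [D]) \<bullet>\<^sub>s
     ((sid [A] \<star>\<^sub>s unpack B D) \<bullet>\<^sub>s (sid [A] \<star>\<^sub>s pack B D)) \<bullet>\<^sub>s (unpack A B \<star>\<^sub>s sid [D]) \<bullet>\<^sub>s unpack (A \<diamondop> B) D"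
    by (simp add: embed_asc)
  also have "(sid [A] \<star>\<^sub>s unpack B D) \<bullet>\<^sub>s (sid [A] \<star>\<^sub>s pack B D) = sid [A, B, D]"
    by (simp add: strict.interchange)
  also have "pack (A \<diamondop> B) D \<bullet>\<^sub>s (pack A B \<star>\<^sub>s sid [D]) \<bullet>\<^sub>s sid [A, B, D] \<bullet>\<^sub>s (unpack A B \<star>\<^sub>s sid [D]) \<bullet>\<^sub>s unpack (A \<diamondop> B) D
     = pack (A \<diamondop> B) D \<bullet>\<^sub>s ((pack A B \<star>\<^sub>s sid [D]) \<bullet>\<^sub>s (unpack A B \<star>\<^sub>s sid [D])) \<bullet>\<^sub>s unpack (A \<diamondop> B) D"
    by simp
  also have "(pack A B \<star>\<^sub>s sid [D]) \<bullet>\<^sub>s (unpack A B \<star>\<^sub>s sid [D]) = sid [A \<diamondop> B, D]"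
    by (simp add: strict.interchange)
  also have "pack (A \<diamondop> B) D \<bullet>\<^sub>s \<dots> \<bullet>\<^sub>s unpack (A \<diamondop> B) D = sid [(A \<diamondop> B) \<diamondop> D]" by simp
  finally have "(?r \<bullet>\<^sub>s embed (asc A B D)) \<bullet>\<^sub>s embed (asci A B D) = sid [(A \<diamondop> B) \<diamondop> D] \<bullet>\<^sub>s embed (asci A B D)" by simp
  moreover have "embed (asc A B D) \<bullet>\<^sub>s embed (asci A B D) = sid [A \<diamondop> (B \<diamondop> D)]"
    by (simp add: asc_asci embed_id flip: embed_comp)
  ultimately show ?thesis by simp
qed

lemma embed_lu: "embed (lu A) = (drop_unit \<star>\<^sub>s sid [A]) \<bullet>\<^sub>s unpack U A"
proof -
  have "lu (A \<diamondop> U) \<bullet> (ru U \<star> id (A \<diamondop> U)) \<bullet> (rui U \<star> id (A \<diamondop> U)) \<bullet> asc U A U = lu A \<star> id U"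
    using cancel_head[of "ru U \<star> id (A \<diamondop> U)" "rui U \<star> id (A \<diamondop> U)" "U \<diamondop> (A \<diamondop> U)" "asc U A U"]
    by (simp add: lu_tens interchange ru_rui)
  then show ?thesis
    by (simp add: embed_def drop_unit_def sid_def unpack_def join_Nil_left unjoin_singleton)
qed

lemma embed_lui: "embed (lui A) = pack U A \<bullet>\<^sub>s (insert_unit \<star>\<^sub>s sid [A])"
proof -
  have "embed (lui A) \<bullet>\<^sub>s embed (lu A) \<bullet>\<^sub>s pack U A \<bullet>\<^sub>s (insert_unit \<star>\<^sub>s sid [A]) = pack U A \<bullet>\<^sub>s (insert_unit \<star>\<^sub>s sid [A])"
    by (simp add: lui_lu embed_id flip: embed_comp strict.comp_assoc)
  then show ?thesis by (simp add: embed_lu strict.interchange)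
qed

lemma embed_ru: "embed (ru A) = (sid [A] \<star>\<^sub>s drop_unit) \<bullet>\<^sub>s unpack A U"
proof -
  have "sid [A] \<star>\<^sub>s drop_unit = ([A, U], [A], id A \<star> ru U)"
    using embed_stens[of "id A" "ru U" "[U]" "[]"] by (simp add: embed_id drop_unit_def)
  then show ?thesis by (simp add: embed_def unpack_def ru_tens ru_tens_unit)
qed

lemma embed_rui: "embed (rui A) = pack A U \<bullet>\<^sub>s (sid [A] \<star>\<^sub>s insert_unit)"
proof -
  have "embed (rui A) \<bullet>\<^sub>s embed (ru A) \<bullet>\<^sub>s pack A U \<bullet>\<^sub>s (sid [A] \<star>\<^sub>s insert_unit) = pack A U \<bullet>\<^sub>s (sid [A] \<star>\<^sub>s insert_unit)"
    by (simp add: rui_ru embed_id flip: embed_comp strict.comp_assoc)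
  then show ?thesis by (simp add: embed_ru strict.interchange)
qed

lemma embed_tw: "embed (tw A) = stw [A]"
proof -
  have "ru A \<bullet> tw (A \<diamondop> U) = ru A \<bullet> (tw A \<star> id U)"
    using tw_natural[of "ru A"] ru_natural[of "tw A"] by simp
  then have "tw (A \<diamondop> U) = tw A \<star> id U"
    by (rule cancel_left) (rule rui_ru, simp_all)
  then show ?thesis by (simp add: embed_def stw_def)
qed

lemma embed_twi: "embed (twi A) = stwi [A]"
proof -
  have "stwi [A] \<bullet>\<^sub>s (embed (tw A) \<bullet>\<^sub>s embed (twi A)) = stwi [A]"
    by (simp add: tw_twi embed_id flip: embed_comp)
  moreover have "stwi [A] \<bullet>\<^sub>s (embed (tw A) \<bullet>\<^sub>s embed (twi A)) = embed (twi A)"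
    by (simp add: embed_tw strict.twi_tw flip: strict.comp_assoc)
  ultimately show ?thesis by simp
qed

lemma sbr_unpack: "sbr [A] [B] \<bullet>\<^sub>s unpack A B = unpack B A \<bullet>\<^sub>s embed (br A B)"
proof -
  have 1: "(ru B \<star> id (A \<diamondop> U)) \<bullet> br (A \<diamondop> U) (B \<diamondop> U) = br (A \<diamondop> U) B \<bullet> (id (A \<diamondop> U) \<star> ru B)"
    using br_natural[of "id (A \<diamondop> U)" "ru B"] by simp
  have 2: "br (A \<diamondop> U) B \<bullet> (rui A \<star> id B) = (id B \<star> rui A) \<bullet> br A B"
    using br_natural[of "rui A" "id B"] by simp
  have 3: "(id (A \<diamondop> U) \<star> ru B) \<bullet> (rui A \<star> id (B \<diamondop> U)) = (rui A \<star> id B) \<bullet> (id A \<star> ru B)"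
    by (simp add: interchange)
  have 4: "br A B \<bullet> ru (A \<diamondop> B) = ru (B \<diamondop> A) \<bullet> (br A B \<star> id U)"
    using ru_natural[of "br A B"] by simp
  have "join [B] [A] \<bullet> br (A \<diamondop> U) (B \<diamondop> U) \<bullet> unjoin [A] [B] \<bullet> asc A B U
     = ((ru B \<star> id (A \<diamondop> U)) \<bullet> br (A \<diamondop> U) (B \<diamondop> U)) \<bullet> (rui A \<star> id (B \<diamondop> U)) \<bullet> asc A B U"
    by (simp add: join_singleton unjoin_singleton)
  also have "\<dots> = br (A \<diamondop> U) B \<bullet> ((id (A \<diamondop> U) \<star> ru B) \<bullet> (rui A \<star> id (B \<diamondop> U))) \<bullet> asc A B U"
    unfolding 1 by simp
  also have "\<dots> = (br (A \<diamondop> U) B \<bullet> (rui A \<star> id B)) \<bullet> ((id A \<star> ru B) \<bullet> asc A B U)"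
    unfolding 3 by simp
  also have "\<dots> = (id B \<star> rui A) \<bullet> (br A B \<bullet> ru (A \<diamondop> B))"
    unfolding 2 ru_tens by simp
  also have "\<dots> = (id B \<star> rui A) \<bullet> ((id B \<star> ru A) \<bullet> asc B A U) \<bullet> (br A B \<star> id U)"
    unfolding 4 ru_tens by simp
  also have "\<dots> = (id B \<star> (rui A \<bullet> ru A)) \<bullet> asc B A U \<bullet> (br A B \<star> id U)"
    by (simp add: whisker)
  also have "\<dots> = asc B A U \<bullet> (br A B \<star> id U)" by (simp add: rui_ru)
  finally show ?thesis by (simp add: sbr_def unpack_def embed_def)
qed

lemma embed_br: "embed (br A B) = pack B A \<bullet>\<^sub>s sbr [A] [B] \<bullet>\<^sub>s unpack A B"
  by (simp add: sbr_unpack)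

lemma embed_bri: "embed (bri A B) = pack A B \<bullet>\<^sub>s sbri [A] [B] \<bullet>\<^sub>s unpack B A"
proof -
  have "(pack A B \<bullet>\<^sub>s sbri [A] [B] \<bullet>\<^sub>s unpack B A) \<bullet>\<^sub>s (embed (br A B) \<bullet>\<^sub>s embed (bri A B)) = pack A B \<bullet>\<^sub>s sbri [A] [B] \<bullet>\<^sub>s unpack B A"
    by (simp add: br_bri embed_id flip: embed_comp)
  moreover have "(pack A B \<bullet>\<^sub>s sbri [A] [B] \<bullet>\<^sub>s unpack B A) \<bullet>\<^sub>s (embed (br A B) \<bullet>\<^sub>s embed (bri A B))
     = pack A B \<bullet>\<^sub>s (sbri [A] [B] \<bullet>\<^sub>s sbr [A] [B]) \<bullet>\<^sub>s unpack A B \<bullet>\<^sub>s embed (bri A B)"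
    by (simp add: embed_br)
  ultimately show ?thesis by (simp add: strict.bri_br)
qed

text \<open>
  The coherence isomorphisms around a bent morphism are absorbed into the strict form of the cap and
  that of the morphism, so that only a strict diagram remains.
\<close>

lemma embed_cap_left:
  assumes "arr f" "src f = X \<diamondop> X'" "tgt f = U" "arr b" "src b = S" "tgt b = X' \<diamondop> T"
  shows "embed (lu T \<bullet> (f \<star> id T) \<bullet> asci X X' T \<bullet> (id X \<star> b))
    = ((drop_unit \<bullet>\<^sub>s embed f \<bullet>\<^sub>s pack X X') \<star>\<^sub>s sid [T]) \<bullet>\<^sub>s (sid [X] \<star>\<^sub>s (unpack X' T \<bullet>\<^sub>s embed b)) \<bullet>\<^sub>s unpack X S"
  using assms by (simp add: embed_comp embed_tens embed_lu embed_asci embed_id strict.whisker)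

lemma embed_cup_left:
  assumes "arr k" "src k = U" "tgt k = X \<diamondop> X'" "arr g" "src g = X' \<diamondop> T" "tgt g = S"
  shows "embed ((id X \<star> g) \<bullet> asc X X' T \<bullet> (k \<star> id T) \<bullet> lui T)
    = pack X S \<bullet>\<^sub>s (sid [X] \<star>\<^sub>s (embed g \<bullet>\<^sub>s pack X' T)) \<bullet>\<^sub>s ((unpack X X' \<bullet>\<^sub>s embed k \<bullet>\<^sub>s insert_unit) \<star>\<^sub>s sid [T])"
  using assms by (simp add: embed_comp embed_tens embed_lui embed_asc embed_id strict.whisker)

lemma embed_cap_right:
  assumes "arr f" "src f = X' \<diamondop> X" "tgt f = U" "arr b" "src b = S" "tgt b = T \<diamondop> X'"
  shows "embed (ru T \<bullet> (id T \<star> f) \<bullet> asc T X' X \<bullet> (b \<star> id X))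
    = (sid [T] \<star>\<^sub>s (drop_unit \<bullet>\<^sub>s embed f \<bullet>\<^sub>s pack X' X)) \<bullet>\<^sub>s ((unpack T X' \<bullet>\<^sub>s embed b) \<star>\<^sub>s sid [X]) \<bullet>\<^sub>s unpack S X"
  using assms by (simp add: embed_comp embed_tens embed_ru embed_asc embed_id strict.whisker)

lemma embed_cup_right:
  assumes "arr k" "src k = U" "tgt k = X' \<diamondop> X" "arr g" "src g = T \<diamondop> X'" "tgt g = S"
  shows "embed ((g \<star> id X) \<bullet> asci T X' X \<bullet> (id T \<star> k) \<bullet> rui T)
    = pack S X \<bullet>\<^sub>s ((embed g \<bullet>\<^sub>s pack T X') \<star>\<^sub>s sid [X]) \<bullet>\<^sub>s (sid [T] \<star>\<^sub>s (unpack X' X \<bullet>\<^sub>s embed k \<bullet>\<^sub>s insert_unit))"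
  using assms by (simp add: embed_comp embed_tens embed_rui embed_asci embed_id strict.whisker)


subsection \<open>Duals and traces under the embedding\<close>

definition dual_data :: "'o \<Rightarrow> 'o \<Rightarrow> 'x \<Rightarrow> 'x \<Rightarrow> bool" where
  "dual_data X X' e k \<longleftrightarrow> arr e \<and> src e = X' \<diamondop> X \<and> tgt e = U \<and> arr k \<and> src k = U \<and> tgt k = X \<diamondop> X' \<and>
     ru X \<bullet> (id X \<star> e) \<bullet> asc X X' X \<bullet> (k \<star> id X) \<bullet> lui X = id X \<and>
     lu X' \<bullet> (e \<star> id X') \<bullet> asci X' X X' \<bullet> (id X' \<star> k) \<bullet> rui X' = id X'"

definition strict_ev where "strict_ev X X' e = drop_unit \<bullet>\<^sub>s embed e \<bullet>\<^sub>s pack X' X"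
definition strict_coev where "strict_coev X X' k = unpack X X' \<bullet>\<^sub>s embed k \<bullet>\<^sub>s insert_unit"

lemma dual_dataD:
  assumes "dual_data X X' e k"
  shows "arr e" "src e = X' \<diamondop> X" "tgt e = U" "arr k" "src k = U" "tgt k = X \<diamondop> X'"
    and "ru X \<bullet> (id X \<star> e) \<bullet> asc X X' X \<bullet> (k \<star> id X) \<bullet> lui X = id X"
    "lu X' \<bullet> (e \<star> id X') \<bullet> asci X' X X' \<bullet> (id X' \<star> k) \<bullet> rui X' = id X'"
  using assms by (auto simp: dual_data_def)

lemma strict_dual_pair:
  assumes "dual_data X X' e k"
  shows "strict.dual_pair [X] [X'] (strict_ev X X' e) (strict_coev X X' k)"
proof -
  note [simp] = dual_dataD(1-6)[OF assms]
  have "embed (ru X \<bullet> (id X \<star> e) \<bullet> asc X X' X \<bullet> (k \<star> id X) \<bullet> lui X)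
    = embed ((ru X \<bullet> (id X \<star> e) \<bullet> asc X X' X \<bullet> (k \<star> id X)) \<bullet> lui X)" by simp
  also have "\<dots> = embed (ru X \<bullet> (id X \<star> e) \<bullet> asc X X' X \<bullet> (k \<star> id X)) \<bullet>\<^sub>s embed (lui X)"
    by (rule embed_comp) simp_all
  also have "\<dots> = (sid [X] \<star>\<^sub>s strict_ev X X' e) \<bullet>\<^sub>s (strict_coev X X' k \<star>\<^sub>s sid [X])"
    by (subst embed_cap_right[where S = U]) (simp_all add: embed_lui strict_ev_def strict_coev_def strict.whisker)
  finally have 1: "(sid [X] \<star>\<^sub>s strict_ev X X' e) \<bullet>\<^sub>s (strict_coev X X' k \<star>\<^sub>s sid [X]) = sid [X]"
    by (simp only: dual_dataD(7)[OF assms] embed_id)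
  have "embed (lu X' \<bullet> (e \<star> id X') \<bullet> asci X' X X' \<bullet> (id X' \<star> k) \<bullet> rui X')
    = embed ((lu X' \<bullet> (e \<star> id X') \<bullet> asci X' X X' \<bullet> (id X' \<star> k)) \<bullet> rui X')" by simp
  also have "\<dots> = embed (lu X' \<bullet> (e \<star> id X') \<bullet> asci X' X X' \<bullet> (id X' \<star> k)) \<bullet>\<^sub>s embed (rui X')"
    by (rule embed_comp) simp_all
  also have "\<dots> = (strict_ev X X' e \<star>\<^sub>s sid [X']) \<bullet>\<^sub>s (sid [X'] \<star>\<^sub>s strict_coev X X' k)"
    by (subst embed_cap_left[where S = U]) (simp_all add: embed_rui strict_ev_def strict_coev_def strict.whisker)
  finally have 2: "(strict_ev X X' e \<star>\<^sub>s sid [X']) \<bullet>\<^sub>s (sid [X'] \<star>\<^sub>s strict_coev X X' k) = sid [X']"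
    by (simp only: dual_dataD(8)[OF assms] embed_id)
  show ?thesis using 1 2 by (simp add: strict.dual_pair_def) (simp add: strict_ev_def strict_coev_def)
qed

definition right_ev where "right_ev X X' e = e \<bullet> br X X' \<bullet> (tw X \<star> id X')"
definition right_coev where "right_coev X X' k = (id X' \<star> twi X) \<bullet> bri X' X \<bullet> k"

lemma right_ev_typing [simp]: "arr e \<Longrightarrow> arr (right_ev X X' e)" "src (right_ev X X' e) = X \<diamondop> X'" "tgt (right_ev X X' e) = tgt e"
  by (simp_all add: right_ev_def)
lemma right_coev_typing [simp]: "arr k \<Longrightarrow> arr (right_coev X X' k)" "src (right_coev X X' k) = src k" "tgt (right_coev X X' k) = X' \<diamondop> X"
  by (simp_all add: right_coev_def)

lemma embed_tev:
  assumes "dual_data X X' e k"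
  shows "drop_unit \<bullet>\<^sub>s embed (right_ev X X' e) \<bullet>\<^sub>s pack X X' = strict.right_ev [X] [X'] (strict_ev X X' e)"
  using dual_dataD(1-6)[OF assms]
  by (simp add: right_ev_def embed_comp embed_tens embed_br embed_tw embed_id strict.right_ev_def strict_ev_def)

lemma embed_trace:
  assumes "dual_data X X' e k" "arr f" "src f = X" "tgt f = X"
  shows "drop_unit \<bullet>\<^sub>s embed (right_ev X X' e \<bullet> (f \<star> id X') \<bullet> k) \<bullet>\<^sub>s insert_unit = strict.tr [X] [X'] (strict_ev X X' e) (strict_coev X X' k) (embed f)"
  using dual_dataD(1-6)[OF assms(1)] assms(2-)
  by (subst strict.tr_via_right_ev[OF strict_dual_pair[OF assms(1)]])
    (simp_all add: embed_comp embed_tens embed_id strict_coev_def flip: embed_tev[OF assms(1)])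

text \<open>
  The last condition says that the twist of \<open>X'\<close> is the dual morphism of the twist of \<open>X\<close>.
\<close>

definition ribbon_data :: "'o \<Rightarrow> 'o \<Rightarrow> 'x \<Rightarrow> 'x \<Rightarrow> bool" where
  "ribbon_data X X' e k \<longleftrightarrow> dual_data X X' e k \<and>
     tw X' = lu X' \<bullet> (e \<star> id X') \<bullet> asci X' X X' \<bullet> (id X' \<star> (tw X \<star> id X')) \<bullet> (id X' \<star> k) \<bullet> rui X'"

text \<open>
  Strictly, the twist of \<open>X'\<close> is the transpose of the twist of \<open>X\<close>, and transposes slide around cups.
\<close>

lemma strict_balanced:
  assumes "ribbon_data X X' e k"
  shows "strict.balanced [X] [X'] (strict_coev X X' k)"
proof -
  have d: "dual_data X X' e k" using assms by (simp add: ribbon_data_def)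
  note [simp] = dual_dataD(1-6)[OF d]
  note p = strict_dual_pair[OF d]
  have "tw X' = (lu X' \<bullet> (e \<star> id X') \<bullet> asci X' X X' \<bullet> (id X' \<star> ((tw X \<star> id X') \<bullet> k))) \<bullet> rui X'"
    using assms by (simp add: ribbon_data_def whisker)
  then have "stw [X'] = embed ((lu X' \<bullet> (e \<star> id X') \<bullet> asci X' X X' \<bullet> (id X' \<star> ((tw X \<star> id X') \<bullet> k))) \<bullet> rui X')"
    by (simp only: embed_tw[symmetric])
  also have "\<dots> = embed (lu X' \<bullet> (e \<star> id X') \<bullet> asci X' X X' \<bullet> (id X' \<star> ((tw X \<star> id X') \<bullet> k))) \<bullet>\<^sub>s embed (rui X')"
    by (rule embed_comp) simp_all
  also have "\<dots> = strict.transpose (strict_ev X X' e) [X'] (strict_coev X X' k) [X'] (stw [X])"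
    by (subst embed_cap_left[where S = U])
      (simp_all add: embed_comp embed_tens embed_id embed_tw embed_rui strict_ev_def strict_coev_def strict.transpose_def strict.whisker)
  finally show ?thesis
    using strict.coev_transpose[OF p p, of "stw [X]"] by (simp add: strict.balanced_def)
qed

lemma embed_tcoev:
  assumes "ribbon_data X X' e k"
  shows "unpack X' X \<bullet>\<^sub>s embed (right_coev X X' k) \<bullet>\<^sub>s insert_unit = strict.right_coev [X] [X'] (strict_coev X X' k)"
proof -
  have d: "dual_data X X' e k" using assms by (simp add: ribbon_data_def)
  note [simp] = dual_dataD(1-6)[OF d]
  show ?thesis
    by (subst strict.right_coev_eq[OF strict_dual_pair[OF d] strict_balanced[OF assms]])
      (simp add: right_coev_def embed_comp embed_tens embed_bri embed_twi embed_id strict_coev_def)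
qed

lemma unit_endo_eqI:
  assumes "drop_unit \<bullet>\<^sub>s embed f \<bullet>\<^sub>s insert_unit = drop_unit \<bullet>\<^sub>s embed g \<bullet>\<^sub>s insert_unit"
    and "arr f" "src f = U" "tgt f = U" "arr g" "src g = U" "tgt g = U"
  shows "f = g"
proof -
  have "insert_unit \<bullet>\<^sub>s (drop_unit \<bullet>\<^sub>s embed f \<bullet>\<^sub>s insert_unit) \<bullet>\<^sub>s drop_unit = insert_unit \<bullet>\<^sub>s (drop_unit \<bullet>\<^sub>s embed g \<bullet>\<^sub>s insert_unit) \<bullet>\<^sub>s drop_unit"
    by (simp only: assms(1))
  then have "embed f = embed g" using assms(2-) by simp
  then show ?thesis using assms by (simp add: embed_inject)
qed

text \<open>
  Both sides are endomorphisms of the unit whose images in the strictification are traces there.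
\<close>

theorem trace_rotate_left:
  assumes S: "dual_data S S' eS kS" and T: "dual_data T T' eT kT" and X: "ribbon_data X X' eX kX"
    and b: "arr b" "src b = S" "tgt b = X' \<diamondop> T" and g: "arr g" "src g = X' \<diamondop> T" "tgt g = S"
  shows "right_ev T T' eT \<bullet> (((lu T \<bullet> (right_ev X X' eX \<star> id T) \<bullet> asci X X' T \<bullet> (id X \<star> b)) \<bullet>
      ((id X \<star> g) \<bullet> asc X X' T \<bullet> (kX \<star> id T) \<bullet> lui T)) \<star> id T') \<bullet> kT
    = right_ev S S' eS \<bullet> ((g \<bullet> b) \<star> id S') \<bullet> kS"
proof -
  have d: "dual_data X X' eX kX" using X by (simp add: ribbon_data_def)
  note [simp] = dual_dataD(1-6)[OF d] dual_dataD(1-6)[OF S] dual_dataD(1-6)[OF T] b g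
  let ?u = "lu T \<bullet> (right_ev X X' eX \<star> id T) \<bullet> asci X X' T \<bullet> (id X \<star> b)"
  let ?v = "(id X \<star> g) \<bullet> asc X X' T \<bullet> (kX \<star> id T) \<bullet> lui T"
  let ?b = "unpack X' T \<bullet>\<^sub>s embed b" and ?g = "embed g \<bullet>\<^sub>s pack X' T"
  have "embed (?u \<bullet> ?v) = embed ?u \<bullet>\<^sub>s embed ?v" by (rule embed_comp) simp_all
  also have "embed ?u = (strict.right_ev [X] [X'] (strict_ev X X' eX) \<star>\<^sub>s sid [T]) \<bullet>\<^sub>s (sid [X] \<star>\<^sub>s ?b) \<bullet>\<^sub>s unpack X S"
    by (subst embed_cap_left) (simp_all add: embed_tev[OF d])
  also have "embed ?v = pack X S \<bullet>\<^sub>s (sid [X] \<star>\<^sub>s ?g) \<bullet>\<^sub>s (strict_coev X X' kX \<star>\<^sub>s sid [T])"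
    by (subst embed_cup_left) (simp_all add: strict_coev_def)
  finally have uv: "embed (?u \<bullet> ?v) = (strict.right_ev [X] [X'] (strict_ev X X' eX) \<star>\<^sub>s sid [T]) \<bullet>\<^sub>s (sid [X] \<star>\<^sub>s ?b) \<bullet>\<^sub>s
     (sid [X] \<star>\<^sub>s ?g) \<bullet>\<^sub>s (strict_coev X X' kX \<star>\<^sub>s sid [T])"
    by (simp add: strict_coev_def)
  have gb: "embed (g \<bullet> b) = ?g \<bullet>\<^sub>s ?b" by (simp add: embed_comp)
  have "drop_unit \<bullet>\<^sub>s embed (right_ev T T' eT \<bullet> ((?u \<bullet> ?v) \<star> id T') \<bullet> kT) \<bullet>\<^sub>s insert_unit
    = strict.tr [T] [T'] (strict_ev T T' eT) (strict_coev T T' kT) (embed (?u \<bullet> ?v))"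
    by (rule embed_trace[OF T]) simp_all
  also have "\<dots> = strict.tr [S] [S'] (strict_ev S S' eS) (strict_coev S S' kS) (embed (g \<bullet> b))"
    unfolding uv gb
    by (rule strict.trace_rotate_left[OF strict_dual_pair[OF S] strict_dual_pair[OF T] strict_dual_pair[OF d] strict_balanced[OF X]])
      simp_all
  also have "\<dots> = drop_unit \<bullet>\<^sub>s embed (right_ev S S' eS \<bullet> ((g \<bullet> b) \<star> id S') \<bullet> kS) \<bullet>\<^sub>s insert_unit"
    by (rule embed_trace[OF S, symmetric]) simp_all
  finally show ?thesis by (rule unit_endo_eqI) simp_all
qed

theorem trace_rotate_right:
  assumes S: "dual_data S S' eS kS" and T: "dual_data T T' eT kT" and X: "ribbon_data X X' eX kX"
    and b: "arr b" "src b = S" "tgt b = T \<diamondop> X'" and g: "arr g" "src g = T \<diamondop> X'" "tgt g = S"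
  shows "right_ev T T' eT \<bullet> (((ru T \<bullet> (id T \<star> eX) \<bullet> asc T X' X \<bullet> (b \<star> id X)) \<bullet>
      ((g \<star> id X) \<bullet> asci T X' X \<bullet> (id T \<star> right_coev X X' kX) \<bullet> rui T)) \<star> id T') \<bullet> kT
    = right_ev S S' eS \<bullet> ((g \<bullet> b) \<star> id S') \<bullet> kS"
proof -
  have d: "dual_data X X' eX kX" using X by (simp add: ribbon_data_def)
  note [simp] = dual_dataD(1-6)[OF d] dual_dataD(1-6)[OF S] dual_dataD(1-6)[OF T] b g
  let ?u = "ru T \<bullet> (id T \<star> eX) \<bullet> asc T X' X \<bullet> (b \<star> id X)"
  let ?v = "(g \<star> id X) \<bullet> asci T X' X \<bullet> (id T \<star> right_coev X X' kX) \<bullet> rui T"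
  let ?b = "unpack T X' \<bullet>\<^sub>s embed b" and ?g = "embed g \<bullet>\<^sub>s pack T X'"
  have "embed (?u \<bullet> ?v) = embed ?u \<bullet>\<^sub>s embed ?v" by (rule embed_comp) simp_all
  also have "embed ?u = (sid [T] \<star>\<^sub>s strict_ev X X' eX) \<bullet>\<^sub>s (?b \<star>\<^sub>s sid [X]) \<bullet>\<^sub>s unpack S X"
    by (subst embed_cap_right[where S = S]) (simp_all add: strict_ev_def)
  also have "embed ?v = pack S X \<bullet>\<^sub>s (?g \<star>\<^sub>s sid [X]) \<bullet>\<^sub>s (sid [T] \<star>\<^sub>s strict.right_coev [X] [X'] (strict_coev X X' kX))"
    by (subst embed_cup_right[where S = S]) (simp_all add: embed_tcoev[OF X])
  finally have uv: "embed (?u \<bullet> ?v) = (sid [T] \<star>\<^sub>s strict_ev X X' eX) \<bullet>\<^sub>s (?b \<star>\<^sub>s sid [X]) \<bullet>\<^sub>s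
     (?g \<star>\<^sub>s sid [X]) \<bullet>\<^sub>s (sid [T] \<star>\<^sub>s strict.right_coev [X] [X'] (strict_coev X X' kX))"
    by (simp add: strict_coev_def)
  have gb: "embed (g \<bullet> b) = ?g \<bullet>\<^sub>s ?b" by (simp add: embed_comp)
  have "drop_unit \<bullet>\<^sub>s embed (right_ev T T' eT \<bullet> ((?u \<bullet> ?v) \<star> id T') \<bullet> kT) \<bullet>\<^sub>s insert_unit
    = strict.tr [T] [T'] (strict_ev T T' eT) (strict_coev T T' kT) (embed (?u \<bullet> ?v))"
    by (rule embed_trace[OF T]) simp_all
  also have "\<dots> = strict.tr [S] [S'] (strict_ev S S' eS) (strict_coev S S' kS) (embed (g \<bullet> b))"
    unfolding uv gb
    by (rule strict.trace_rotate_right[OF strict_dual_pair[OF S] strict_dual_pair[OF T] strict_dual_pair[OF d] strict_balanced[OF X]])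
      simp_all
  also have "\<dots> = drop_unit \<bullet>\<^sub>s embed (right_ev S S' eS \<bullet> ((g \<bullet> b) \<star> id S') \<bullet> kS) \<bullet>\<^sub>s insert_unit"
    by (rule embed_trace[OF S, symmetric]) simp_all
  finally show ?thesis by (rule unit_endo_eqI) simp_all
qed

text \<open>
  Bending \<open>X\<close> down and up again is the identity, by the zigzag; hence every \<open>q\<close> is a bent morphism.
\<close>

lemma cup_left_cap:
  assumes X: "dual_data X X' e k" and q: "arr q" "src q = T" "tgt q = X \<diamondop> S"
  shows "(id X \<star> (lu S \<bullet> (e \<star> id S) \<bullet> asci X' X S \<bullet> (id X' \<star> q))) \<bullet> asc X X' T \<bullet> (k \<star> id T) \<bullet> lui T = q"
   (is "?l = _")
proof -
  note [simp] = dual_dataD(1-6)[OF X] q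
  let ?g = "lu S \<bullet> (e \<star> id S) \<bullet> asci X' X S \<bullet> (id X' \<star> q)" and ?q = "unpack X S \<bullet>\<^sub>s embed q"
  let ?e = "strict_ev X X' e" and ?k = "strict_coev X X' k"
  note p = strict_dual_pair[OF X]
  note [simp] = strict.dual_pairD(1-6)[OF p]
  have g: "embed ?g \<bullet>\<^sub>s pack X' T = (?e \<star>\<^sub>s sid [S]) \<bullet>\<^sub>s (sid [X'] \<star>\<^sub>s ?q)"
    by (subst embed_cap_left[where S = T]) (simp_all add: strict_ev_def)
  have "embed ?l = pack X S \<bullet>\<^sub>s (sid [X] \<star>\<^sub>s (embed ?g \<bullet>\<^sub>s pack X' T)) \<bullet>\<^sub>s (?k \<star>\<^sub>s sid [T])"
    by (subst embed_cup_left[where S = S]) (simp_all add: strict_coev_def)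
  also have "\<dots> = pack X S \<bullet>\<^sub>s (sid [X] \<star>\<^sub>s ?e \<star>\<^sub>s sid [S]) \<bullet>\<^sub>s ((sid [X, X'] \<star>\<^sub>s ?q) \<bullet>\<^sub>s (?k \<star>\<^sub>s sid [T]))"
    unfolding g by (simp add: strict.whisker)
  also have "(sid [X, X'] \<star>\<^sub>s ?q) \<bullet>\<^sub>s (?k \<star>\<^sub>s sid [T]) = (?k \<star>\<^sub>s sid [X, S]) \<bullet>\<^sub>s ?q"
    using strict.exchange[of ?k ?q "[X, S]" "[]" "[T]" "[X, X']"] by simp
  also have "pack X S \<bullet>\<^sub>s (sid [X] \<star>\<^sub>s ?e \<star>\<^sub>s sid [S]) \<bullet>\<^sub>s \<dots>
     = pack X S \<bullet>\<^sub>s (((sid [X] \<star>\<^sub>s ?e) \<bullet>\<^sub>s (?k \<star>\<^sub>s sid [X])) \<star>\<^sub>s sid [S]) \<bullet>\<^sub>s ?q"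
    by (simp add: strict.whisker)
  also have "\<dots> = embed q" unfolding strict.dual_pairD(7)[OF p] by simp
  finally show ?thesis by (rule embed_inject) simp_all
qed

text \<open>
  Here \<open>X\<close> is bent on the other side, so the zigzag needed is the one for the right duality morphisms.
\<close>

lemma cup_right_cap:
  assumes X: "ribbon_data X X' e k" and q: "arr q" "src q = T" "tgt q = S \<diamondop> X"
  shows "((ru S \<bullet> (id S \<star> right_ev X X' e) \<bullet> asc S X X' \<bullet> (q \<star> id X')) \<star> id X)
     \<bullet> asci T X' X \<bullet> (id T \<star> right_coev X X' k) \<bullet> rui T = q"
   (is "?l = _")
proof -
  have d: "dual_data X X' e k" using X by (simp add: ribbon_data_def)
  note [simp] = dual_dataD(1-6)[OF d] q
  let ?g = "ru S \<bullet> (id S \<star> right_ev X X' e) \<bullet> asc S X X' \<bullet> (q \<star> id X')" and ?q = "unpack S X \<bullet>\<^sub>s embed q"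
  let ?e = "strict.right_ev [X] [X'] (strict_ev X X' e)" and ?k = "strict.right_coev [X] [X'] (strict_coev X X' k)"
  note p = strict_dual_pair[OF d]
  note [simp] = strict.dual_pairD(1-6)[OF p]
  have g: "embed ?g \<bullet>\<^sub>s pack T X' = (sid [S] \<star>\<^sub>s ?e) \<bullet>\<^sub>s (?q \<star>\<^sub>s sid [X'])"
    by (subst embed_cap_right[where S = T]) (simp_all add: embed_tev[OF d])
  have "embed ?l = pack S X \<bullet>\<^sub>s ((embed ?g \<bullet>\<^sub>s pack T X') \<star>\<^sub>s sid [X]) \<bullet>\<^sub>s (sid [T] \<star>\<^sub>s ?k)"
    by (subst embed_cup_right[where S = S]) (simp_all add: embed_tcoev[OF X])
  also have "\<dots> = pack S X \<bullet>\<^sub>s (sid [S] \<star>\<^sub>s ?e \<star>\<^sub>s sid [X]) \<bullet>\<^sub>s ((?q \<star>\<^sub>s sid [X', X]) \<bullet>\<^sub>s (sid [T] \<star>\<^sub>s ?k))"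
    unfolding g by (simp add: strict.whisker)
  also have "(?q \<star>\<^sub>s sid [X', X]) \<bullet>\<^sub>s (sid [T] \<star>\<^sub>s ?k) = (sid [S, X] \<star>\<^sub>s ?k) \<bullet>\<^sub>s ?q"
    using strict.exchange[of ?q ?k "[X', X]" "[T]" "[]" "[S, X]"] by simp
  also have "pack S X \<bullet>\<^sub>s (sid [S] \<star>\<^sub>s ?e \<star>\<^sub>s sid [X]) \<bullet>\<^sub>s \<dots>
     = pack S X \<bullet>\<^sub>s (sid [S] \<star>\<^sub>s ((?e \<star>\<^sub>s sid [X]) \<bullet>\<^sub>s (sid [X] \<star>\<^sub>s ?k))) \<bullet>\<^sub>s ?q"
    by (simp add: strict.whisker)
  also have "\<dots> = embed q" unfolding strict.right_zigzag[OF p strict_balanced[OF X]] by simp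
  finally show ?thesis by (rule embed_inject) simp_all
qed

end

section \<open>Ribbon linear categories\<close>

text \<open>
  Hom spaces may overlap, so a morphism determines neither source nor target; an arrow is a morphism
  with both attached.
\<close>


definition arrow :: "'o \<Rightarrow> 'o \<Rightarrow> 'm \<Rightarrow> 'o \<times> 'o \<times> 'm" where "arrow X Y f = (X, Y, f)"
definition source :: "'o \<times> 'o \<times> 'm \<Rightarrow> 'o" where "source a = fst a"
definition target :: "'o \<times> 'o \<times> 'm \<Rightarrow> 'o" where "target a = fst (snd a)"
definition mor :: "'o \<times> 'o \<times> 'm \<Rightarrow> 'm" where "mor a = snd (snd a)"

lemma arrow_simps [simp]: "source (arrow X Y f) = X" "target (arrow X Y f) = Y" "mor (arrow X Y f) = f"
  by (simp_all add: arrow_def source_def target_def mor_def)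

lemma arrow_eqI: "source a = source b \<Longrightarrow> target a = target b \<Longrightarrow> mor a = mor b \<Longrightarrow> a = b"
  by (simp add: source_def target_def mor_def prod_eq_iff)

context linear_category begin

lemma zero_in_Hom: "0 \<in> Hom C X Y" by (rule subspace_0[OF subspace_Hom])
lemma scale_in_Hom: "f \<in> Hom C X Y \<Longrightarrow> a \<odot> f \<in> Hom C X Y" by (rule subspace_scale[OF subspace_Hom])
lemma add_in_Hom: "f \<in> Hom C X Y \<Longrightarrow> g \<in> Hom C X Y \<Longrightarrow> f + g \<in> Hom C X Y" by (rule subspace_add[OF subspace_Hom])
lemma diff_in_Hom: "f \<in> Hom C X Y \<Longrightarrow> g \<in> Hom C X Y \<Longrightarrow> f - g \<in> Hom C X Y" by (rule subspace_diff[OF subspace_Hom])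
lemma sum_in_Hom: "(\<And>i. i \<in> I \<Longrightarrow> f i \<in> Hom C X Y) \<Longrightarrow> sum f I \<in> Hom C X Y" by (rule subspace_sum[OF subspace_Hom])

lemma zero_comp: "f \<in> Hom C X Y \<Longrightarrow> 0 \<cdot> f = 0"
  using comp_scale_left[OF zero_in_Hom, of f X Y 0] by simp
lemma comp_zero: "f \<in> Hom C X Y \<Longrightarrow> f \<cdot> 0 = 0"
  using comp_scale_right[OF _ zero_in_Hom, of f X Y 0] by simp

lemma comp_diff_right: "\<lbrakk>g \<in> Hom C Y Z; f \<in> Hom C X Y; f' \<in> Hom C X Y\<rbrakk> \<Longrightarrow> g \<cdot> (f - f') = (g \<cdot> f) - (g \<cdot> f')"
  using comp_add_right[of g Y Z "f - f'" X f'] by (simp add: diff_in_Hom algebra_simps)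

lemma comp_sum_left: "\<lbrakk>\<And>i. i \<in> I \<Longrightarrow> g i \<in> Hom C Y Z; f \<in> Hom C X Y\<rbrakk> \<Longrightarrow> sum g I \<cdot> f = (\<Sum>i\<in>I. g i \<cdot> f)"
proof (induction I rule: infinite_finite_induct)
  case (insert i I)
  then show ?case using comp_add_left[of "g i" Y Z "sum g I" f X] by (simp add: sum_in_Hom)
qed (simp_all add: zero_comp)

lemma comp_sum_right: "\<lbrakk>g \<in> Hom C Y Z; \<And>i. i \<in> I \<Longrightarrow> f i \<in> Hom C X Y\<rbrakk> \<Longrightarrow> g \<cdot> sum f I = (\<Sum>i\<in>I. g \<cdot> f i)"
proof (induction I rule: infinite_finite_induct)
  case (insert i I)
  then show ?case using comp_add_right[of g Y Z "f i" X "sum f I"] by (simp add: sum_in_Hom)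
qed (simp_all add: comp_zero)

lemma inverse_mor_inv_mor:
  assumes "iso C X Y f"
  shows "inverse_mor C X Y f (inv_mor C X Y f)"
proof -
  obtain g where g: "inverse_mor C X Y f g" using assms by (auto simp: iso_def)
  have "h = g" if h: "inverse_mor C X Y f h" for h
  proof -
    show ?thesis
      using g h comp_assoc[of h Y X f X g Y] comp_ide_right[of h Y X] comp_ide_left[of g Y X]
      by (simp add: inverse_mor_def)
  qed
  then show ?thesis unfolding inv_mor_def using g by (metis the_equality)
qed

lemma inv_mor_simps:
  assumes "iso C X Y f"
  shows "f \<in> Hom C X Y" "inv_mor C X Y f \<in> Hom C Y X"
    "inv_mor C X Y f \<cdot> f = ide X" "f \<cdot> inv_mor C X Y f = ide Y"
  using inverse_mor_inv_mor[OF assms] by (auto simp: inverse_mor_def)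

definition is_arrow where "is_arrow a \<longleftrightarrow> mor a \<in> Hom C (source a) (target a)"
definition ide_arrow where "ide_arrow X = arrow X X (ide X)"
text \<open>
  Composites of ill-typed arrows are sent to \<open>0\<close>, which lies in every Hom space and is absorbing. This
  makes composition associative without any side condition.
\<close>

definition comp_arrow where
  "comp_arrow a b = arrow (source b) (target a)
     (if is_arrow a \<and> is_arrow b \<and> source a = target b then mor a \<cdot> mor b else 0)"
definition inv_arrow where "inv_arrow X Y f = arrow Y X (inv_mor C X Y f)"

lemma is_arrow_arrow [simp]: "is_arrow (arrow X Y f) \<longleftrightarrow> f \<in> Hom C X Y"
  by (simp add: is_arrow_def)

lemma mor_comp_arrow: "\<lbrakk>is_arrow a; is_arrow b; source a = target b\<rbrakk> \<Longrightarrow> mor (comp_arrow a b) = mor a \<cdot> mor b"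
  by (simp add: comp_arrow_def)

lemma comp_arrow_typing [simp]: "source (comp_arrow a b) = source b" "target (comp_arrow a b) = target a"
  "is_arrow (comp_arrow a b)"
  using comp_in_Hom by (auto simp: comp_arrow_def zero_in_Hom is_arrow_def)

lemma comp_arrow_zero: "mor a = 0 \<or> mor b = 0 \<Longrightarrow> mor (comp_arrow a b) = 0"
  by (auto simp: comp_arrow_def is_arrow_def intro: comp_zero zero_comp)

lemma comp_arrow_assoc: "comp_arrow (comp_arrow a b) c = comp_arrow a (comp_arrow b c)"
proof (rule arrow_eqI)
  show "mor (comp_arrow (comp_arrow a b) c) = mor (comp_arrow a (comp_arrow b c))"
  proof (cases "is_arrow a \<and> is_arrow b \<and> is_arrow c \<and> source a = target b \<and> source b = target c")
    case True
    then have "(mor a \<cdot> mor b) \<cdot> mor c = mor a \<cdot> (mor b \<cdot> mor c)"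
      by (intro comp_assoc) (auto simp: is_arrow_def)
    with True show ?thesis by (simp add: mor_comp_arrow)
  next
    case False
    then have "mor (comp_arrow a b) = 0 \<or> \<not> is_arrow c \<or> source b \<noteq> target c"
      "mor (comp_arrow b c) = 0 \<or> \<not> is_arrow a \<or> source a \<noteq> target b"
      by (auto simp: comp_arrow_def)
    then have "mor (comp_arrow (comp_arrow a b) c) = 0" "mor (comp_arrow a (comp_arrow b c)) = 0"
      using comp_arrow_zero[of "comp_arrow a b" c] comp_arrow_zero[of a "comp_arrow b c"]
      by (auto simp: comp_arrow_def[of "comp_arrow a b"] comp_arrow_def[of a "comp_arrow b c"])
    then show ?thesis by simp
  qed
qed simp_all

lemma ide_arrow_simps [simp]: "source (ide_arrow X) = X" "target (ide_arrow X) = X" "mor (ide_arrow X) = ide X"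
  "is_arrow (ide_arrow X)"
  by (simp_all add: ide_arrow_def ide_in_Hom)

lemma inv_arrow_simps [simp]: "source (inv_arrow X Y f) = Y" "target (inv_arrow X Y f) = X"
  "mor (inv_arrow X Y f) = inv_mor C X Y f"
  by (simp_all add: inv_arrow_def)

lemma is_arrow_inv: "iso C X Y f \<Longrightarrow> is_arrow (inv_arrow X Y f)"
  by (simp add: inv_arrow_def inv_mor_simps)

lemma comp_arrow_ide: "is_arrow f \<Longrightarrow> source f = X \<Longrightarrow> comp_arrow f (ide_arrow X) = f"
  "is_arrow f \<Longrightarrow> target f = X \<Longrightarrow> comp_arrow (ide_arrow X) f = f"
  by (auto intro!: arrow_eqI simp: mor_comp_arrow) (auto simp: is_arrow_def intro: comp_ide_left comp_ide_right)

lemma comp_arrow_inv: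
  assumes "iso C X Y f"
  shows "comp_arrow (inv_arrow X Y f) (arrow X Y f) = ide_arrow X"
    "comp_arrow (arrow X Y f) (inv_arrow X Y f) = ide_arrow Y"
  using inv_mor_simps[OF assms] is_arrow_inv[OF assms]
  by (auto intro!: arrow_eqI simp: mor_comp_arrow)

end

context monoidal_linear_category begin

definition tens_arrow where
  "tens_arrow a b = arrow (source a \<otimes> source b) (target a \<otimes> target b) (mor a \<otimes>\<^sub>m mor b)"

lemma tens_arrow_simps [simp]:
  "source (tens_arrow a b) = source a \<otimes> source b" "target (tens_arrow a b) = target a \<otimes> target b"
  "mor (tens_arrow a b) = mor a \<otimes>\<^sub>m mor b"
  by (simp_all add: tens_arrow_def)

lemma is_arrow_tens: "is_arrow a \<Longrightarrow> is_arrow b \<Longrightarrow> is_arrow (tens_arrow a b)"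
  by (simp add: is_arrow_def tensor_in_Hom)

lemma tens_arrow_interchange:
  assumes "is_arrow f" "is_arrow g" "is_arrow h" "is_arrow k" "source f = target h" "source g = target k"
  shows "comp_arrow (tens_arrow f g) (tens_arrow h k) = tens_arrow (comp_arrow f h) (comp_arrow g k)"
proof (rule arrow_eqI)
  have "(mor f \<cdot> mor h) \<otimes>\<^sub>m (mor g \<cdot> mor k) = (mor f \<otimes>\<^sub>m mor g) \<cdot> (mor h \<otimes>\<^sub>m mor k)"
    by (rule interchange) (use assms in \<open>auto simp: is_arrow_def\<close>)
  then show "mor (comp_arrow (tens_arrow f g) (tens_arrow h k)) = mor (tens_arrow (comp_arrow f h) (comp_arrow g k))"
    using assms by (simp add: mor_comp_arrow is_arrow_tens)
qed simp_all

end

context ribbon_linear_category begin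

lemmas structure_isos = associator_iso left_unitor_iso right_unitor_iso braiding_iso twist_iso
lemmas structure_in_Hom = structure_isos[THEN inv_mor_simps(1)]

lemma arrow_naturality:
  assumes "is_arrow f" "is_arrow g" "is_arrow h"
  shows "\<alpha> (target f) (target g) (target h) \<cdot> ((mor f \<otimes>\<^sub>m mor g) \<otimes>\<^sub>m mor h)
      = (mor f \<otimes>\<^sub>m (mor g \<otimes>\<^sub>m mor h)) \<cdot> \<alpha> (source f) (source g) (source h)"
    "\<l> (target f) \<cdot> (ide \<one> \<otimes>\<^sub>m mor f) = mor f \<cdot> \<l> (source f)"
    "\<r> (target f) \<cdot> (mor f \<otimes>\<^sub>m ide \<one>) = mor f \<cdot> \<r> (source f)"
    "\<c> (target f) (target g) \<cdot> (mor f \<otimes>\<^sub>m mor g) = (mor g \<otimes>\<^sub>m mor f) \<cdot> \<c> (source f) (source g)"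
    "\<theta> (target f) \<cdot> mor f = mor f \<cdot> \<theta> (source f)"
  using assms associator_natural left_unitor_natural right_unitor_natural braiding_natural twist_natural
  by (auto simp: is_arrow_def)

sublocale arrows: balanced_category is_arrow source target ide_arrow comp_arrow "tensor C" "unit C" tens_arrow
  "\<lambda>X Y Z. arrow ((X \<otimes> Y) \<otimes> Z) (X \<otimes> Y \<otimes> Z) (\<alpha> X Y Z)"
  "\<lambda>X Y Z. inv_arrow ((X \<otimes> Y) \<otimes> Z) (X \<otimes> Y \<otimes> Z) (\<alpha> X Y Z)"
  "\<lambda>X. arrow (\<one> \<otimes> X) X (\<l> X)" "\<lambda>X. inv_arrow (\<one> \<otimes> X) X (\<l> X)"
  "\<lambda>X. arrow (X \<otimes> \<one>) X (\<r> X)" "\<lambda>X. inv_arrow (X \<otimes> \<one>) X (\<r> X)"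
  "\<lambda>X Y. arrow (X \<otimes> Y) (Y \<otimes> X) (\<c> X Y)" "\<lambda>X Y. inv_arrow (X \<otimes> Y) (Y \<otimes> X) (\<c> X Y)"
  "\<lambda>X. arrow X X (\<theta> X)" "\<lambda>X. inv_arrow X X (\<theta> X)"
  by unfold_locales
    (simp_all add: comp_arrow_assoc comp_arrow_ide comp_arrow_inv tens_arrow_interchange structure_isos
      is_arrow_tens is_arrow_inv structure_in_Hom, 
     (rule arrow_eqI; simp add: mor_comp_arrow is_arrow_tens is_arrow_inv structure_isos structure_in_Hom
        arrow_naturality tensor_ide pentagon triangle hexagon twist_tensor hexagon_inv[unfolded associator_inv_def])+)


subsection \<open>Bending strands\<close>

abbreviation "ev_arrow X \<equiv> arrow (X\<^sup>\<or> \<otimes> X) \<one> (ev X)"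
abbreviation "coev_arrow X \<equiv> arrow \<one> (X \<otimes> X\<^sup>\<or>) (coev X)"

lemmas arrow_typing = is_arrow_tens is_arrow_inv structure_isos structure_in_Hom ev_in_Hom coev_in_Hom

lemma ribbon_data_dual: "arrows.ribbon_data X (X\<^sup>\<or>) (ev_arrow X) (coev_arrow X)"
  unfolding arrows.ribbon_data_def arrows.dual_data_def
  by (intro conjI arrow_eqI)
    (simp_all add: arrow_typing mor_comp_arrow zigzag zigzag_dual[unfolded associator_inv_def]
      twist_dual[unfolded dual_mor_def associator_inv_def])

lemma dual_data_dual: "arrows.dual_data X (X\<^sup>\<or>) (ev_arrow X) (coev_arrow X)"
  using ribbon_data_dual by (simp add: arrows.ribbon_data_def)

lemma tev_arrow: "arrows.right_ev X (X\<^sup>\<or>) (ev_arrow X) = arrow (X \<otimes> X\<^sup>\<or>) \<one> (tev X)"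
  by (rule arrow_eqI) (simp_all add: arrows.right_ev_def tev_def mor_comp_arrow arrow_typing)

lemma tcoev_arrow: "arrows.right_coev X (X\<^sup>\<or>) (coev_arrow X) = arrow \<one> (X\<^sup>\<or> \<otimes> X) (tcoev X)"
  by (rule arrow_eqI) (simp_all add: arrows.right_coev_def tcoev_def mor_comp_arrow arrow_typing)

lemma tev_in_Hom: "tev X \<in> Hom C (X \<otimes> X\<^sup>\<or>) \<one>"
  using arrows.right_ev_typing(1)[of "ev_arrow X" X "X\<^sup>\<or>"] unfolding tev_arrow by (simp add: ev_in_Hom)

lemma tcoev_in_Hom: "tcoev X \<in> Hom C \<one> (X\<^sup>\<or> \<otimes> X)"
  using arrows.right_coev_typing(1)[of "coev_arrow X" X "X\<^sup>\<or>"] unfolding tcoev_arrow by (simp add: coev_in_Hom)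

text \<open>
  The bent morphisms, with the unit object removed by a unitor so that \<open>T\<close> itself is the target
  of a cap and the source of a cup.
\<close>

definition cap_left where
  "cap_left X T b = \<l> T \<cdot> (tev X \<otimes>\<^sub>m ide T) \<cdot> \<alpha>inv X (X\<^sup>\<or>) T \<cdot> (ide X \<otimes>\<^sub>m b)"
definition cup_left where
  "cup_left X T g = (ide X \<otimes>\<^sub>m g) \<cdot> \<alpha> X (X\<^sup>\<or>) T \<cdot> (coev X \<otimes>\<^sub>m ide T) \<cdot> inv_mor C (\<one> \<otimes> T) T (\<l> T)"
definition cap_right where
  "cap_right X T b = \<r> T \<cdot> (ide T \<otimes>\<^sub>m ev X) \<cdot> \<alpha> T (X\<^sup>\<or>) X \<cdot> (b \<otimes>\<^sub>m ide X)"
definition cup_right where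
  "cup_right X T g = (g \<otimes>\<^sub>m ide X) \<cdot> \<alpha>inv T (X\<^sup>\<or>) X \<cdot> (ide T \<otimes>\<^sub>m tcoev X) \<cdot> inv_mor C (T \<otimes> \<one>) T (\<r> T)"

abbreviation "tev_arrow X \<equiv> arrow (X \<otimes> X\<^sup>\<or>) \<one> (tev X)"
abbreviation "tcoev_arrow X \<equiv> arrow \<one> (X\<^sup>\<or> \<otimes> X) (tcoev X)"

lemmas structure_typing = arrow_typing tev_in_Hom tcoev_in_Hom

lemma cap_left_arrow:
  assumes "b \<in> Hom C S (X\<^sup>\<or> \<otimes> T)"
  shows "comp_arrow (arrow (\<one> \<otimes> T) T (\<l> T)) (comp_arrow (tens_arrow (tev_arrow X) (ide_arrow T))
      (comp_arrow (inv_arrow ((X \<otimes> X\<^sup>\<or>) \<otimes> T) (X \<otimes> X\<^sup>\<or> \<otimes> T) (\<alpha> X (X\<^sup>\<or>) T))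
        (tens_arrow (ide_arrow X) (arrow S (X\<^sup>\<or> \<otimes> T) b)))) = arrow (X \<otimes> S) T (cap_left X T b)"
  by (rule arrow_eqI) (simp_all add: assms structure_typing mor_comp_arrow cap_left_def associator_inv_def)

lemma cup_left_arrow:
  assumes "g \<in> Hom C (X\<^sup>\<or> \<otimes> T) S"
  shows "comp_arrow (tens_arrow (ide_arrow X) (arrow (X\<^sup>\<or> \<otimes> T) S g))
      (comp_arrow (arrow ((X \<otimes> X\<^sup>\<or>) \<otimes> T) (X \<otimes> X\<^sup>\<or> \<otimes> T) (\<alpha> X (X\<^sup>\<or>) T))
        (comp_arrow (tens_arrow (coev_arrow X) (ide_arrow T)) (inv_arrow (\<one> \<otimes> T) T (\<l> T))))
    = arrow T (X \<otimes> S) (cup_left X T g)"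
  by (rule arrow_eqI) (simp_all add: assms structure_typing mor_comp_arrow cup_left_def)

lemma cap_right_arrow:
  assumes "b \<in> Hom C S (T \<otimes> X\<^sup>\<or>)"
  shows "comp_arrow (arrow (T \<otimes> \<one>) T (\<r> T)) (comp_arrow (tens_arrow (ide_arrow T) (ev_arrow X))
      (comp_arrow (arrow ((T \<otimes> X\<^sup>\<or>) \<otimes> X) (T \<otimes> X\<^sup>\<or> \<otimes> X) (\<alpha> T (X\<^sup>\<or>) X))
        (tens_arrow (arrow S (T \<otimes> X\<^sup>\<or>) b) (ide_arrow X)))) = arrow (S \<otimes> X) T (cap_right X T b)"
  by (rule arrow_eqI) (simp_all add: assms structure_typing mor_comp_arrow cap_right_def)

lemma cup_right_arrow:
  assumes "g \<in> Hom C (T \<otimes> X\<^sup>\<or>) S"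
  shows "comp_arrow (tens_arrow (arrow (T \<otimes> X\<^sup>\<or>) S g) (ide_arrow X))
      (comp_arrow (inv_arrow ((T \<otimes> X\<^sup>\<or>) \<otimes> X) (T \<otimes> X\<^sup>\<or> \<otimes> X) (\<alpha> T (X\<^sup>\<or>) X))
        (comp_arrow (tens_arrow (ide_arrow T) (tcoev_arrow X)) (inv_arrow (T \<otimes> \<one>) T (\<r> T))))
    = arrow T (S \<otimes> X) (cup_right X T g)"
  by (rule arrow_eqI) (simp_all add: assms structure_typing mor_comp_arrow cup_right_def associator_inv_def)

lemma cap_left_in_Hom: "b \<in> Hom C S (X\<^sup>\<or> \<otimes> T) \<Longrightarrow> cap_left X T b \<in> Hom C (X \<otimes> S) T"
  using comp_arrow_typing(3) cap_left_arrow by (metis is_arrow_arrow)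
lemma cup_left_in_Hom: "g \<in> Hom C (X\<^sup>\<or> \<otimes> T) S \<Longrightarrow> cup_left X T g \<in> Hom C T (X \<otimes> S)"
  using comp_arrow_typing(3) cup_left_arrow by (metis is_arrow_arrow)
lemma cap_right_in_Hom: "b \<in> Hom C S (T \<otimes> X\<^sup>\<or>) \<Longrightarrow> cap_right X T b \<in> Hom C (S \<otimes> X) T"
  using comp_arrow_typing(3) cap_right_arrow by (metis is_arrow_arrow)
lemma cup_right_in_Hom: "g \<in> Hom C (T \<otimes> X\<^sup>\<or>) S \<Longrightarrow> cup_right X T g \<in> Hom C T (S \<otimes> X)"
  using comp_arrow_typing(3) cup_right_arrow by (metis is_arrow_arrow)

text \<open>
  The two unitors at \<open>T\<close> cancel.
\<close>

lemma cup_left_cap_left: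
  assumes b: "b \<in> Hom C S (X\<^sup>\<or> \<otimes> T)" and g: "g \<in> Hom C (X\<^sup>\<or> \<otimes> T) S"
  shows "(ide X \<otimes>\<^sub>m g) \<cdot> \<alpha> X (X\<^sup>\<or>) T \<cdot> (coev X \<otimes>\<^sub>m ide T) \<cdot> (tev X \<otimes>\<^sub>m ide T) \<cdot> \<alpha>inv X (X\<^sup>\<or>) T \<cdot> (ide X \<otimes>\<^sub>m b)
    = cup_left X T g \<cdot> cap_left X T b"
proof -
  note c = arrows.cancel_head[OF arrows.lui_lu[of T]]
  have "mor (comp_arrow (arrow T (X \<otimes> S) (cup_left X T g)) (arrow (X \<otimes> S) T (cap_left X T b)))
    = (ide X \<otimes>\<^sub>m g) \<cdot> \<alpha> X (X\<^sup>\<or>) T \<cdot> (coev X \<otimes>\<^sub>m ide T) \<cdot> (tev X \<otimes>\<^sub>m ide T) \<cdot> \<alpha>inv X (X\<^sup>\<or>) T \<cdot> (ide X \<otimes>\<^sub>m b)"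
    unfolding cap_left_arrow[OF b, symmetric] cup_left_arrow[OF g, symmetric]
    by (simp add: b g c structure_typing mor_comp_arrow associator_inv_def)
  then show ?thesis
    by (simp add: mor_comp_arrow cap_left_in_Hom[OF b] cup_left_in_Hom[OF g])
qed

lemma cup_right_cap_right:
  assumes b: "b \<in> Hom C S (T \<otimes> X\<^sup>\<or>)" and g: "g \<in> Hom C (T \<otimes> X\<^sup>\<or>) S"
  shows "(g \<otimes>\<^sub>m ide X) \<cdot> \<alpha>inv T (X\<^sup>\<or>) X \<cdot> (ide T \<otimes>\<^sub>m tcoev X) \<cdot> (ide T \<otimes>\<^sub>m ev X) \<cdot> \<alpha> T (X\<^sup>\<or>) X \<cdot> (b \<otimes>\<^sub>m ide X)
    = cup_right X T g \<cdot> cap_right X T b"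
proof -
  note c = arrows.cancel_head[OF arrows.rui_ru[of T]]
  have "mor (comp_arrow (arrow T (S \<otimes> X) (cup_right X T g)) (arrow (S \<otimes> X) T (cap_right X T b)))
    = (g \<otimes>\<^sub>m ide X) \<cdot> \<alpha>inv T (X\<^sup>\<or>) X \<cdot> (ide T \<otimes>\<^sub>m tcoev X) \<cdot> (ide T \<otimes>\<^sub>m ev X) \<cdot> \<alpha> T (X\<^sup>\<or>) X \<cdot> (b \<otimes>\<^sub>m ide X)"
    unfolding cap_right_arrow[OF b, symmetric] cup_right_arrow[OF g, symmetric]
    by (simp add: b g c structure_typing mor_comp_arrow associator_inv_def)
  then show ?thesis
    by (simp add: mor_comp_arrow cap_right_in_Hom[OF b] cup_right_in_Hom[OF g])
qed

lemma trace_cap_cup_left: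
  assumes b: "b \<in> Hom C S (X\<^sup>\<or> \<otimes> T)" and g: "g \<in> Hom C (X\<^sup>\<or> \<otimes> T) S"
  shows "tev T \<cdot> ((cap_left X T b \<cdot> cup_left X T g) \<otimes>\<^sub>m ide (T\<^sup>\<or>)) \<cdot> coev T = tev S \<cdot> ((g \<cdot> b) \<otimes>\<^sub>m ide (S\<^sup>\<or>)) \<cdot> coev S"
  using arg_cong[where f = mor, OF arrows.trace_rotate_left[OF dual_data_dual[of S] dual_data_dual[of T] ribbon_data_dual[of X],
      of "arrow S (X\<^sup>\<or> \<otimes> T) b" "arrow (X\<^sup>\<or> \<otimes> T) S g"]] b g
  unfolding tev_arrow cap_left_arrow[OF b] cup_left_arrow[OF g]
  by (simp add: structure_typing cap_left_in_Hom cup_left_in_Hom mor_comp_arrow)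

lemma trace_cap_cup_right:
  assumes b: "b \<in> Hom C S (T \<otimes> X\<^sup>\<or>)" and g: "g \<in> Hom C (T \<otimes> X\<^sup>\<or>) S"
  shows "tev T \<cdot> ((cap_right X T b \<cdot> cup_right X T g) \<otimes>\<^sub>m ide (T\<^sup>\<or>)) \<cdot> coev T = tev S \<cdot> ((g \<cdot> b) \<otimes>\<^sub>m ide (S\<^sup>\<or>)) \<cdot> coev S"
  using arg_cong[where f = mor, OF arrows.trace_rotate_right[OF dual_data_dual[of S] dual_data_dual[of T] ribbon_data_dual[of X],
      of "arrow S (T \<otimes> X\<^sup>\<or>) b" "arrow (T \<otimes> X\<^sup>\<or>) S g"]] b g
  unfolding tev_arrow tcoev_arrow cap_right_arrow[OF b] cup_right_arrow[OF g]
  by (simp add: structure_typing cap_right_in_Hom cup_right_in_Hom mor_comp_arrow)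

lemma cup_left_surj:
  assumes q: "q \<in> Hom C T (X \<otimes> S)"
  shows "\<exists>g\<in>Hom C (X\<^sup>\<or> \<otimes> T) S. cup_left X T g = q"
proof -
  let ?g = "comp_arrow (arrow (\<one> \<otimes> S) S (\<l> S)) (comp_arrow (tens_arrow (ev_arrow X) (ide_arrow S))
      (comp_arrow (inv_arrow ((X\<^sup>\<or> \<otimes> X) \<otimes> S) (X\<^sup>\<or> \<otimes> X \<otimes> S) (\<alpha> (X\<^sup>\<or>) X S))
        (tens_arrow (ide_arrow (X\<^sup>\<or>)) (arrow T (X \<otimes> S) q))))"
  have e: "?g = arrow (X\<^sup>\<or> \<otimes> T) S (mor ?g)" by (rule arrow_eqI) simp_all
  have "is_arrow ?g" by simp
  then have g: "mor ?g \<in> Hom C (X\<^sup>\<or> \<otimes> T) S" by (subst (asm) e) (simp only: is_arrow_arrow)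
  have "arrow T (X \<otimes> S) (cup_left X T (mor ?g)) = arrow T (X \<otimes> S) q"
    unfolding cup_left_arrow[OF g, symmetric] e[symmetric]
    by (rule arrows.cup_left_cap[OF dual_data_dual]) (simp_all add: q)
  with g show ?thesis by (metis arrow_simps(3))
qed

lemma cup_right_surj:
  assumes q: "q \<in> Hom C T (S \<otimes> X)"
  shows "\<exists>g\<in>Hom C (T \<otimes> X\<^sup>\<or>) S. cup_right X T g = q"
proof -
  let ?g = "comp_arrow (arrow (S \<otimes> \<one>) S (\<r> S)) (comp_arrow (tens_arrow (ide_arrow S) (tev_arrow X))
      (comp_arrow (arrow ((S \<otimes> X) \<otimes> X\<^sup>\<or>) (S \<otimes> X \<otimes> X\<^sup>\<or>) (\<alpha> S X (X\<^sup>\<or>)))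
        (tens_arrow (arrow T (S \<otimes> X) q) (ide_arrow (X\<^sup>\<or>)))))"
  have e: "?g = arrow (T \<otimes> X\<^sup>\<or>) S (mor ?g)" by (rule arrow_eqI) simp_all
  have "is_arrow ?g" by simp
  then have g: "mor ?g \<in> Hom C (T \<otimes> X\<^sup>\<or>) S" by (subst (asm) e) (simp only: is_arrow_arrow)
  have "arrow T (S \<otimes> X) (cup_right X T (mor ?g)) = arrow T (S \<otimes> X) q"
    unfolding cup_right_arrow[OF g, symmetric] e[symmetric]
    by (rule arrows.cup_right_cap[OF ribbon_data_dual, unfolded tev_arrow tcoev_arrow]) (simp_all add: q)
  with g show ?thesis by (metis arrow_simps(3))
qed

lemma cup_left_linear:
  assumes "g \<in> Hom C (X\<^sup>\<or> \<otimes> T) S" "g' \<in> Hom C (X\<^sup>\<or> \<otimes> T) S"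
  shows "cup_left X T (g + g') = cup_left X T g + cup_left X T g'" "cup_left X T (a \<odot> g) = a \<odot> cup_left X T g"
proof -
  let ?r = "comp_arrow (arrow ((X \<otimes> X\<^sup>\<or>) \<otimes> T) (X \<otimes> X\<^sup>\<or> \<otimes> T) (\<alpha> X (X\<^sup>\<or>) T))
        (comp_arrow (tens_arrow (coev_arrow X) (ide_arrow T)) (inv_arrow (\<one> \<otimes> T) T (\<l> T)))"
  have "is_arrow ?r" by simp
  then have r: "mor ?r \<in> Hom C T (X \<otimes> X\<^sup>\<or> \<otimes> T)" by (simp add: is_arrow_def)
  have c: "cup_left X T h = (ide X \<otimes>\<^sub>m h) \<cdot> mor ?r" for h
    by (simp add: cup_left_def structure_typing mor_comp_arrow)
  note t = tensor_in_Hom[OF ide_in_Hom[of X]]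
  show "cup_left X T (g + g') = cup_left X T g + cup_left X T g'"
    unfolding c tensor_add_right[OF ide_in_Hom assms] by (rule comp_add_left[OF t t r]) (fact assms)+
  show "cup_left X T (a \<odot> g) = a \<odot> cup_left X T g"
    unfolding c tensor_scale_right[OF ide_in_Hom assms(1)] by (rule comp_scale_left[OF t r]) (fact assms)
qed

lemma cup_right_linear:
  assumes "g \<in> Hom C (T \<otimes> X\<^sup>\<or>) S" "g' \<in> Hom C (T \<otimes> X\<^sup>\<or>) S"
  shows "cup_right X T (g + g') = cup_right X T g + cup_right X T g'" "cup_right X T (a \<odot> g) = a \<odot> cup_right X T g"
proof -
  let ?r = "comp_arrow (inv_arrow ((T \<otimes> X\<^sup>\<or>) \<otimes> X) (T \<otimes> X\<^sup>\<or> \<otimes> X) (\<alpha> T (X\<^sup>\<or>) X))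
        (comp_arrow (tens_arrow (ide_arrow T) (tcoev_arrow X)) (inv_arrow (T \<otimes> \<one>) T (\<r> T)))"
  have "is_arrow ?r" by simp
  then have r: "mor ?r \<in> Hom C T ((T \<otimes> X\<^sup>\<or>) \<otimes> X)" by (simp add: is_arrow_def)
  have c: "cup_right X T h = (h \<otimes>\<^sub>m ide X) \<cdot> mor ?r" for h
    by (simp add: cup_right_def structure_typing mor_comp_arrow associator_inv_def)
  note t = tensor_in_Hom[OF _ ide_in_Hom[of X]]
  show "cup_right X T (g + g') = cup_right X T g + cup_right X T g'"
    unfolding c tensor_add_left[OF assms ide_in_Hom] by (rule comp_add_left[OF t t r]) (fact assms)+
  show "cup_right X T (a \<odot> g) = a \<odot> cup_right X T g"
    unfolding c tensor_scale_left[OF assms(1) ide_in_Hom] by (rule comp_scale_left[OF t r]) (fact assms)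
qed

end

section \<open>Simple objects, dual bases and the resolution of the identity\<close>

lemma inverse_mor_sym: "inverse_mor C X Y f g \<Longrightarrow> inverse_mor C Y X g f"
  by (auto simp: inverse_mor_def)

lemma isomorphic_sym: "isomorphic C X Y \<Longrightarrow> isomorphic C Y X"
  unfolding isomorphic_def iso_def by (blast intro: inverse_mor_sym)

context linear_category begin

lemma isomorphic_refl: "isomorphic C X X"
  unfolding isomorphic_def iso_def inverse_mor_def using ide_in_Hom comp_ide_left by blast

lemma simple_ide_nonzero:
  assumes "simple C S"
  shows "ide S \<noteq> 0"
proof
  assume 0: "ide S = 0"
  have "f = 0" if "f \<in> Hom C S Y" for f Y
    using comp_ide_right[OF that] comp_zero[OF that] by (simp add: 0)
  moreover have "f = 0" if "f \<in> Hom C Y S" for f Y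
    using comp_ide_left[OF that] zero_comp[OF that] by (simp add: 0)
  ultimately have "zero_object C S"
    unfolding zero_object_def using zero_in_Hom by blast
  then show False using assms by (simp add: simple_def)
qed

lemma simple_scale_ide_inject:
  assumes "simple C S" "a \<odot> ide S = b \<odot> ide S"
  shows "a = b"
  using simple_ide_nonzero[OF assms(1)] assms(2) by simp

end

context abelian_linear_category begin

text \<open>
  The kernel of a nonzero \<open>f\<close> is not all of \<open>S\<close>, so it is zero because \<open>S\<close> is simple. Hence \<open>f\<close> is
  monic, and then it is invertible because \<open>T\<close> is simple.
\<close>

lemma schur_iso:
  assumes S: "simple C S" and T: "simple C T" and f: "f \<in> Hom C S T" "f \<noteq> 0"
  shows "iso C S T f"
proof -
  obtain K k where k: "is_kernel C K S T k f" using ex_kernel[OF f(1)] by blast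
  then have kH: "k \<in> Hom C K S" and fk: "f \<cdot> k = 0" by (auto simp: is_kernel_def)
  have univ: "\<exists>!h. h \<in> Hom C Z K \<and> k \<cdot> h = g" if "g \<in> Hom C Z S" "f \<cdot> g = 0" for Z g
    using k that unfolding is_kernel_def by blast
  have "monic C K S k"
    unfolding monic_def
  proof (intro conjI allI ballI impI kH)
    fix Z g h assume gh: "g \<in> Hom C Z K" "h \<in> Hom C Z K" "k \<cdot> g = k \<cdot> h"
    have "f \<cdot> k \<cdot> g = 0"
      using comp_assoc[OF f(1) kH gh(1)] fk zero_comp[OF gh(1)] by simp
    then show "g = h" using univ[OF comp_in_Hom[OF kH gh(1)]] gh by auto
  qed
  then have "zero_object C K \<or> iso C K S k" using S by (auto simp: simple_def)
  moreover have "\<not> iso C K S k"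
  proof
    assume i: "iso C K S k"
    note j = inv_mor_simps[OF i]
    have "f = f \<cdot> k \<cdot> inv_mor C K S k" using comp_ide_right[OF f(1)] j(4) by simp
    also have "\<dots> = 0" using comp_assoc[OF f(1) j(1) j(2)] fk zero_comp[OF j(2)] by simp
    finally show False using f(2) by simp
  qed
  ultimately have K: "zero_object C K" by simp
  have "monic C S T f"
    unfolding monic_def
  proof (intro conjI allI ballI impI f(1))
    fix Z g h assume gh: "g \<in> Hom C Z S" "h \<in> Hom C Z S" "f \<cdot> g = f \<cdot> h"
    have "f \<cdot> (g - h) = 0" using comp_diff_right[OF f(1) gh(1,2)] gh(3) by simp
    then obtain l where "l \<in> Hom C Z K" "k \<cdot> l = g - h"
      using univ[OF diff_in_Hom[OF gh(1,2)]] by blast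
    moreover have "Hom C Z K = {0}" using K by (simp add: zero_object_def)
    ultimately have "g - h = 0" using comp_zero[OF kH] by simp
    then show "g = h" by simp
  qed
  then have "zero_object C S \<or> iso C S T f" using T by (auto simp: simple_def)
  then show ?thesis using S by (auto simp: simple_def)
qed

lemma schur_zero:
  assumes "simple C S" "simple C T" "\<not> isomorphic C S T" "f \<in> Hom C S T"
  shows "f = 0"
  using schur_iso[OF assms(1,2,4)] assms(3) by (auto simp: isomorphic_def)

end

context semisimple_linear_category begin

lemma decompose:
  obtains n :: nat and F i p where "\<And>j. j < n \<Longrightarrow> simple C (F j)"
    "\<And>j. j < n \<Longrightarrow> i j \<in> Hom C (F j) Y" "\<And>j. j < n \<Longrightarrow> p j \<in> Hom C Y (F j)"
    "(\<Sum>j<n. i j \<cdot> p j) = ide Y"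
proof -
  obtain n F where F: "\<forall>j<n. simple C (F j)" "is_direct_sum C Y n F" using semisimple[of Y] by blast
  then obtain i p where "\<forall>j<n. i j \<in> Hom C (F j) Y \<and> p j \<in> Hom C Y (F j)" "(\<Sum>j<n. i j \<cdot> p j) = ide Y"
    unfolding is_direct_sum_def by (elim exE conjE)
  with F(1) show thesis by (intro that[of n F i p]) auto
qed

text \<open>
  By semisimplicity the identity of the source factors through simple objects.
\<close>

lemma eq_if_eq_on_simples:
  assumes f: "f \<in> Hom C Y Z" "f' \<in> Hom C Y Z"
    and eq: "\<And>T q. simple C T \<Longrightarrow> q \<in> Hom C T Y \<Longrightarrow> f \<cdot> q = f' \<cdot> q"
  shows "f = f'"
proof -
  obtain n :: nat and F i p where d: "\<And>j. j < n \<Longrightarrow> simple C (F j)"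
    "\<And>j. j < n \<Longrightarrow> i j \<in> Hom C (F j) Y" "\<And>j. j < n \<Longrightarrow> p j \<in> Hom C Y (F j)"
    "(\<Sum>j<n. i j \<cdot> p j) = ide Y" using decompose[of Y] by blast
  have e: "h = (\<Sum>j<n. (h \<cdot> i j) \<cdot> p j)" if h: "h \<in> Hom C Y Z" for h
  proof -
    have "h = h \<cdot> (\<Sum>j<n. i j \<cdot> p j)" using comp_ide_right[OF h] d(4) by simp
    also have "\<dots> = (\<Sum>j<n. h \<cdot> i j \<cdot> p j)"
      by (rule comp_sum_right[OF h]) (auto intro: comp_in_Hom[OF d(2) d(3)])
    also have "\<dots> = (\<Sum>j<n. (h \<cdot> i j) \<cdot> p j)"
      by (rule sum.cong) (auto simp: comp_assoc[OF h d(2) d(3)])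
    finally show ?thesis .
  qed
  have "(\<Sum>j<n. (f \<cdot> i j) \<cdot> p j) = (\<Sum>j<n. (f' \<cdot> i j) \<cdot> p j)"
    by (rule sum.cong[OF refl]) (simp add: eq[OF d(1,2)])
  then show ?thesis using e[OF f(1)] e[OF f(2)] by simp
qed

lemma eq_if_eq_on_representatives:
  assumes I: "simple_representatives C I" and f: "f \<in> Hom C Y Z" "f' \<in> Hom C Y Z"
    and eq: "\<And>T q. T \<in> I \<Longrightarrow> q \<in> Hom C T Y \<Longrightarrow> f \<cdot> q = f' \<cdot> q"
  shows "f = f'"
proof (rule eq_if_eq_on_simples[OF f])
  fix S q assume S: "simple C S" and q: "q \<in> Hom C S Y"
  obtain T u where T: "T \<in> I" "iso C S T u"
    using I S unfolding simple_representatives_def isomorphic_def by blast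
  note u = inv_mor_simps[OF T(2)]
  have e: "h \<cdot> q = (h \<cdot> q \<cdot> inv_mor C S T u) \<cdot> u" if h: "h \<in> Hom C Y Z" for h
    using comp_assoc[OF h comp_in_Hom[OF q u(2)] u(1)] comp_assoc[OF q u(2,1)] u(3) comp_ide_right[OF q]
    by simp
  show "f \<cdot> q = f' \<cdot> q"
    using e[OF f(1)] e[OF f(2)] eq[OF T(1) comp_in_Hom[OF q u(2)]] by simp
qed

end

context modular_tensor_category begin

subsection \<open>Endomorphisms of simple objects are scalars\<close>

primrec endo_power where
  "endo_power S f 0 = ide S"
| "endo_power S f (Suc n) = f \<cdot> endo_power S f n"

text \<open>
  Horner evaluation of a polynomial at the endomorphism \<open>f\<close>.
\<close>

definition poly_endo where
  "poly_endo S f p = fold_coeffs (\<lambda>a h. a \<odot> ide S + (f \<cdot> h)) p 0"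

lemma endo_power_in_Hom: "f \<in> Hom C S S \<Longrightarrow> endo_power S f n \<in> Hom C S S"
  by (induction n) (auto intro: ide_in_Hom comp_in_Hom)

lemma poly_endo_0 [simp]: "poly_endo S f 0 = 0" by (simp add: poly_endo_def)

lemma poly_endo_pCons:
  assumes "f \<in> Hom C S S"
  shows "poly_endo S f (pCons a p) = a \<odot> ide S + (f \<cdot> poly_endo S f p)"
  using comp_zero[OF assms] by (cases "p = 0 \<and> a = 0") (auto simp: poly_endo_def fold_coeffs_pCons_not_0_0_eq)

lemma poly_endo_in_Hom: "f \<in> Hom C S S \<Longrightarrow> poly_endo S f p \<in> Hom C S S"
  by (induction p) (auto simp: poly_endo_pCons intro!: zero_in_Hom add_in_Hom scale_in_Hom ide_in_Hom comp_in_Hom)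

lemma poly_endo_add: "f \<in> Hom C S S \<Longrightarrow> poly_endo S f (p + q) = poly_endo S f p + poly_endo S f q"
proof (induction p q rule: poly_induct2)
  case (pCons a p b q)
  then show ?case
    using comp_add_right[of f S S "poly_endo S f p" S "poly_endo S f q"]
    by (simp add: poly_endo_pCons poly_endo_in_Hom scale_left_distrib)
qed simp

lemma poly_endo_smult: "f \<in> Hom C S S \<Longrightarrow> poly_endo S f (smult c p) = c \<odot> poly_endo S f p"
proof (induction p)
  case (pCons a p)
  then show ?case
    using comp_scale_right[of f S S "poly_endo S f p" S c]
    by (simp add: poly_endo_pCons poly_endo_in_Hom scale_right_distrib)
qed simp

lemma poly_endo_monom: "f \<in> Hom C S S \<Longrightarrow> poly_endo S f (monom c n) = c \<odot> endo_power S f n"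
proof (induction n)
  case 0 then show ?case by (simp add: monom_0 poly_endo_pCons comp_zero)
next
  case (Suc n)
  then show ?case
    using comp_scale_right[of f S S "endo_power S f n" S c]
    by (simp add: monom_Suc poly_endo_pCons endo_power_in_Hom)
qed

lemma poly_endo_sum: "f \<in> Hom C S S \<Longrightarrow> poly_endo S f (sum g A) = (\<Sum>i\<in>A. poly_endo S f (g i))"
  by (induction A rule: infinite_finite_induct) (auto simp: poly_endo_add)

text \<open>
  Either two powers of \<open>f\<close> coincide, or the infinitely many powers are linearly dependent in the
  finite-dimensional space of endomorphisms; both give a polynomial relation.
\<close>

lemma ex_annihilating_poly:
  assumes f: "f \<in> Hom C S S"
  shows "\<exists>p. p \<noteq> 0 \<and> poly_endo S f p = 0"
proof (cases "inj (endo_power S f)")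
  case False
  then obtain m n where mn: "m \<noteq> n" "endo_power S f m = endo_power S f n" by (auto simp: inj_def)
  let ?p = "monom (1::'k) m + smult (-1) (monom 1 n)"
  have "poly.coeff ?p m \<noteq> 0" using mn(1) by simp
  then have "?p \<noteq> 0" by (metis coeff_0)
  moreover have "poly_endo S f ?p = 0"
    unfolding poly_endo_add[OF f] poly_endo_smult[OF f] poly_endo_monom[OF f] by (simp add: mn(2))
  ultimately show ?thesis by blast
next
  case True
  obtain B where B: "finite B" "span B = Hom C S S" using finite_dim_Hom by blast
  have "infinite (range (endo_power S f))" using True by (simp add: finite_image_iff)
  moreover have "range (endo_power S f) \<subseteq> span B" using B(2) endo_power_in_Hom[OF f] by auto
  ultimately have "dependent (range (endo_power S f))"
    using independent_span_bound[OF B(1)] by blast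
  then obtain t u v where t: "finite t" "t \<subseteq> range (endo_power S f)" "(\<Sum>w\<in>t. u w \<odot> w) = 0" "v \<in> t" "u v \<noteq> 0"
    unfolding dependent_explicit by blast
  let ?i = "inv (endo_power S f)"
  have i: "endo_power S f (?i w) = w" if "w \<in> t" for w using that t(2) by (simp add: f_inv_into_f subsetD)
  let ?p = "\<Sum>w\<in>t. monom (u w) (?i w)"
  have "poly.coeff ?p (?i v) = (\<Sum>w\<in>t. if w = v then u w else 0)"
    unfolding coeff_sum coeff_monom by (rule sum.cong) (use i t(4) in \<open>auto, metis\<close>)
  also have "\<dots> = u v" using t(1,4) by simp
  finally have "?p \<noteq> 0" using t(5) by (metis coeff_0)
  moreover have "poly_endo S f ?p = 0"
    using t(3) i by (simp add: poly_endo_sum[OF f] poly_endo_monom[OF f])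
  ultimately show ?thesis by blast
qed

text \<open>
  Take a root \<open>x\<close> of a polynomial annihilating \<open>f\<close>. If \<open>f - x id\<close> is not zero, it is invertible by
  Schur's lemma, so the complementary factor, of smaller degree, annihilates \<open>f\<close> as well.
\<close>

lemma simple_endo_scalar:
  assumes S: "simple C S" and f: "f \<in> Hom C S S"
  shows "\<exists>a. f = a \<odot> ide S"
proof -
  have "p \<noteq> 0 \<Longrightarrow> poly_endo S f p = 0 \<Longrightarrow> ?thesis" for p
  proof (induction "degree p" arbitrary: p)
    case 0
    then obtain c where p: "p = [:c:]" "c \<noteq> 0" by (metis degree_eq_zeroE pCons_eq_0_iff)
    then have "c \<odot> ide S = 0" using 0 comp_zero[OF f] by (simp add: poly_endo_pCons[OF f])
    then show ?case using p(2) simple_ide_nonzero[OF S] by simp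
  next
    case (Suc n)
    obtain x where "poly p x = 0" using alg_closed_imp_poly_has_root[of p] Suc(2) by auto
    then obtain q where q: "p = [:-x, 1:] * q" by (auto simp: poly_eq_0_iff_dvd elim: dvdE)
    have q0: "q \<noteq> 0" using q Suc.prems by auto
    have "degree p = degree [:-x, 1:] + degree q" unfolding q by (rule degree_mult_eq) (use q0 in auto)
    then have dq: "n = degree q" using Suc(2) by simp
    define g where "g = f - x \<odot> ide S"
    have g: "g \<in> Hom C S S" unfolding g_def by (intro diff_in_Hom scale_in_Hom ide_in_Hom f)
    let ?h = "poly_endo S f q"
    have h: "?h \<in> Hom C S S" by (rule poly_endo_in_Hom[OF f])
    have p': "p = smult (-x) q + pCons 0 q" using q by simp
    have "f \<cdot> ?h = (g + x \<odot> ide S) \<cdot> ?h" by (simp add: g_def)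
    also have "\<dots> = (g \<cdot> ?h) + x \<odot> ?h"
      using comp_add_left[OF g scale_in_Hom[OF ide_in_Hom] h] comp_scale_left[OF ide_in_Hom h] comp_ide_left[OF h] by simp
    finally have gh: "g \<cdot> ?h = 0"
      using Suc.prems(2) unfolding p' poly_endo_add[OF f] poly_endo_smult[OF f] poly_endo_pCons[OF f] by simp
    show ?case
    proof (cases "g = 0")
      case True then show ?thesis by (auto simp: g_def)
    next
      case False
      note i = inv_mor_simps[OF schur_iso[OF S S g False]]
      have "?h = (inv_mor C S S g \<cdot> g) \<cdot> ?h" using i(3) comp_ide_left[OF h] by simp
      also have "\<dots> = 0" using comp_assoc[OF i(2,1) h] gh comp_zero[OF i(2)] by simp
      finally show ?thesis using Suc.hyps(1)[OF dq q0] by blast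
    qed
  qed
  then show ?thesis using ex_annihilating_poly[OF f] by blast
qed

subsection \<open>Dual bases\<close>

lemma Hom_basis_finite:
  assumes "Hom_basis C X Y B" shows "finite B"
proof -
  obtain B' where "finite B'" "span B' = Hom C X Y" using finite_dim_Hom by blast
  then show ?thesis using assms independent_span_bound[of B' B] by (auto simp: Hom_basis_def)
qed

text \<open>
  A morphism to \<open>S\<close> is detected by simple objects, and those not isomorphic to \<open>S\<close> have no nonzero morphism to it.
\<close>

lemma eq_if_eq_on_basis:
  assumes S: "simple C S" and B: "Hom_basis C S W B"
    and g: "g \<in> Hom C W S" "g' \<in> Hom C W S" and eq: "\<And>b. b \<in> B \<Longrightarrow> g \<cdot> b = g' \<cdot> b"
  shows "g = g'"
proof (rule eq_if_eq_on_simples[OF g])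
  have BH: "B \<subseteq> Hom C S W" "span B = Hom C S W" using B by (auto simp: Hom_basis_def)
  have eqS: "g \<cdot> h = g' \<cdot> h" if "h \<in> Hom C S W" for h
  proof -
    have "h \<in> span B" using that BH by simp
    then have "h \<in> Hom C S W \<and> g \<cdot> h = g' \<cdot> h"
    proof (induction rule: span_induct_alt)
      case base show ?case using comp_zero g zero_in_Hom by metis
    next
      case (step c b h)
      have b: "b \<in> Hom C S W" using step BH by auto
      show ?case
        using step eq[OF step(1)] comp_add_right[OF g(1) scale_in_Hom[OF b], of h c] comp_add_right[OF g(2) scale_in_Hom[OF b], of h c]
          comp_scale_right[OF g(1) b] comp_scale_right[OF g(2) b] by (auto intro: add_in_Hom scale_in_Hom b)
    qed
    then show ?thesis by simp
  qed
  fix T q assume T: "simple C T" and q: "q \<in> Hom C T W"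
  show "g \<cdot> q = g' \<cdot> q"
  proof (cases "isomorphic C T S")
    case True
    then obtain u where "iso C T S u" by (auto simp: isomorphic_def)
    note u = inv_mor_simps[OF this]
    have e: "h \<cdot> q = (h \<cdot> q \<cdot> inv_mor C T S u) \<cdot> u" if h: "h \<in> Hom C W S" for h
      using comp_assoc[OF h comp_in_Hom[OF q u(2)] u(1)] comp_assoc[OF q u(2,1)] u(3) comp_ide_right[OF q]
      by simp
    show ?thesis using e[OF g(1)] e[OF g(2)] eqS[OF comp_in_Hom[OF q u(2)]] by simp
  next
    case False
    then show ?thesis using schur_zero[OF T S False comp_in_Hom[OF g(1) q]] schur_zero[OF T S False comp_in_Hom[OF g(2) q]] by simp
  qed
qed

text \<open>
  A decomposition of \<open>W\<close> yields one basis of \<open>Hom(S, W)\<close> with an obvious dual basis: the inclusions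
  \<open>i j \<circ> u j\<close> and the projections \<open>v j \<circ> p j\<close> of the summands isomorphic to \<open>S\<close>. The dual basis of
  \<open>B\<close> is obtained from these projections by expanding the inclusions in \<open>B\<close>.
\<close>

lemma ex_dual_vector:
  assumes S: "simple C S" and B: "Hom_basis C S W B" and b: "b \<in> B"
  shows "\<exists>g\<in>Hom C W S. \<forall>b'\<in>B. g \<cdot> b' = (if b' = b then ide S else 0)"
proof -
  have BH: "B \<subseteq> Hom C S W" "span B = Hom C S W" "independent B" using B by (auto simp: Hom_basis_def)
  obtain n :: nat and F i p where d: "\<And>j. j < n \<Longrightarrow> simple C (F j)"
    "\<And>j. j < n \<Longrightarrow> i j \<in> Hom C (F j) W" "\<And>j. j < n \<Longrightarrow> p j \<in> Hom C W (F j)"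
    "(\<Sum>j<n. i j \<cdot> p j) = ide W" using decompose[of W] by blast
  define J where "J = {j. j < n \<and> isomorphic C S (F j)}"
  have Jn: "J \<subseteq> {..<n}" by (auto simp: J_def)
  define u where "u j = (SOME f. iso C S (F j) f)" for j
  have u: "iso C S (F j) (u j)" if "j \<in> J" for j
    using that unfolding J_def isomorphic_def u_def by (blast intro: someI)
  note u' = inv_mor_simps[OF u]
  define v where "v j = inv_mor C S (F j) (u j)" for j
  have iu: "i j \<cdot> u j \<in> Hom C S W" if "j \<in> J" for j using that by (intro comp_in_Hom[OF d(2) u'(1)]) (simp_all add: J_def)
  have vp: "v j \<cdot> p j \<in> Hom C W S" if "j \<in> J" for j unfolding v_def using that by (intro comp_in_Hom[OF u'(2) d(3)]) (simp_all add: J_def)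
  define g where "g = (\<Sum>j\<in>J. representation B (i j \<cdot> u j) b \<odot> (v j \<cdot> p j))"
  have "g \<cdot> b' = (if b' = b then ide S else 0)" if b': "b' \<in> B" for b'
  proof -
    have bH: "b' \<in> Hom C S W" using b' BH by auto
    have "\<exists>l. (v j \<cdot> p j) \<cdot> b' = l \<odot> ide S" if "j \<in> J" for j
      by (rule simple_endo_scalar[OF S comp_in_Hom[OF vp[OF that] bH]])
    then obtain l where l: "\<And>j. j \<in> J \<Longrightarrow> (v j \<cdot> p j) \<cdot> b' = l j \<odot> ide S" by metis
    have t: "i j \<cdot> p j \<cdot> b' = (if j \<in> J then l j \<odot> (i j \<cdot> u j) else 0)" if j: "j < n" for j
    proof (cases "j \<in> J")
      case True
      note pb = comp_in_Hom[OF d(3)[OF j] bH]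
      have "p j \<cdot> b' = u j \<cdot> (v j \<cdot> p j \<cdot> b')"
        using comp_assoc[OF u'(1,2)[OF True] pb] u'(4)[OF True] comp_ide_left[OF pb] by (simp add: v_def)
      also have "v j \<cdot> p j \<cdot> b' = l j \<odot> ide S"
        using l[OF True] comp_assoc[OF u'(2)[OF True] d(3)[OF j] bH] by (simp add: v_def)
      also have "u j \<cdot> l j \<odot> ide S = l j \<odot> u j"
        using comp_scale_right[OF u'(1)[OF True] ide_in_Hom] comp_ide_right[OF u'(1)[OF True]] by simp
      finally show ?thesis
        using True comp_scale_right[OF d(2)[OF j] u'(1)[OF True]] by simp
    next
      case False
      then have "p j \<cdot> b' = 0"
        using schur_zero[OF S d(1)[OF j] _ comp_in_Hom[OF d(3)[OF j] bH]] j by (simp add: J_def)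
      then show ?thesis using False comp_zero[OF d(2)[OF j]] by simp
    qed
    have "b' = (\<Sum>j<n. i j \<cdot> p j) \<cdot> b'" using d(4) comp_ide_left[OF bH] by simp
    also have "\<dots> = (\<Sum>j<n. (i j \<cdot> p j) \<cdot> b')"
      by (rule comp_sum_left[OF _ bH]) (auto intro: comp_in_Hom[OF d(2,3)])
    also have "\<dots> = (\<Sum>j<n. if j \<in> J then l j \<odot> (i j \<cdot> u j) else 0)"
      by (rule sum.cong) (auto simp: t comp_assoc[OF d(2,3) bH])
    also have "\<dots> = (\<Sum>j\<in>J. l j \<odot> (i j \<cdot> u j))"
      using Jn by (simp add: sum.If_cases inf_absorb2 Int_absorb1)
    finally have b'e: "b' = (\<Sum>j\<in>J. l j \<odot> (i j \<cdot> u j))" .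
    have sp: "l j \<odot> (i j \<cdot> u j) \<in> span B" "i j \<cdot> u j \<in> span B" if "j \<in> J" for j
      using iu[OF that] BH(2) scale_in_Hom by auto
    have "representation B b' b = (\<Sum>j\<in>J. l j * representation B (i j \<cdot> u j) b)"
      by (subst b'e, subst representation_sum[OF BH(3)]) (auto simp: sp representation_scale[OF BH(3)])
    then have r: "(\<Sum>j\<in>J. l j * representation B (i j \<cdot> u j) b) = (if b' = b then 1 else 0)"
      using representation_basis[OF BH(3) b'] by auto
    have "g \<cdot> b' = (\<Sum>j\<in>J. (representation B (i j \<cdot> u j) b \<odot> (v j \<cdot> p j)) \<cdot> b')"
      unfolding g_def by (rule comp_sum_left[OF _ bH]) (auto intro: scale_in_Hom vp)
    also have "\<dots> = (\<Sum>j\<in>J. (l j * representation B (i j \<cdot> u j) b) \<odot> ide S)"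
      by (rule sum.cong) (auto simp: comp_scale_left[OF vp bH] l mult.commute)
    also have "\<dots> = (if b' = b then ide S else 0)"
      by (simp flip: scale_sum_left add: r)
    finally show ?thesis .
  qed
  moreover have "g \<in> Hom C W S" unfolding g_def by (rule sum_in_Hom) (auto intro: scale_in_Hom vp)
  ultimately show ?thesis by blast
qed

lemma dual_vector:
  assumes S: "simple C S" and B: "Hom_basis C S W B" and b: "b \<in> B"
  shows "dual_vector C S W B b \<in> Hom C W S"
    and "b' \<in> B \<Longrightarrow> dual_vector C S W B b \<cdot> b' = (if b' = b then ide S else 0)"
proof -
  let ?P = "\<lambda>g. g \<in> Hom C W S \<and> (\<forall>b'\<in>B. g \<cdot> b' = (if b' = b then ide S else 0))"
  have "\<exists>!g. ?P g"
    using ex_dual_vector[OF assms] eq_if_eq_on_basis[OF S B] by (metis (no_types, lifting))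
  then have "?P (dual_vector C S W B b)" unfolding dual_vector_def by (rule theI')
  then show "dual_vector C S W B b \<in> Hom C W S"
    "b' \<in> B \<Longrightarrow> dual_vector C S W B b \<cdot> b' = (if b' = b then ide S else 0)" by auto
qed

lemma dual_vector_expansion:
  assumes S: "simple C S" and B: "Hom_basis C S W B" and g: "g \<in> Hom C W S"
    and a: "\<And>b. b \<in> B \<Longrightarrow> g \<cdot> b = a b \<odot> ide S"
  shows "g = (\<Sum>b\<in>B. a b \<odot> dual_vector C S W B b)"
proof (rule eq_if_eq_on_basis[OF S B g])
  note dv = dual_vector[OF S B]
  show "(\<Sum>b\<in>B. a b \<odot> dual_vector C S W B b) \<in> Hom C W S"
    by (rule sum_in_Hom) (auto intro: scale_in_Hom dv)
  fix b' assume b': "b' \<in> B"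
  have bH: "b' \<in> Hom C S W" using b' B by (auto simp: Hom_basis_def)
  have "(\<Sum>b\<in>B. a b \<odot> dual_vector C S W B b) \<cdot> b' = (\<Sum>b\<in>B. (a b \<odot> dual_vector C S W B b) \<cdot> b')"
    by (rule comp_sum_left[OF _ bH]) (auto intro: scale_in_Hom dv)
  also have "\<dots> = (\<Sum>b\<in>B. if b = b' then a b \<odot> ide S else 0)"
    by (rule sum.cong) (auto simp: comp_scale_left[OF dv(1) bH] dv(2) b')
  also have "\<dots> = a b' \<odot> ide S" using b' Hom_basis_finite[OF B] by simp
  finally show "g \<cdot> b' = (\<Sum>b\<in>B. a b \<odot> dual_vector C S W B b) \<cdot> b'" using a[OF b'] by simp
qed

subsection \<open>Resolution of the identity\<close>

lemma representatives_finite: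
  assumes I: "simple_representatives C I"
  shows "finite I"
proof -
  obtain I0 where I0: "finite I0" "simple_representatives C I0" using finitely_many_simples by blast
  define r where "r S = (SOME T. T \<in> I0 \<and> isomorphic C S T)" for S
  have r: "r S \<in> I0 \<and> isomorphic C S (r S)" if "S \<in> I" for S
  proof -
    have "\<exists>T. T \<in> I0 \<and> isomorphic C S T" using I I0(2) that unfolding simple_representatives_def by blast
    then show ?thesis unfolding r_def by (rule someI_ex)
  qed
  have "inj_on r I"
  proof
    fix S S' assume *: "S \<in> I" "S' \<in> I" "r S = r S'"
    have "simple C (r S)" using r[OF *(1)] I0(2) by (auto simp: simple_representatives_def)
    then have "\<exists>!T. T \<in> I \<and> isomorphic C (r S) T" using I by (auto simp: simple_representatives_def)
    then show "S = S'" using r[OF *(1)] r[OF *(2)] * isomorphic_sym by metis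
  qed
  moreover have "r ` I \<subseteq> I0" using r by auto
  ultimately show ?thesis using I0(1) by (metis finite_imageD finite_subset)
qed

lemma representatives_Hom_zero:
  assumes I: "simple_representatives C I" and T: "T \<in> I" "T' \<in> I" "T \<noteq> T'" and f: "f \<in> Hom C T T'"
  shows "f = 0"
proof (rule schur_zero[OF _ _ _ f])
  show s: "simple C T" "simple C T'" using I T by (auto simp: simple_representatives_def)
  have "\<exists>!U. U \<in> I \<and> isomorphic C T U" using I s by (auto simp: simple_representatives_def)
  then show "\<not> isomorphic C T T'" using T isomorphic_refl by metis
qed

text \<open>
  The general principle behind both formulas. The assumption \<open>rel\<close> says that the pairings
  \<open>cap b \<circ> cup g\<close> and \<open>g \<circ> b\<close> are proportional with ratio \<open>d S\<close> to \<open>d T\<close>; since the maps \<open>cup\<close> are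
  surjective, it is enough to compare both sides on morphisms \<open>cup g\<close>.
\<close>

lemma resolution_of_identity:
  assumes I: "simple_representatives C I" and S: "simple C S"
    and B: "\<And>T. T \<in> I \<Longrightarrow> Hom_basis C S (W T) (B T)"
    and cap: "\<And>T b. b \<in> Hom C S (W T) \<Longrightarrow> cap T b \<in> Hom C Y T"
    and cup: "\<And>T g. g \<in> Hom C (W T) S \<Longrightarrow> cup T g \<in> Hom C T Y"
    and cup_add: "\<And>T g g'. \<lbrakk>g \<in> Hom C (W T) S; g' \<in> Hom C (W T) S\<rbrakk> \<Longrightarrow> cup T (g + g') = cup T g + cup T g'"
    and cup_scale: "\<And>T g a. g \<in> Hom C (W T) S \<Longrightarrow> cup T (a \<odot> g) = a \<odot> cup T g"
    and cup_surj: "\<And>T q. q \<in> Hom C T Y \<Longrightarrow> \<exists>g\<in>Hom C (W T) S. cup T g = q"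
    and rel: "\<And>T b g a c. \<lbrakk>T \<in> I; b \<in> Hom C S (W T); g \<in> Hom C (W T) S; g \<cdot> b = a \<odot> ide S;
        cap T b \<cdot> cup T g = c \<odot> ide T\<rbrakk> \<Longrightarrow> d T * c = d S * a"
  shows "d S \<odot> ide Y = (\<Sum>T\<in>I. \<Sum>b\<in>B T. d T \<odot> (cup T (dual_vector C S (W T) (B T) b) \<cdot> cap T b))"
    (is "_ = ?R")
proof (rule eq_if_eq_on_representatives[OF I scale_in_Hom[OF ide_in_Hom]])
  let ?dv = "\<lambda>T. dual_vector C S (W T) (B T)"
  have BH: "b \<in> Hom C S (W T)" if "T \<in> I" "b \<in> B T" for T b
    using B[OF that(1)] that(2) by (auto simp: Hom_basis_def)
  note dv = dual_vector(1)[OF S B]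
  have t: "cup T (?dv T b) \<cdot> cap T b \<in> Hom C Y Y" if "T \<in> I" "b \<in> B T" for T b
    using that by (intro comp_in_Hom[OF cup cap] dv BH)
  show "?R \<in> Hom C Y Y" by (intro sum_in_Hom scale_in_Hom t)
  have cup_sum: "cup T (\<Sum>b\<in>D. a b \<odot> ?dv T b) = (\<Sum>b\<in>D. a b \<odot> cup T (?dv T b))" if "T \<in> I" "D \<subseteq> B T" for T D a
    using that(2)
  proof (induction D rule: infinite_finite_induct)
    case (infinite D)
    then show ?case using cup_scale[OF zero_in_Hom, of T 0] by simp
  next
    case empty
    then show ?case using cup_scale[OF zero_in_Hom, of T 0] by simp
  next
    case (insert x D)
    have D: "(\<Sum>b\<in>D. a b \<odot> ?dv T b) \<in> Hom C (W T) S"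
      using insert.prems by (intro sum_in_Hom scale_in_Hom dv that(1)) auto
    have x: "?dv T x \<in> Hom C (W T) S" using insert.prems by (intro dv that(1)) simp
    show ?case
      using insert cup_add[OF scale_in_Hom[OF x] D] cup_scale[OF x] by simp
  qed
  fix T q assume T: "T \<in> I" and q: "q \<in> Hom C T Y"
  have sT: "simple C T" using I T by (simp add: simple_representatives_def)
  obtain g where g: "g \<in> Hom C (W T) S" "q = cup T g" using cup_surj[OF q] by blast
  have "\<exists>a. g \<cdot> b = a \<odot> ide S" if "b \<in> B T" for b
    by (rule simple_endo_scalar[OF S comp_in_Hom[OF g(1) BH[OF T that]]])
  then obtain a where a: "\<And>b. b \<in> B T \<Longrightarrow> g \<cdot> b = a b \<odot> ide S" by metis
  have key: "(d T' \<odot> (cup T' (?dv T' b) \<cdot> cap T' b)) \<cdot> q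
      = (if T' = T then d S \<odot> a b \<odot> cup T (?dv T b) else 0)" if T': "T' \<in> I" and b: "b \<in> B T'" for T' b
  proof -
    note cu = cup[OF dv[OF T' b]] and ca = cap[OF BH[OF T' b]]
    have 1: "(d T' \<odot> (cup T' (?dv T' b) \<cdot> cap T' b)) \<cdot> q = d T' \<odot> (cup T' (?dv T' b) \<cdot> (cap T' b \<cdot> q))"
      by (simp add: comp_scale_left[OF t[OF T' b] q] comp_assoc[OF cu ca q])
    show ?thesis
    proof (cases "T' = T")
      case True
      obtain c where c: "cap T b \<cdot> cup T g = c \<odot> ide T"
        using simple_endo_scalar[OF sT comp_in_Hom[OF ca[unfolded True] q]] g(2) by blast
      have "d T * c = d S * a b" using rel[OF T _ g(1) a c] b BH[OF T' b] True by simp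
      moreover have "cup T (?dv T b) \<cdot> c \<odot> ide T = c \<odot> cup T (?dv T b)"
        using comp_scale_right[OF cu[unfolded True] ide_in_Hom] comp_ide_right[OF cu[unfolded True]] by simp
      ultimately show ?thesis using 1 True c g(2) by simp
    next
      case False
      then have "cap T' b \<cdot> q = 0"
        using representatives_Hom_zero[OF I T T' _ comp_in_Hom[OF ca q]] by simp
      then show ?thesis using False 1 comp_zero[OF cu] by simp
    qed
  qed
  have "?R \<cdot> q = (\<Sum>T'\<in>I. (\<Sum>b\<in>B T'. d T' \<odot> (cup T' (?dv T' b) \<cdot> cap T' b)) \<cdot> q)"
    by (rule comp_sum_left[where Z = Y, OF _ q]) (intro sum_in_Hom scale_in_Hom t)
  also have "\<dots> = (\<Sum>T'\<in>I. \<Sum>b\<in>B T'. (d T' \<odot> (cup T' (?dv T' b) \<cdot> cap T' b)) \<cdot> q)"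
    by (rule sum.cong[OF refl], rule comp_sum_left[where Z = Y, OF _ q]) (intro scale_in_Hom t)
  also have "\<dots> = (\<Sum>T'\<in>I. if T' = T then \<Sum>b\<in>B T. d S \<odot> a b \<odot> cup T (?dv T b) else 0)"
    by (rule sum.cong) (auto simp: key)
  also have "\<dots> = d S \<odot> (\<Sum>b\<in>B T. a b \<odot> cup T (?dv T b))"
    using T representatives_finite[OF I] by (simp add: scale_sum_right)
  also have "\<dots> = d S \<odot> q"
    using cup_sum[OF T order.refl, of a] dual_vector_expansion[OF S B[OF T] g(1) a] g(2) by simp
  finally show "(d S \<odot> ide Y) \<cdot> q = ?R \<cdot> q"
    using comp_scale_left[OF ide_in_Hom q] comp_ide_left[OF q] by simp
qed

text \<open>
  Endomorphisms of the unit are scalars, so the description in the definition of the trace determines a scalar, and the trace of a multiple of the identity can be read off.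
\<close>

lemma qdim_loop: "tev X \<cdot> ((a \<odot> ide X) \<otimes>\<^sub>m ide (X\<^sup>\<or>)) \<cdot> coev X = (a * qdim C X) \<odot> ide \<one>"
proof -
  have i: "ide X \<otimes>\<^sub>m ide (X\<^sup>\<or>) \<in> Hom C (X \<otimes> X\<^sup>\<or>) (X \<otimes> X\<^sup>\<or>)" by (intro tensor_in_Hom ide_in_Hom)
  note ic = comp_in_Hom[OF i coev_in_Hom]
  obtain c where c: "tev X \<cdot> (ide X \<otimes>\<^sub>m ide (X\<^sup>\<or>)) \<cdot> coev X = c \<odot> ide \<one>"
    using simple_endo_scalar[OF simple_unit comp_in_Hom[OF tev_in_Hom ic]] by blast
  have "qdim C X = c"
    unfolding qdim_def trace_def c using simple_scale_ide_inject[OF simple_unit] by blast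
  then show ?thesis
    using c tensor_scale_left[OF ide_in_Hom ide_in_Hom, of a X "X\<^sup>\<or>"] comp_scale_left[OF i coev_in_Hom, of a]
      comp_scale_right[OF tev_in_Hom ic, of a] by simp
qed

text \<open>
  The proportionality of the pairings is the rotation of traces, read off on scalars.
\<close>

theorem left_resolution:
  assumes I: "simple_representatives C I" and S: "S \<in> I"
    and B: "\<And>T. T \<in> I \<Longrightarrow> Hom_basis C S (X\<^sup>\<or> \<otimes> T) (B T)"
  shows "qdim C S \<odot> ide (X \<otimes> S) = (\<Sum>T\<in>I. \<Sum>b\<in>B T. qdim C T \<odot>
    (cup_left X T (dual_vector C S (X\<^sup>\<or> \<otimes> T) (B T) b) \<cdot> cap_left X T b))"
proof (rule resolution_of_identity[OF I _ B])
  show "simple C S" using I S by (simp add: simple_representatives_def)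
  fix T b g a c
  assume *: "b \<in> Hom C S (X\<^sup>\<or> \<otimes> T)" "g \<in> Hom C (X\<^sup>\<or> \<otimes> T) S" "g \<cdot> b = a \<odot> ide S" "cap_left X T b \<cdot> cup_left X T g = c \<odot> ide T"
  have "(c * qdim C T) \<odot> ide \<one> = (a * qdim C S) \<odot> ide \<one>"
    using trace_cap_cup_left[OF *(1,2)] *(3,4) by (simp add: qdim_loop)
  then show "qdim C T * c = qdim C S * a"
    using simple_scale_ide_inject[OF simple_unit] by (simp add: mult.commute)
qed (auto intro: cap_left_in_Hom cup_left_in_Hom cup_left_linear cup_left_surj)

theorem right_resolution:
  assumes I: "simple_representatives C I" and S: "S \<in> I"
    and B: "\<And>T. T \<in> I \<Longrightarrow> Hom_basis C S (T \<otimes> X\<^sup>\<or>) (B T)"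
  shows "qdim C S \<odot> ide (S \<otimes> X) = (\<Sum>T\<in>I. \<Sum>b\<in>B T. qdim C T \<odot>
    (cup_right X T (dual_vector C S (T \<otimes> X\<^sup>\<or>) (B T) b) \<cdot> cap_right X T b))"
proof (rule resolution_of_identity[OF I _ B])
  show "simple C S" using I S by (simp add: simple_representatives_def)
  fix T b g a c
  assume *: "b \<in> Hom C S (T \<otimes> X\<^sup>\<or>)" "g \<in> Hom C (T \<otimes> X\<^sup>\<or>) S" "g \<cdot> b = a \<odot> ide S" "cap_right X T b \<cdot> cup_right X T g = c \<odot> ide T"
  have "(c * qdim C T) \<odot> ide \<one> = (a * qdim C S) \<odot> ide \<one>"
    using trace_cap_cup_right[OF *(1,2)] *(3,4) by (simp add: qdim_loop)
  then show "qdim C T * c = qdim C S * a"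
    using simple_scale_ide_inject[OF simple_unit] by (simp add: mult.commute)
qed (auto intro: cap_right_in_Hom cup_right_in_Hom cup_right_linear cup_right_surj)

end

theorem lemma3p11:
  fixes C :: "('o, 'm::ab_group_add, 'k::alg_closed_field) ribbon_data" (structure)
    and Irr :: "'o set" and X S :: 'o
  assumes "modular_tensor_category C"
    and "simple_representatives C Irr"
    and "S \<in> Irr"
  shows "(\<forall>B. (\<forall>T\<in>Irr. Hom_basis C S (X\<^sup>\<or> \<otimes> T) (B T)) \<longrightarrow>
      qdim C S \<odot> ide (X \<otimes> S) =
        (\<Sum>T\<in>Irr. \<Sum>b\<in>B T. qdim C T \<odot>
          ((ide X \<otimes>\<^sub>m dual_vector C S (X\<^sup>\<or> \<otimes> T) (B T) b)
            \<cdot> \<alpha> X (X\<^sup>\<or>) T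
            \<cdot> (coev X \<otimes>\<^sub>m ide T)
            \<cdot> (tev X \<otimes>\<^sub>m ide T)
            \<cdot> \<alpha>inv X (X\<^sup>\<or>) T
            \<cdot> (ide X \<otimes>\<^sub>m b))))
    \<and> (\<forall>B. (\<forall>T\<in>Irr. Hom_basis C S (T \<otimes> X\<^sup>\<or>) (B T)) \<longrightarrow>
      qdim C S \<odot> ide (S \<otimes> X) =
        (\<Sum>T\<in>Irr. \<Sum>b\<in>B T. qdim C T \<odot>
          ((dual_vector C S (T \<otimes> X\<^sup>\<or>) (B T) b \<otimes>\<^sub>m ide X)
            \<cdot> \<alpha>inv T (X\<^sup>\<or>) X
            \<cdot> (ide T \<otimes>\<^sub>m tcoev X)
            \<cdot> (ide T \<otimes>\<^sub>m ev X)
            \<cdot> \<alpha> T (X\<^sup>\<or>) X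
            \<cdot> (b \<otimes>\<^sub>m ide X))))"
proof -
  interpret modular_tensor_category C by fact
  have S: "simple C S" using assms(2,3) by (simp add: simple_representatives_def)
  show ?thesis
  proof (intro conjI allI impI)
    fix B assume B: "\<forall>T\<in>Irr. Hom_basis C S (X\<^sup>\<or> \<otimes> T) (B T)"
    then have bH: "b \<in> Hom C S (X\<^sup>\<or> \<otimes> T)" if "T \<in> Irr" "b \<in> B T" for T b
      using that by (auto simp: Hom_basis_def)
    show "qdim C S \<odot> ide (X \<otimes> S) =
        (\<Sum>T\<in>Irr. \<Sum>b\<in>B T. qdim C T \<odot>
          ((ide X \<otimes>\<^sub>m dual_vector C S (X\<^sup>\<or> \<otimes> T) (B T) b)
            \<cdot> \<alpha> X (X\<^sup>\<or>) T \<cdot> (coev X \<otimes>\<^sub>m ide T) \<cdot> (tev X \<otimes>\<^sub>m ide T) \<cdot> \<alpha>inv X (X\<^sup>\<or>) T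
            \<cdot> (ide X \<otimes>\<^sub>m b)))"
      using left_resolution[OF assms(2,3), of X B] B
      by (auto simp: cup_left_cap_left[OF bH dual_vector(1)[OF S]] intro!: sum.cong)
  next
    fix B assume B: "\<forall>T\<in>Irr. Hom_basis C S (T \<otimes> X\<^sup>\<or>) (B T)"
    then have bH: "b \<in> Hom C S (T \<otimes> X\<^sup>\<or>)" if "T \<in> Irr" "b \<in> B T" for T b
      using that by (auto simp: Hom_basis_def)
    show "qdim C S \<odot> ide (S \<otimes> X) =
        (\<Sum>T\<in>Irr. \<Sum>b\<in>B T. qdim C T \<odot>
          ((dual_vector C S (T \<otimes> X\<^sup>\<or>) (B T) b \<otimes>\<^sub>m ide X)
            \<cdot> \<alpha>inv T (X\<^sup>\<or>) X \<cdot> (ide T \<otimes>\<^sub>m tcoev X) \<cdot> (ide T \<otimes>\<^sub>m ev X) \<cdot> \<alpha> T (X\<^sup>\<or>) X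
            \<cdot> (b \<otimes>\<^sub>m ide X)))"
      using right_resolution[OF assms(2,3), of X B] B
      by (auto simp: cup_right_cap_right[OF bH dual_vector(1)[OF S]] intro!: sum.cong)
  qed
qed

end
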